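(* Let $q$ be a prime power and $m$ a positive integer. Let $\chi$ be a multiplicative character of $\mathbb{F}_{q^m}$ and $\psi$ an additive character of $\mathbb{F}_q$, such that not both of them are trivial. Let $\theta\in\mathbb{F}_{q^m}$ be a generator of the extension $\mathbb{F}_{q^m}/\mathbb{F}_q$, that is, $\mathbb{F}_{q^m}=\mathbb{F}_q(\theta)$. Then $$\left|\sum_{t\in\mathbb{F}_q}\chi(\theta+t)\psi(t)\right|\leq m\,q^{1/2}.$$
   Context: A multiplicative character of $\mathbb{F}_{q^m}$ is a group homomorphism $\chi:\mathbb{F}_{q^m}^*\to\{z\in\mathbb{C}:|z|=1\}$, extended to $\mathbb{F}_{q^m}$ by $\chi(0)=0$ if $\chi$ is nontrivial and $\chi(0)=1$ if $\chi$ is trivial. An additive character of $\mathbb{F}_q$ is a group homomorphism $\psi:(\mathbb{F}_q,+)\to\{z\in\mathbb{C}:|z|=1\}$. A character is trivial if it takes the value $1$ on the whole group. *)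

theory Defs
  imports Complex_Main "HOL-Algebra.Multiplicative_Group" "HOL-Algebra.Generated_Fields"
    "HOL-Number_Theory.Prime_Powers"
begin

definition circle_group :: "complex monoid" where
  "circle_group = \<lparr>carrier = {z. cmod z = 1}, monoid.mult = (*), one = 1\<rparr>"

definition trivial_character :: "('a, 'b) monoid_scheme \<Rightarrow> ('a \<Rightarrow> complex) \<Rightarrow> bool" where
  "trivial_character G \<chi> \<longleftrightarrow> (\<forall>x\<in>carrier G. \<chi> x = 1)"

definition trivial_multiplicative :: "('a, 'b) ring_scheme \<Rightarrow> ('a \<Rightarrow> complex) \<Rightarrow> bool" where
  "trivial_multiplicative F \<chi> \<longleftrightarrow> trivial_character (mult_of F) \<chi>"

definition trivial_additive :: "('a, 'b) ring_scheme \<Rightarrow> ('a \<Rightarrow> complex) \<Rightarrow> bool" where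
  "trivial_additive F \<psi> \<longleftrightarrow> trivial_character (add_monoid F) \<psi>"

text \<open>
  The second conjunct is the extension of the character from the unit group to zero.
  Values outside the carrier are left unconstrained.
\<close>

definition multiplicative_character :: "('a, 'b) ring_scheme \<Rightarrow> ('a \<Rightarrow> complex) \<Rightarrow> bool" where
  "multiplicative_character F \<chi> \<longleftrightarrow>
     \<chi> \<in> hom (mult_of F) circle_group \<and>
     \<chi> \<zero>\<^bsub>F\<^esub> = (if trivial_multiplicative F \<chi> then 1 else 0)"

definition additive_character :: "('a, 'b) ring_scheme \<Rightarrow> ('a \<Rightarrow> complex) \<Rightarrow> bool" where
  "additive_character F \<psi> \<longleftrightarrow> \<psi> \<in> hom (add_monoid F) circle_group"

end

theory Submission
  imports Defs "HOL-Algebra.Algebraic_Closure" "HOL-Computational_Algebra.Polynomial_FPS"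
    "HOL-Computational_Algebra.Fundamental_Theorem_Algebra"
begin

text \<open>
  The sum is minus the sum of the reciprocal roots \<open>\<omega>\<close> of an L-function. For a monic polynomial
  \<open>f = X^n + a X^(n-1) + \<dots>\<close> over \<open>K = \<F>\<^sub>q\<close> put \<open>\<Lambda> f = \<chi> (f \<theta>) \<psi> a\<close>; this is multiplicative in \<open>f\<close>, and since
  \<open>\<theta>\<close> generates the extension, the sum of \<open>\<Lambda> f\<close> over the monic \<open>f\<close> of degree \<open>n\<close> vanishes for \<open>n > m\<close>.
  Hence the generating function of these sums is a product of \<open>m\<close> factors \<open>1 - \<omega> T\<close>, and logarithmic
  differentiation gives \<open>S n = - (\<Sum>\<omega>. \<omega> ^ n)\<close>, where \<open>S n\<close> is the sum of
  \<open>\<Lambda> (\<Prod>j<n. X + t ^ (q ^ j))\<close> over the \<open>t\<close> in the field with \<open>q ^ n\<close> elements, and \<open>S 1\<close> is the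
  sum in question. It remains to see that \<open>S n = O (q ^ (n / 2))\<close> for infinitely many \<open>n\<close>.

  For \<open>n = 2 \<nu>\<close> with \<open>m\<close> dividing \<open>\<nu>\<close>, put \<open>P = q ^ \<nu>\<close> and \<open>d = q ^ m - 1\<close>. By the Stepanov--Bombieri
  method every pair \<open>(\<zeta>, c)\<close> with \<open>\<zeta> \<noteq> 0\<close> is the pair of values \<open>(\<Prod>j<n. \<theta> + t ^ (q ^ j), \<Sum>j<n. t ^ (q ^ j))\<close>
  for at most \<open>P\<^sup>2 / (d q) + O(P)\<close> of the \<open>t\<close>. As there are \<open>d q\<close> such pairs and \<open>P\<^sup>2\<close> points \<open>t\<close>, these
  upper bounds force the values to be equidistributed up to \<open>O(P)\<close>. In terms of \<open>s = t + \<theta>\<close>, the pair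
  is \<open>(h h^P, v + v^P)\<close> for polynomials \<open>h\<close>, \<open>v\<close> in \<open>s\<close> of degree less than \<open>P\<close>. The auxiliary polynomial
  is a combination \<open>W\<close> of the \<open>s^(l + P j) h^i v^k\<close> with coefficients in the field of \<open>q ^ m\<close> elements;
  at the points in question \<open>h^(d-1) W^P\<close> agrees with a polynomial of much smaller degree, which can
  be made to vanish identically by choice of the coefficients.
\<close>

hide_const (open) Polynomials.degree Polynomials.lead_coeff UnivPoly.coeff UnivPoly.monom UnivPoly.up
  Module.smult
  Divisibility.prime Divisibility.irreducible Coset.order Order.bottom Order.top

section \<open>Power sums\<close>

text \<open>The converse of Newton's identities: by the recurrence the generating series
  \<open>C\<close> of \<open>c\<close> satisfies X C' = S C. Factoring the polynomial
  \<open>C\<close> into terms 1 - w X gives the same equation with minus the sum of the series w X /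
  (1 - w X) in place of S, and \<open>C\<close> cancels.\<close>

lemma power_sums_of_recurrence:
  fixes c S :: "nat \<Rightarrow> complex"
  assumes c0: "c 0 = 1" and cm: "\<And>n. n > m \<Longrightarrow> c n = 0"
    and rec: "\<And>n. n > 0 \<Longrightarrow> of_nat n * c n = (\<Sum>r=1..n. S r * c (n - r))"
  shows "\<exists>w. \<forall>n>0. S n = - (\<Sum>i<m. w i ^ n)"
proof -
  \<comment> \<open>The reversed polynomial has degree exactly \<open>m\<close> because
    \<open>c 0 = 1\<close>; if \<open>C\<close> has smaller degree, the missing \<open>w i\<close>
    are zero.\<close>
  define p where "p = (\<Sum>i\<le>m. monom (c i) (m - i))"
  have coeff_p: "coeff p k = (if k \<le> m then c (m - k) else 0)" for k
  proof -
    have "coeff p k = (\<Sum>i\<le>m. if i = m - k \<and> k \<le> m then c i else 0)"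
      unfolding p_def by (auto simp: coeff_sum coeff_monom intro!: sum.cong)
    then show ?thesis by (auto simp: sum.delta)
  qed
  have deg: "degree p = m"
    by (rule antisym) (auto intro!: degree_le le_degree simp: coeff_p c0)
  have p0: "p \<noteq> 0" using coeff_p[of m] c0 by auto
  obtain A where A: "size A = m" "p = (\<Prod>x\<in>#A. [:- x, 1:])"
    using alg_closed_imp_factorization[OF p0] by (auto simp: deg coeff_p c0)
  obtain xs where xs: "mset xs = A" using ex_mset by blast
  define w where "w i = xs ! i" for i
  have refl: "coeff (reflect_poly p) n = c n" for n
    using cm[of n] by (auto simp: coeff_reflect_poly deg coeff_p)
  have p_prod: "p = (\<Prod>i<m. [:- w i, 1:])"
  proof -
    have "length xs = m" using A(1) by (simp add: xs[symmetric])
    moreover have "p = prod_list (map (\<lambda>x. [:- x, 1:]) xs)"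
      unfolding A(2) xs[symmetric] by (simp flip: prod_mset_prod_list)
    ultimately show ?thesis
      by (simp add: prod.list_conv_set_nth w_def atLeast0LessThan)
  qed
  define C where "C = Abs_fps c"
  define T where "T i = 1 - fps_const (w i) * fps_X" for i
  have C_prod: "C = (\<Prod>i<m. T i)"
  proof -
    have "C = fps_of_poly (reflect_poly p)"
      by (simp add: C_def fps_eq_iff refl)
    also have "\<dots> = (\<Prod>i<m. fps_of_poly (reflect_poly [:- w i, 1:]))"
      unfolding p_prod by (simp add: reflect_poly_prod fps_of_poly_prod)
    also have "\<dots> = (\<Prod>i<m. T i)"
    proof (rule prod.cong)
      fix i
      have "reflect_poly [:- w i, 1:] = [:1, - w i:]" by (simp add: reflect_poly_def cCons_def)
      then show "fps_of_poly (reflect_poly [:- w i, 1:]) = T i"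
        by (simp add: T_def fps_of_poly_pCons algebra_simps)
    qed simp
    finally show ?thesis .
  qed
  \<comment> \<open>The series w X / (1 - w X), which is minus X times the logarithmic derivative of
    1 - w X.\<close>
  define G where "G i = Abs_fps (\<lambda>n. if n = 0 then 0 else w i ^ n)" for i
  have GT: "G i * T i = fps_const (w i) * fps_X" for i
  proof (rule fps_ext)
    fix n
    have "G i * T i = G i - fps_const (w i) * (fps_X * G i)"
      by (simp add: T_def algebra_simps)
    then show "fps_nth (G i * T i) n = fps_nth (fps_const (w i) * fps_X) n"
      by (cases n) (auto simp: G_def)
  qed
  have log_deriv: "fps_X * fps_deriv (\<Prod>i\<in>I. T i) = - (\<Sum>i\<in>I. G i) * (\<Prod>i\<in>I. T i)"
    if "finite I" for I using that
  proof (induction I)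
    case (insert i I)
    have "fps_X * fps_deriv (T i) = fps_X * - fps_const (w i)" by (simp add: T_def)
    also have "\<dots> = - (G i * T i)" by (simp only: mult_minus_right mult.commute GT)
    finally have dT: "fps_X * fps_deriv (T i) = - (G i * T i)" .
    have "fps_X * fps_deriv (T i * (\<Prod>i\<in>I. T i)) = fps_X * fps_deriv (T i) * (\<Prod>i\<in>I. T i)
        + T i * (fps_X * fps_deriv (\<Prod>i\<in>I. T i))"
      by (simp add: algebra_simps)
    then have "fps_X * fps_deriv (T i * (\<Prod>i\<in>I. T i))
        = - (G i * T i) * (\<Prod>i\<in>I. T i) + T i * (- (\<Sum>i\<in>I. G i) * (\<Prod>i\<in>I. T i))"
      by (simp only: dT insert.IH)
    then show ?case using insert.hyps by (simp add: algebra_simps)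
  qed simp
  define SS where "SS = Abs_fps (\<lambda>n. if n = 0 then 0 else S n)"
  have "fps_X * fps_deriv C = SS * C"
  proof (rule fps_ext)
    fix n
    show "fps_nth (fps_X * fps_deriv C) n = fps_nth (SS * C) n"
    proof (cases "n = 0")
      case False
      have "fps_nth (SS * C) n = (\<Sum>r=0..n. (if r = 0 then 0 else S r) * c (n - r))"
        by (simp add: fps_mult_nth SS_def C_def)
      also have "\<dots> = (\<Sum>r=1..n. S r * c (n - r))"
        by (rule sum.mono_neutral_cong_right) auto
      finally show ?thesis using rec[of n] False
        by (simp add: C_def)
    qed (simp add: SS_def)
  qed
  moreover have "fps_X * fps_deriv C = - (\<Sum>i<m. G i) * C"
    using log_deriv[of "{..<m}"] by (simp add: C_prod)
  ultimately have "(SS + (\<Sum>i<m. G i)) * C = 0"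
    by (metis add.commute add.right_inverse distrib_right minus_mult_left)
  moreover have "C \<noteq> 0" using c0 by (auto simp: C_def fps_eq_iff intro: exI[of _ 0])
  ultimately have "SS = - (\<Sum>i<m. G i)" by (simp add: eq_neg_iff_add_eq_0)
  then have nth: "fps_nth SS n = - (\<Sum>i<m. fps_nth (G i) n)" for n
    by (simp add: fps_sum_nth)
  then have "S n = - (\<Sum>i<m. w i ^ n)" if "n > 0" for n
  proof -
    have "S n = fps_nth SS n" using that by (simp add: SS_def)
    also have "\<dots> = - (\<Sum>i<m. fps_nth (G i) n)" by (rule nth)
    finally show ?thesis using that by (simp add: G_def)
  qed
  then show ?thesis by blast
qed

text \<open>A fixed linear combination of consecutive power sums isolates a single value
  \<open>w\<close>: it equals the multiplicity of \<open>w\<close> times \<open>w ^ k\<close> times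
  a nonzero constant. As this is \<open>O(b ^ k)\<close>, the modulus of \<open>w\<close> cannot
  exceed \<open>b\<close>.\<close>

lemma norm_le_of_power_sums_bound:
  fixes z :: "nat \<Rightarrow> complex"
  assumes b: "b > 0" and bound: "\<And>k. k \<ge> kmin \<Longrightarrow> cmod (\<Sum>i<m. z i ^ k) \<le> C * b ^ k"
    and j: "j < m"
  shows "cmod (z j) \<le> b"
proof (rule ccontr)
  assume "\<not> cmod (z j) \<le> b"
  then have gt: "cmod (z j) / b > 1" using b by simp
  define w where "w = z j"
  \<comment> \<open>The coefficients of this polynomial weight the power sums; it vanishes at all
    values of \<open>z\<close> other than \<open>w\<close>.\<close>
  define p where "p = (\<Prod>v\<in>z ` {..<m} - {w}. [:- v, 1:])"
  have p_w: "poly p w \<noteq> 0" by (auto simp: p_def poly_prod)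
  have p_0: "poly p (z i) = 0" if "i < m" "z i \<noteq> w" for i
    using that by (auto simp: p_def poly_prod)
  define \<mu> where "\<mu> = card {i. i < m \<and> z i = w}"
  have mu: "\<mu> > 0" unfolding \<mu>_def using j by (subst card_gt_0_iff) (auto simp: w_def)
  define C' where "C' = (\<Sum>l\<le>degree p. cmod (coeff p l) * C * b ^ l)"
  have filter: "(\<Sum>l\<le>degree p. coeff p l * (\<Sum>i<m. z i ^ (k + l))) = of_nat \<mu> * (w ^ k * poly p w)" for k
  proof -
    have "(\<Sum>l\<le>degree p. coeff p l * (\<Sum>i<m. z i ^ (k + l)))
        = (\<Sum>i<m. \<Sum>l\<le>degree p. coeff p l * z i ^ (k + l))"
      by (simp add: sum_distrib_left) (rule sum.swap)
    also have "\<dots> = (\<Sum>i<m. z i ^ k * poly p (z i))"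
      by (simp add: poly_altdef sum_distrib_left power_add algebra_simps)
    also have "\<dots> = (\<Sum>i\<in>{i. i < m \<and> z i = w}. z i ^ k * poly p (z i))"
      by (rule sum.mono_neutral_right) (auto simp: p_0)
    also have "\<dots> = (\<Sum>i\<in>{i. i < m \<and> z i = w}. w ^ k * poly p w)"
      by (rule sum.cong) auto
    finally show ?thesis by (simp add: \<mu>_def)
  qed
  have le: "(cmod w / b) ^ k \<le> C' / (real \<mu> * cmod (poly p w))" if k: "k \<ge> kmin" for k
  proof -
    have "real \<mu> * (cmod w ^ k * cmod (poly p w)) = cmod (\<Sum>l\<le>degree p. coeff p l * (\<Sum>i<m. z i ^ (k + l)))"
      unfolding filter by (simp add: norm_mult norm_power)
    also have "\<dots> \<le> (\<Sum>l\<le>degree p. cmod (coeff p l) * (C * b ^ (k + l)))"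
      by (rule sum_norm_le) (use k in \<open>auto simp: norm_mult intro!: mult_left_mono bound\<close>)
    also have "\<dots> = C' * b ^ k"
      unfolding C'_def sum_distrib_right by (intro sum.cong) (simp_all add: power_add)
    finally show ?thesis
      using b mu p_w by (simp add: field_simps power_divide)
  qed
  obtain N where N: "C' / (real \<mu> * cmod (poly p w)) < (cmod w / b) ^ N"
    using real_arch_pow gt unfolding w_def by blast
  also have "\<dots> \<le> (cmod w / b) ^ (max N kmin)"
    using gt by (intro power_increasing) (auto simp: w_def)
  also have "\<dots> \<le> C' / (real \<mu> * cmod (poly p w))" by (rule le) simp
  finally show False by simp
qed

section \<open>Orbits of points and stable multisets\<close>

text \<open>Points are counted with multiplicity: if \<open>t\<close> has period e and
  \<open>r = k e\<close>, every point of its orbit occurs k times.\<close>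

definition orbit_mset :: "('a \<Rightarrow> 'a) \<Rightarrow> nat \<Rightarrow> 'a \<Rightarrow> 'a multiset" where
  "orbit_mset f r t = image_mset (\<lambda>j. (f ^^ j) t) (mset_set {..<r})"

lemma size_orbit_mset [simp]: "size (orbit_mset f r t) = r"
  by (simp add: orbit_mset_def)

lemma orbit_mset_0 [simp]: "orbit_mset f 0 t = {#}"
  by (simp add: orbit_mset_def)

lemma orbit_mset_Suc: "orbit_mset f (Suc r) t = add_mset ((f ^^ r) t) (orbit_mset f r t)"
  by (simp add: orbit_mset_def lessThan_Suc)

lemma orbit_mset_add: "orbit_mset f (a + b) t = orbit_mset f a t + orbit_mset f b ((f ^^ a) t)"
proof (induction b)
  case (Suc b)
  have "(f ^^ (a + b)) t = (f ^^ b) ((f ^^ a) t)" by (simp add: funpow_add add.commute[of a])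
  then show ?case using Suc by (simp add: orbit_mset_Suc)
qed simp

lemma mem_orbit_mset: "x \<in># orbit_mset f r t \<longleftrightarrow> (\<exists>j<r. x = (f ^^ j) t)"
  by (auto simp: orbit_mset_def)

lemma image_orbit_mset: "image_mset f (orbit_mset f r t) = orbit_mset f r (f t)"
  by (simp add: orbit_mset_def image_mset.compositionality comp_def funpow_swap1)

lemma orbit_mset_stable:
  assumes "(f ^^ r) t = t"
  shows "image_mset f (orbit_mset f r t) = orbit_mset f r t"
proof -
  have "add_mset t (orbit_mset f r (f t)) = orbit_mset f (Suc 0 + r) t"
    by (subst orbit_mset_add) (simp add: orbit_mset_Suc)
  also have "\<dots> = add_mset t (orbit_mset f r t)" using assms by (simp add: orbit_mset_Suc)
  finally show ?thesis by (simp add: image_orbit_mset)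
qed

lemma count_stable:
  assumes "inj_on f U" "f ` U \<subseteq> U" "set_mset D \<subseteq> U" "image_mset f D = D" "x \<in> U"
  shows "count D (f x) = count D x"
proof -
  have "count D (f x) = count (image_mset f D) (f x)" using assms(4) by simp
  also have "\<dots> = sum (count D) (f -` {f x} \<inter> set_mset D)" by (rule count_image_mset)
  also have "f -` {f x} \<inter> set_mset D = (if x \<in># D then {x} else {})"
    using assms(1,3,5) by (auto simp: inj_on_def subset_iff)
  finally show ?thesis by (auto simp: not_in_iff)
qed

text \<open>By injectivity the iterates of \<open>t\<close> form a cycle, of length \<open>e\<close>
  say, on which \<open>count D\<close> is constant. The admissible \<open>r\<close> are multiples
  \<open>k * e\<close>, and \<open>k\<close> copies of the cycle fit into \<open>D\<close> exactly
  when \<open>k\<close> is at most \<open>count D t\<close>.\<close>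

lemma card_periods_in_stable:
  assumes inj: "inj_on f U" and U: "f ` U \<subseteq> U" and DU: "set_mset D \<subseteq> U"
    and stable: "image_mset f D = D" and t: "t \<in># D"
  shows "card {r\<in>{1..size D}. (f ^^ r) t = t \<and> orbit_mset f r t \<subseteq># D} = count D t"
proof -
  have iter_U: "(f ^^ j) t \<in> U" for j
    by (induction j) (use t DU U in auto)
  have cnt: "count D ((f ^^ j) t) = count D t" for j
    by (induction j) (auto simp: count_stable[OF inj U DU stable iter_U])
  have mem: "(f ^^ j) t \<in># D" for j
    using cnt[of j] t by (metis count_greater_zero_iff)
  have cancel: "(f ^^ j) t = t" if "(f ^^ (i + j)) t = (f ^^ i) t" for i j
    using that
  proof (induction i)
    case (Suc i)
    then show ?case using inj iter_U by (auto simp: inj_on_def)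
  qed simp
  \<comment> \<open>\<open>D\<close> has finitely many points, so the iterates repeat; by
    \<open>cancel\<close> they return to \<open>t\<close> itself.\<close>
  have "\<not> inj_on (\<lambda>j. (f ^^ j) t) UNIV"
  proof
    assume "inj_on (\<lambda>j. (f ^^ j) t) (UNIV :: nat set)"
    then have "finite (UNIV :: nat set)"
      by (rule inj_on_finite[where B = "set_mset D"]) (use mem in auto)
    then show False by simp
  qed
  then obtain a b where "a < b" "(f ^^ a) t = (f ^^ b) t"
    unfolding inj_on_def by (metis linorder_neqE_nat)
  then have ex: "\<exists>r>0. (f ^^ r) t = t"
    using cancel[of a "b - a"] by (intro exI[of _ "b - a"]) auto
  define e where "e = (LEAST r. r > 0 \<and> (f ^^ r) t = t)"
  have e: "e > 0" "(f ^^ e) t = t" using LeastI_ex[OF ex] by (auto simp: e_def)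
  have least: "r \<ge> e" if "r > 0" "(f ^^ r) t = t" for r
    unfolding e_def by (rule Least_le) (use that in simp)
  have per: "(f ^^ (k * e)) t = t" for k
    by (induction k) (auto simp: funpow_add e(2))
  have dvd: "e dvd r" if "(f ^^ r) t = t" for r
  proof -
    have "(f ^^ (r mod e)) t = t"
      using that per[of "r div e"] by (metis comp_apply funpow_add mod_div_mult_eq)
    then have "r mod e = 0" using least[of "r mod e"] e(1)
      by (metis mod_less_divisor not_gr_zero not_le)
    then show ?thesis by presburger
  qed
  have inj_e: "inj_on (\<lambda>j. (f ^^ j) t) {..<e}"
  proof (rule linorder_inj_onI)
    fix a b assume ab: "a < b" "a \<in> {..<e}" "b \<in> {..<e}"
    show "(f ^^ a) t \<noteq> (f ^^ b) t"
      using cancel[of a "b - a"] least[of "b - a"] ab by auto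
  qed auto
  have count_e: "count (orbit_mset f e t) x \<le> 1" for x
    unfolding orbit_mset_def using inj_e
    by (simp add: image_mset_mset_set count_mset_set')
  have count_ke: "count (orbit_mset f (k * e) t) x = k * count (orbit_mset f e t) x" for k x
    by (induction k) (auto simp: orbit_mset_add e(2))
  have count_t: "count (orbit_mset f e t) t = 1"
    using count_e[of t] e(1) mem_orbit_mset[of t f e t]
    by (metis One_nat_def antisym count_eq_zero_iff funpow_0 gr0I le_numeral_extra(4) Suc_leI)
  have "bij_betw (\<lambda>k. k * e) {1..count D t}
      {r\<in>{1..size D}. (f ^^ r) t = t \<and> orbit_mset f r t \<subseteq># D}"
  proof (rule bij_betwI')
    show "(k * e = k' * e) = (k = k')" for k k' using e(1) by simp
    show "k * e \<in> {r\<in>{1..size D}. (f ^^ r) t = t \<and> orbit_mset f r t \<subseteq># D}"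
      if k: "k \<in> {1..count D t}" for k
    proof -
      have sub: "orbit_mset f (k * e) t \<subseteq># D"
      proof (rule mset_subset_eqI)
        fix x
        show "count (orbit_mset f (k * e) t) x \<le> count D x"
        proof (cases "x \<in># orbit_mset f e t")
          case True
          then obtain j where "x = (f ^^ j) t" by (auto simp: mem_orbit_mset)
          then have cx: "count D x = count D t" using cnt by simp
          have "k * count (orbit_mset f e t) x \<le> k * 1" using count_e by (intro mult_le_mono) auto
          also have "\<dots> \<le> count D x" using k cx by simp
          finally show ?thesis by (simp only: count_ke)
        qed (simp add: count_ke not_in_iff)
      qed
      have "k * e \<le> size D" using size_mset_mono[OF sub] by simp
      then show ?thesis using sub per e(1) k by (simp add: Suc_le_eq)
    qed
    fix r assume r: "r \<in> {r\<in>{1..size D}. (f ^^ r) t = t \<and> orbit_mset f r t \<subseteq># D}"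
    then obtain k where k: "r = k * e" using dvd[of r] by (auto elim!: dvdE simp: mult.commute)
    have "k \<le> count D t" using r mset_subset_eq_count[of "orbit_mset f r t" D t]
      by (simp add: k count_ke count_t)
    moreover have "k \<ge> 1" using r k by (cases k) auto
    ultimately show "\<exists>k\<in>{1..count D t}. r = k * e" using k by auto
  qed
  from bij_betw_same_card[OF this] show ?thesis by simp
qed

text \<open>Exchange the two summations: each point \<open>t\<close> of \<open>D\<close> is counted
  for \<open>count D t\<close> values of \<open>r\<close>, and these multiplicities add up to the
  size.\<close>

lemma sum_card_orbits_in_stable:
  assumes inj: "inj_on f U" and U: "f ` U \<subseteq> U" and DU: "set_mset D \<subseteq> U"
    and stable: "image_mset f D = D"
  shows "(\<Sum>r=1..size D. card {t\<in>U. (f ^^ r) t = t \<and> orbit_mset f r t \<subseteq># D}) = size D"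
proof -
  have "card {t\<in>U. (f ^^ r) t = t \<and> orbit_mset f r t \<subseteq># D}
      = (\<Sum>t\<in>set_mset D. if (f ^^ r) t = t \<and> orbit_mset f r t \<subseteq># D then 1 else 0)"
    if r: "r \<in> {1..size D}" for r
  proof -
    have "t \<in># D" if "orbit_mset f r t \<subseteq># D" for t
    proof -
      have "t \<in># orbit_mset f r t" using r by (auto simp: mem_orbit_mset intro!: exI[of _ 0])
      then show ?thesis using that by (rule mset_subset_eqD[rotated])
    qed
    then have "{t\<in>U. (f ^^ r) t = t \<and> orbit_mset f r t \<subseteq># D}
        = {t\<in>set_mset D. (f ^^ r) t = t \<and> orbit_mset f r t \<subseteq># D}" using DU by auto
    then show ?thesis by (simp add: sum.If_cases Int_def)
  qed
  then have "(\<Sum>r=1..size D. card {t\<in>U. (f ^^ r) t = t \<and> orbit_mset f r t \<subseteq># D})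
      = (\<Sum>r=1..size D. \<Sum>t\<in>set_mset D. if (f ^^ r) t = t \<and> orbit_mset f r t \<subseteq># D then 1 else 0)"
    by (rule sum.cong[OF HOL.refl])
  also have "\<dots> = (\<Sum>t\<in>set_mset D. \<Sum>r=1..size D. if (f ^^ r) t = t \<and> orbit_mset f r t \<subseteq># D then 1 else 0)"
    by (rule sum.swap)
  also have "\<dots> = (\<Sum>t\<in>set_mset D. count D t)"
  proof (rule sum.cong[OF HOL.refl])
    fix t assume t: "t \<in># D"
    have "(\<Sum>r=1..size D. if (f ^^ r) t = t \<and> orbit_mset f r t \<subseteq># D then 1 else 0)
        = card {r\<in>{1..size D}. (f ^^ r) t = t \<and> orbit_mset f r t \<subseteq># D}"
      by (simp add: sum.If_cases Int_def)
    then show "(\<Sum>r=1..size D. if (f ^^ r) t = t \<and> orbit_mset f r t \<subseteq># D then 1 else 0) = count D t"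
      using card_periods_in_stable[OF inj U DU stable t] by simp
  qed
  also have "\<dots> = size D" by (simp add: size_multiset_overloaded_eq)
  finally show ?thesis .
qed

text \<open>For the Frobenius map on \<open>L\<close> these are the multisets of negated roots of
  the monic polynomials of degree \<open>n\<close> over \<open>K\<close>; see
  \<open>bij_div_poly\<close>.\<close>

definition stable_msets :: "('a \<Rightarrow> 'a) \<Rightarrow> 'a set \<Rightarrow> nat \<Rightarrow> 'a multiset set" where
  "stable_msets f U n = {D. set_mset D \<subseteq> U \<and> size D = n \<and> image_mset f D = D}"

text \<open>
  The logarithmic derivative of the Euler product of an L-function, with points in place of primes.
\<close>

lemma log_derivative_identity:
  fixes \<Lambda> :: "'a multiset \<Rightarrow> complex"
  assumes inj: "inj_on f U" and U: "f ` U \<subseteq> U"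
    and fin: "\<And>n. finite (stable_msets f U n)" and fin': "\<And>r. r > 0 \<Longrightarrow> finite {t\<in>U. (f ^^ r) t = t}"
    and mult: "\<And>i j A B. A \<in> stable_msets f U i \<Longrightarrow> B \<in> stable_msets f U j \<Longrightarrow> \<Lambda> (A + B) = \<Lambda> A * \<Lambda> B"
  shows "of_nat n * (\<Sum>D\<in>stable_msets f U n. \<Lambda> D)
    = (\<Sum>r=1..n. (\<Sum>t\<in>{t\<in>U. (f ^^ r) t = t}. \<Lambda> (orbit_mset f r t)) * (\<Sum>D\<in>stable_msets f U (n - r). \<Lambda> D))"
proof -
  define Pts where "Pts r = {t\<in>U. (f ^^ r) t = t}" for r
  have orbit_U: "set_mset (orbit_mset f r t) \<subseteq> U" if "t \<in> U" for r t
  proof -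
    have "(f ^^ j) t \<in> U" for j by (induction j) (use that U in auto)
    then show ?thesis by (auto simp: mem_orbit_mset)
  qed
  \<comment> \<open>Multiplicativity moves the orbit into the multiset: adding it is a bijection
    from the stable multisets of size \<open>n - r\<close> onto those of size \<open>n\<close> that
    contain it.\<close>
  have inner: "(\<Sum>t\<in>Pts r. \<Lambda> (orbit_mset f r t)) * (\<Sum>D\<in>stable_msets f U (n - r). \<Lambda> D)
     = (\<Sum>D\<in>stable_msets f U n. of_nat (card {t\<in>U. (f ^^ r) t = t \<and> orbit_mset f r t \<subseteq># D}) * \<Lambda> D)"
    if r: "r \<in> {1..n}" for r
  proof -
    have "\<Lambda> (orbit_mset f r t) * (\<Sum>D\<in>stable_msets f U (n - r). \<Lambda> D)
        = (\<Sum>D\<in>stable_msets f U n. if orbit_mset f r t \<subseteq># D then \<Lambda> D else 0)" if t: "t \<in> Pts r" for t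
    proof -
      define Ob where "Ob = orbit_mset f r t"
      have Ob: "set_mset Ob \<subseteq> U" "size Ob = r" "image_mset f Ob = Ob"
        using t orbit_U orbit_mset_stable[of r f t] by (auto simp: Ob_def Pts_def)
      have "\<Lambda> Ob * (\<Sum>D\<in>stable_msets f U (n - r). \<Lambda> D) = (\<Sum>D\<in>stable_msets f U (n - r). \<Lambda> (Ob + D))"
        using mult[of Ob r _ "n - r"] Ob by (simp add: sum_distrib_left stable_msets_def)
      also have "\<dots> = (\<Sum>D\<in>{D\<in>stable_msets f U n. Ob \<subseteq># D}. \<Lambda> D)"
      proof (rule sum.reindex_bij_witness[where j = "\<lambda>D. Ob + D" and i = "\<lambda>D. D - Ob"])
        fix D assume D: "D \<in> stable_msets f U (n - r)"
        show "Ob + D - Ob = D" by simp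
        show "Ob + D \<in> {D\<in>stable_msets f U n. Ob \<subseteq># D}"
          using D Ob r by (auto simp: stable_msets_def)
      next
        fix D assume "D \<in> {D\<in>stable_msets f U n. Ob \<subseteq># D}"
        then have D: "D \<in> stable_msets f U n" "Ob \<subseteq># D" by auto
        show "Ob + (D - Ob) = D" using D(2) by simp
        show "D - Ob \<in> stable_msets f U (n - r)"
          using D Ob by (auto simp: stable_msets_def size_Diff_submset image_mset_Diff dest: in_diffD)
      qed simp
      also have "\<dots> = (\<Sum>D\<in>stable_msets f U n. if Ob \<subseteq># D then \<Lambda> D else 0)"
        using fin by (simp add: sum.If_cases Int_def)
      finally show ?thesis by (simp add: Ob_def)
    qed
    then have "(\<Sum>t\<in>Pts r. \<Lambda> (orbit_mset f r t)) * (\<Sum>D\<in>stable_msets f U (n - r). \<Lambda> D)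
        = (\<Sum>t\<in>Pts r. \<Sum>D\<in>stable_msets f U n. if orbit_mset f r t \<subseteq># D then \<Lambda> D else 0)"
      by (simp add: sum_distrib_right)
    also have "\<dots> = (\<Sum>D\<in>stable_msets f U n. \<Sum>t\<in>Pts r. if orbit_mset f r t \<subseteq># D then \<Lambda> D else 0)"
      by (rule sum.swap)
    also have "\<dots> = (\<Sum>D\<in>stable_msets f U n. of_nat (card {t\<in>U. (f ^^ r) t = t \<and> orbit_mset f r t \<subseteq># D}) * \<Lambda> D)"
      using fin'[of r] r by (simp add: sum.If_cases Int_def Pts_def conj_assoc)
    finally show ?thesis .
  qed
  have "(\<Sum>r=1..n. (\<Sum>t\<in>Pts r. \<Lambda> (orbit_mset f r t)) * (\<Sum>D\<in>stable_msets f U (n - r). \<Lambda> D))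
    = (\<Sum>r=1..n. \<Sum>D\<in>stable_msets f U n. of_nat (card {t\<in>U. (f ^^ r) t = t \<and> orbit_mset f r t \<subseteq># D}) * \<Lambda> D)"
    by (rule sum.cong[OF HOL.refl inner])
  also have "\<dots> = (\<Sum>D\<in>stable_msets f U n. of_nat (\<Sum>r=1..n. card {t\<in>U. (f ^^ r) t = t \<and> orbit_mset f r t \<subseteq># D}) * \<Lambda> D)"
    by (subst sum.swap) (simp add: sum_distrib_right)
  also have "\<dots> = (\<Sum>D\<in>stable_msets f U n. of_nat n * \<Lambda> D)"
    using sum_card_orbits_in_stable[OF inj U] by (intro sum.cong) (auto simp: stable_msets_def simp del: of_nat_sum)
  finally show ?thesis by (simp add: Pts_def sum_distrib_left)
qed

section \<open>Fields inside a commutative ring\<close>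

text \<open>Zero divisors of the ring do no harm here: the linear factor has leading coefficient 1,
  so the top coefficient of the product is that of \<open>g\<close>.\<close>

lemma linear_mult_eq_0D:
  fixes g :: "'r::comm_ring_1 poly"
  assumes "[:t, 1:] * g = 0"
  shows "g = 0"
proof (rule ccontr)
  assume "g \<noteq> 0"
  have "coeff ([:t, 1:] * g) (Suc (degree g)) = lead_coeff g"
    by (simp add: coeff_eq_0)
  then have "lead_coeff g = 0" unfolding assms by simp
  then show False using \<open>g \<noteq> 0\<close> by simp
qed

lemma linear_mult_left_cancel:
  fixes g h :: "'r::comm_ring_1 poly"
  assumes "[:t, 1:] * g = [:t, 1:] * h"
  shows "g = h"
proof -
  have "[:t, 1:] * (g - h) = 0" using assms by (simp add: right_diff_distrib del: mult_pCons_left)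
  from linear_mult_eq_0D[OF this] show ?thesis by simp
qed

text \<open>The ring need not have characteristic \<open>p\<close>: every mixed binomial term
  contains the factor \<open>p * x\<close>, so it is enough that \<open>p\<close> kills
  \<open>x\<close>, with \<open>y\<close> arbitrary.\<close>

lemma prime_power_freshmans_dream:
  fixes x y :: "'r::comm_ring_1"
  assumes p: "prime p" and x: "of_nat p * x = 0"
  shows "(x + y) ^ (p ^ k) = x ^ (p ^ k) + y ^ (p ^ k)"
proof -
  have step: "(x + y) ^ p = x ^ p + y ^ p" if x: "of_nat p * x = 0" for x y :: 'r
  proof -
    have p0: "p > 0" using p by (simp add: prime_gt_0_nat)
    have z: "of_nat (p choose i) * x ^ i * y ^ (p - i) = 0" if "i \<in> {0<..<p}" for i
    proof -
      have "p dvd (p choose i)" using p that by (intro dvd_choose_prime) auto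
      then obtain c where c: "p choose i = p * c" by blast
      have "i > 0" using that by simp
      then obtain j where j: "i = Suc j" using gr0_implies_Suc by blast
      have "of_nat (p choose i) * x ^ i = of_nat c * x ^ j * (of_nat p * x)"
        using c by (simp add: j algebra_simps)
      then show ?thesis using x by simp
    qed
    have "(x + y) ^ p = (\<Sum>i\<le>p. of_nat (p choose i) * x ^ i * y ^ (p - i))"
      by (rule binomial_ring)
    also have "{..p} = insert 0 (insert p {0<..<p})" using p0 by auto
    also have "(\<Sum>i\<in>\<dots>. of_nat (p choose i) * x ^ i * y ^ (p - i)) = y ^ p + x ^ p"
      using p0 by (simp add: z)
    finally show ?thesis by (simp add: add.commute)
  qed
  show ?thesis
  proof (induction k)
    case (Suc k)
    have p0: "p ^ k > 0" using p by (simp add: prime_gt_0_nat)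
    have "of_nat p * x ^ (p ^ k) = (of_nat p * x) * x ^ (p ^ k - 1)"
      using p0 by (metis mult.assoc power_eq_if not_gr_zero)
    then have "of_nat p * x ^ (p ^ k) = 0" using x by simp
    from step[OF this, of "y ^ (p ^ k)"] show ?case
      using Suc by (simp add: power_mult mult.commute[of p])
  qed simp
qed

text \<open>
  A type cannot depend on the characteristic, so the algebraically closed field of the proof is
  realised as an ideal \<open>e * R\<close>, with \<open>e\<close> an idempotent, of a commutative ring \<open>R\<close> that is a type:
  its addition, multiplication and nonempty powers are those of \<open>R\<close>, and only its unit \<open>e\<close> differs.
\<close>

locale closed_corner =
  fixes e :: "'r::comm_ring_1"
  assumes idem: "e * e = e" and e_nonzero: "e \<noteq> 0"
    and corner_inverse: "x * e = x \<Longrightarrow> x \<noteq> 0 \<Longrightarrow> \<exists>y. x * y = e"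
    and corner_root: "smult e p = p \<Longrightarrow> degree p > 0 \<Longrightarrow> \<exists>x. x * e = x \<and> poly p x = 0"
begin

definition L :: "'r set" where "L = {x. x * e = x}"

lemma e_L [simp]: "e \<in> L"
  by (simp add: L_def idem)

lemma L_zero [simp]: "0 \<in> L"
  by (simp add: L_def)

lemma L_e: "x \<in> L \<Longrightarrow> x * e = x" "x \<in> L \<Longrightarrow> e * x = x"
  by (simp_all add: L_def mult.commute)

lemma L_add: "x \<in> L \<Longrightarrow> y \<in> L \<Longrightarrow> x + y \<in> L"
  by (simp add: L_def algebra_simps)

lemma L_minus: "x \<in> L \<Longrightarrow> - x \<in> L"
  by (simp add: L_def)

lemma L_diff: "x \<in> L \<Longrightarrow> y \<in> L \<Longrightarrow> x - y \<in> L"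
  by (simp add: L_def algebra_simps)

lemma L_multR: "x \<in> L \<Longrightarrow> x * y \<in> L"
  by (simp add: L_def) (metis mult.assoc mult.commute)

lemma L_multL: "x \<in> L \<Longrightarrow> y * x \<in> L"
  by (simp add: L_def mult.assoc)

lemma L_sum: "(\<And>i. i \<in> I \<Longrightarrow> f i \<in> L) \<Longrightarrow> sum f I \<in> L"
  by (induction I rule: infinite_finite_induct) (auto intro: L_add)

lemma L_prod: "finite I \<Longrightarrow> i \<in> I \<Longrightarrow> f i \<in> L \<Longrightarrow> prod f I \<in> L"
  by (metis L_multR prod.remove)

lemma L_power: "x \<in> L \<Longrightarrow> n > 0 \<Longrightarrow> x ^ n \<in> L"
  by (cases n) (auto intro: L_multR)

text \<open>\<open>y\<close> may lie outside \<open>L\<close>, so only its component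
  \<open>e * y\<close> can be shown to vanish.\<close>

lemma L_mult_0D:
  assumes "x \<in> L" "x \<noteq> 0" "x * y = 0"
  shows "e * y = 0"
proof -
  obtain z where "x * z = e" using corner_inverse assms(1,2) by (auto simp: L_def)
  then have "e * y = z * (x * y)" by (metis mult.commute mult.left_commute)
  then show ?thesis using assms(3) by simp
qed

lemma L_mult_eq_0_iff: "x \<in> L \<Longrightarrow> y \<in> L \<Longrightarrow> x * y = 0 \<longleftrightarrow> x = 0 \<or> y = 0"
  using L_mult_0D[of x y] by (auto simp: L_e)

lemma L_power_eq_0_iff: "x \<in> L \<Longrightarrow> n > 0 \<Longrightarrow> x ^ n = 0 \<longleftrightarrow> x = 0"
proof (induction n)
  case (Suc n)
  then show ?case by (cases "n = 0") (auto simp: L_mult_eq_0_iff L_power)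
qed simp

lemma e_power [simp]: "n > 0 \<Longrightarrow> e ^ n = e"
proof (induction n)
  case (Suc n)
  then show ?case by (cases "n = 0") (auto simp: idem)
qed simp

lemma L_mult_cancel: "x \<in> L \<Longrightarrow> y \<in> L \<Longrightarrow> z \<in> L \<Longrightarrow> z \<noteq> 0 \<Longrightarrow> z * x = z * y \<Longrightarrow> x = y"
  using L_mult_eq_0_iff[of z "x - y"] by (simp add: L_diff algebra_simps)

text \<open>The factor \<open>e\<close> projects the product into \<open>L\<close>, which matters
  for the empty product 1.\<close>

lemma L_prod_nonzero:
  assumes "finite I" "\<And>i. i \<in> I \<Longrightarrow> f i \<in> L \<and> f i \<noteq> 0"
  shows "e * prod f I \<noteq> 0"
  using assms
proof (induction I rule: finite_induct)
  case (insert i I)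
  have "f i * (e * prod f I) \<noteq> 0"
    using insert by (subst L_mult_eq_0_iff) (auto intro: L_multR)
  then show ?case using insert by (simp add: algebra_simps)
qed (simp add: e_nonzero)

lemma poly_L: "smult e p = p \<Longrightarrow> poly p x \<in> L"
  by (metis L_multR e_L poly_smult)

lemma coeff_L: "smult e p = p \<Longrightarrow> coeff p i \<in> L"
  by (metis L_multR e_L coeff_smult)

lemma smult_e_iff: "smult e p = p \<longleftrightarrow> (\<forall>i. coeff p i \<in> L)"
  by (auto simp: poly_eq_iff L_def mult.commute)

text \<open>The quotient inherits coefficients in \<open>L\<close> because the monic linear factor
  can be cancelled; being monic, this factor also makes the degrees add up in spite of zero
  divisors.\<close>

lemma factor_root:
  assumes p: "smult e p = p" "p \<noteq> 0" and r: "poly p (- t) = 0"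
  obtains g where "p = [:t, 1:] * g" "smult e g = g" "degree p = Suc (degree g)"
    "lead_coeff g = lead_coeff p" "g \<noteq> 0"
proof -
  obtain g where g: "p = [:t, 1:] * g"
    using r unfolding poly_eq_0_iff_dvd by auto
  have "[:t, 1:] * smult e g = [:t, 1:] * g" using p(1) unfolding g by (metis mult_smult_right)
  then have e: "smult e g = g" by (rule linear_mult_left_cancel)
  have g0: "g \<noteq> 0" using p(2) g by auto
  have c: "coeff p (Suc (degree g)) = lead_coeff g" unfolding g by (simp add: coeff_eq_0)
  have "degree p \<le> Suc (degree g)" unfolding g using degree_mult_le[of "[:t, 1:]" g] by simp
  moreover have "degree p \<ge> Suc (degree g)" using c g0 by (intro le_degree) simp
  ultimately have d: "degree p = Suc (degree g)" by simp
  show ?thesis using that[OF g e d] c d g0 by simp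
qed

text \<open>The usual induction, splitting off one root. Only roots in \<open>L\<close> are counted,
  since there a product vanishes only if a factor does.\<close>

lemma card_roots_le:
  assumes "smult e p = p" "p \<noteq> 0"
  shows "finite {x\<in>L. poly p x = 0} \<and> card {x\<in>L. poly p x = 0} \<le> degree p"
  using assms
proof (induction "degree p" arbitrary: p rule: less_induct)
  case less
  show ?case
  proof (cases "{x\<in>L. poly p x = 0} = {}")
    case False
    then obtain a where a: "a \<in> L" "poly p a = 0" by auto
    obtain g where g: "p = [:- a, 1:] * g" "smult e g = g" "degree p = Suc (degree g)" "g \<noteq> 0"
      using factor_root[OF less.prems, of "- a"] a by auto
    have IH: "finite {x\<in>L. poly g x = 0}" "card {x\<in>L. poly g x = 0} \<le> degree g"
      using less.hyps[of g] g by auto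
    have sub: "{x\<in>L. poly p x = 0} \<subseteq> insert a {x\<in>L. poly g x = 0}"
    proof
      fix x assume x: "x \<in> {x\<in>L. poly p x = 0}"
      then have "(x - a) * poly g x = 0" unfolding g(1) by (simp add: algebra_simps)
      then have "x - a = 0 \<or> poly g x = 0"
        using x a poly_L[OF g(2)] by (subst (asm) L_mult_eq_0_iff) (auto intro: L_diff)
      then show "x \<in> insert a {x\<in>L. poly g x = 0}" using x by auto
    qed
    have "card {x\<in>L. poly p x = 0} \<le> card (insert a {x\<in>L. poly g x = 0})"
      by (rule card_mono) (use IH sub in auto)
    also have "\<dots> \<le> Suc (degree g)" using IH by (simp add: card_insert_if)
    finally show ?thesis using g(3) finite_subset[OF sub] IH(1) by auto
  next
    case True
    show ?thesis unfolding True by simp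
  qed
qed

text \<open>The multiset holds the negatives of the roots, in keeping with the factors
  \<open>\<theta> + t\<close> that occur later.\<close>

lemma split_poly:
  assumes "smult e p = p" "p \<noteq> 0"
  shows "\<exists>D. set_mset D \<subseteq> L \<and> size D = degree p \<and> p = smult (lead_coeff p) (\<Prod>t\<in>#D. [:t, 1:])"
  using assms
proof (induction "degree p" arbitrary: p rule: less_induct)
  case less
  show ?case
  proof (cases "degree p = 0")
    case True
    then obtain c where "p = [:c:]" by (rule degree_eq_zeroE)
    then show ?thesis by (intro exI[of _ "{#}"]) simp
  next
    case False
    then obtain x where x: "x \<in> L" "poly p x = 0" using corner_root[OF less.prems(1)] by (auto simp: L_def)
    obtain g where g: "p = [:- x, 1:] * g" "smult e g = g" "degree p = Suc (degree g)"
       "lead_coeff g = lead_coeff p" "g \<noteq> 0"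
      using factor_root[OF less.prems, of "- x"] x by auto
    obtain D where D: "set_mset D \<subseteq> L" "size D = degree g" "g = smult (lead_coeff g) (\<Prod>t\<in>#D. [:t, 1:])"
      using less.hyps[of g] g by auto
    have "p = smult (lead_coeff p) (\<Prod>t\<in>#add_mset (- x) D. [:t, 1:])"
      using g(1,4) D(3) by (metis image_mset_add_mset mult_smult_right prod_mset.add_mset)
    then show ?thesis
      by (intro exI[of _ "add_mset (- x) D"]) (use D x g(3) in \<open>auto intro: L_minus\<close>)
  qed
qed

end

section \<open>Finite subfields and the Frobenius map\<close>

locale finite_corner = closed_corner e for e :: "'r::comm_ring_1" +
  fixes K :: "'r set" and q :: nat
  assumes K_L: "K \<subseteq> L" and e_K: "e \<in> K"
    and K_diff: "x \<in> K \<Longrightarrow> y \<in> K \<Longrightarrow> x - y \<in> K"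
    and K_mult: "x \<in> K \<Longrightarrow> y \<in> K \<Longrightarrow> x * y \<in> K"
    and card_K: "card K = q" and q_primepow: "primepow q"
begin

lemma q_gt1: "q > 1"
  using q_primepow primepow_gt_Suc_0 by force

lemma q_pos [simp]: "q > 0"
  using q_gt1 by simp

lemma qr_pos [simp]: "q ^ r > 0"
  by simp

lemma q_neq_0 [simp]: "q \<noteq> 0"
  using q_gt1 by simp

lemma zero_frob [simp]: "(0::'r) ^ (q ^ r) = 0"
  by (simp add: power_0_left)

lemma q_power_gt1: "r > 0 \<Longrightarrow> q ^ r > 1"
  using q_gt1 one_less_power by blast

lemma finite_K: "finite K"
  using card_K q_gt1 by (intro card_ge_0_finite) simp

lemma K_zero: "0 \<in> K"
  using K_diff[OF e_K e_K] by simp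

lemma K_add: "x \<in> K \<Longrightarrow> y \<in> K \<Longrightarrow> x + y \<in> K"
  using K_diff[OF _ K_diff[OF K_zero, of y], of x] by simp

text \<open>Translation by \<open>e\<close> permutes \<open>K\<close>; comparing the sums over
  \<open>K\<close> gives \<open>q e = 0\<close>. For \<open>q = p ^ k\<close> this is the
  \<open>k\<close>-th power of \<open>p e\<close>, and \<open>L\<close> has no nilpotents.\<close>

lemma characteristic:
  obtains p k where "prime p" "q = p ^ k" "\<And>x. x \<in> L \<Longrightarrow> of_nat p * x = 0"
proof -
  have "bij_betw (\<lambda>x. x + e) K K"
    by (rule bij_betw_byWitness[where f' = "\<lambda>x. x - e"]) (auto intro: K_add K_diff e_K)
  then have "(\<Sum>x\<in>K. x + e) = (\<Sum>x\<in>K. x)" by (rule sum.reindex_bij_betw)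
  then have qe: "of_nat q * e = 0" by (simp add: sum.distrib card_K)
  obtain p k where pk: "prime p" "k > 0" "q = p ^ k"
    using q_primepow by (auto simp: primepow_def)
  have "(of_nat p * e) ^ k = of_nat q * e" using pk by (simp add: power_mult_distrib)
  then have "of_nat p * e = 0"
    using qe pk(2) L_power_eq_0_iff[OF L_multL[OF e_L], of k "of_nat p"] by simp
  then have "of_nat p * x = 0" if "x \<in> L" for x
    using that by (metis L_e(2) mult.assoc mult_zero_left)
  then show ?thesis using that pk by blast
qed

lemma frob_add:
  assumes "x \<in> L"
  shows "(x + y) ^ (q ^ r) = x ^ (q ^ r) + y ^ (q ^ r)"
proof -
  obtain p k where p: "prime p" "q = p ^ k" "\<And>x. x \<in> L \<Longrightarrow> of_nat p * x = 0"
    by (rule characteristic) blast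
  show ?thesis using prime_power_freshmans_dream[OF p(1) p(3)[OF assms], of y "k * r"]
    by (simp add: p(2) power_mult)
qed

lemma frob_minus: "x \<in> L \<Longrightarrow> (- x) ^ (q ^ r) = - (x ^ (q ^ r))"
  using frob_add[of x "- x" r] by (simp add: eq_neg_iff_add_eq_0 add.commute)

lemma frob_diff: "x \<in> L \<Longrightarrow> y \<in> L \<Longrightarrow> (x - y) ^ (q ^ r) = x ^ (q ^ r) - y ^ (q ^ r)"
  using frob_add[of x "- y" r] frob_minus[of y r] by simp

lemma frob_sum: "(\<And>i. i \<in> I \<Longrightarrow> f i \<in> L) \<Longrightarrow> (sum f I) ^ (q ^ r) = (\<Sum>i\<in>I. f i ^ (q ^ r))"
  by (induction I rule: infinite_finite_induct) (auto simp: frob_add power_0_left)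

lemma frob_inj: "x \<in> L \<Longrightarrow> y \<in> L \<Longrightarrow> x ^ (q ^ r) = y ^ (q ^ r) \<Longrightarrow> x = y"
  using frob_diff[of x y r] L_power_eq_0_iff[of "x - y" "q ^ r"] by (auto intro: L_diff)

text \<open>For \<open>r > 0\<close> this is the subfield of \<open>L\<close> with
  \<open>q ^ r\<close> elements, by \<open>card_E\<close>; for \<open>r = 0\<close> it is all of
  \<open>L\<close>.\<close>

definition E :: "nat \<Rightarrow> 'r set" where "E r = {x \<in> L. x ^ (q ^ r) = x}"

lemma E_L: "x \<in> E r \<Longrightarrow> x \<in> L"
  by (simp add: E_def)

lemma E_zero [simp]: "0 \<in> E r"
  by (simp add: E_def power_0_left)

lemma E_e [simp]: "e \<in> E r"
  by (simp add: E_def)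

lemma E_add: "x \<in> E r \<Longrightarrow> y \<in> E r \<Longrightarrow> x + y \<in> E r"
  by (simp add: E_def L_add frob_add)

lemma E_diff: "x \<in> E r \<Longrightarrow> y \<in> E r \<Longrightarrow> x - y \<in> E r"
  by (simp add: E_def L_diff frob_diff)

lemma E_minus: "x \<in> E r \<Longrightarrow> - x \<in> E r"
  by (simp add: E_def L_minus frob_minus)

lemma E_mult: "x \<in> E r \<Longrightarrow> y \<in> E r \<Longrightarrow> x * y \<in> E r"
  by (simp add: E_def L_multR power_mult_distrib)

lemma E_power: "x \<in> E r \<Longrightarrow> n > 0 \<Longrightarrow> x ^ n \<in> E r"
  by (simp add: E_def L_power) (metis mult.commute power_mult)

lemma E_sum: "(\<And>i. i \<in> I \<Longrightarrow> f i \<in> E r) \<Longrightarrow> sum f I \<in> E r"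
  by (induction I rule: infinite_finite_induct) (auto intro: E_add)

lemma E_iterate: "x \<in> E r \<Longrightarrow> x ^ (q ^ (r * k)) = x"
proof (induction k)
  case (Suc k)
  have "x ^ (q ^ (r * Suc k)) = (x ^ (q ^ (r * k))) ^ (q ^ r)"
    unfolding power_mult[symmetric] power_add[symmetric] by (simp add: add.commute)
  then show ?case using Suc by (simp add: E_def)
qed simp

lemma E_dvd: "x \<in> E r \<Longrightarrow> r dvd s \<Longrightarrow> x \<in> E s"
  using E_iterate by (auto simp: E_def elim!: dvdE)

lemma E_inverse:
  assumes "x \<in> E r" "x \<noteq> 0"
  obtains y where "y \<in> E r" "x * y = e" "y \<noteq> 0"
proof -
  obtain y where y: "x * y = e" using corner_inverse[of x] assms by (auto simp: E_def L_def)
  define z where "z = e * y"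
  have z: "z \<in> L" "x * z = e"
    using y idem by (simp_all add: z_def L_multR mult.left_commute[of x])
  have "x * z ^ (q ^ r) = (x * z) ^ (q ^ r)"
    using assms(1) by (simp add: power_mult_distrib E_def)
  then have "x * z ^ (q ^ r) = x * z" using z by simp
  then have "z ^ (q ^ r) = z"
    using assms z by (intro L_mult_cancel[of "z ^ (q ^ r)" z x]) (auto simp: E_def L_power)
  then have "z \<in> E r" using z by (simp add: E_def)
  moreover have "z \<noteq> 0" using z e_nonzero by auto
  ultimately show ?thesis using that z by blast
qed

lemma card_frob_fixed_le:
  assumes "r > 0"
  shows "finite (E r) \<and> card (E r) \<le> q ^ r"
proof -
  define p where "p = monom e (q ^ r) - monom e 1"
  have gt: "q ^ r > 1" using q_power_gt1[OF assms] by simp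
  have p: "smult e p = p" by (simp add: p_def smult_diff_right smult_monom idem)
  have p0: "p \<noteq> 0"
  proof
    assume "p = 0"
    then have "coeff p (q ^ r) = 0" by simp
    then show False using gt e_nonzero by (simp add: p_def)
  qed
  have "degree p \<le> q ^ r" unfolding p_def
    using gt by (intro degree_diff_le) (auto simp: degree_monom_le intro: order_trans[OF degree_monom_le])
  moreover have "E r = {x\<in>L. poly p x = 0}"
    by (auto simp: E_def p_def poly_monom L_e L_power)
  ultimately show ?thesis using card_roots_le[OF p p0] by auto
qed

lemma finite_E: "r > 0 \<Longrightarrow> finite (E r)"
  using card_frob_fixed_le by blast

text \<open>Fermat's argument: multiplication by a nonzero \<open>x\<close> permutes the nonzero
  elements of \<open>K\<close>, so \<open>x ^ (q - 1)\<close> fixes their product and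
  \<open>x ^ q = x\<close>. Equality follows because \<open>E 1\<close> has at most \<open>q\<close>
  elements.\<close>

lemma K_eq_E1: "K = E 1"
proof -
  have "x \<in> E 1" if x: "x \<in> K" for x
  proof (cases "x = 0")
    case False
    have xL: "x \<in> L" using x K_L by blast
    define K0 where "K0 = K - {0}"
    have fin: "finite K0" using finite_K by (simp add: K0_def)
    have inj: "inj_on (\<lambda>y. x * y) K0"
    proof (rule inj_onI)
      fix y z assume "y \<in> K0" "z \<in> K0" "x * y = x * z"
      then show "y = z"
        using False xL K_L by (auto simp: K0_def intro: L_mult_cancel[of y z x])
    qed
    have "(\<lambda>y. x * y) ` K0 \<subseteq> K0"
      using x False xL K_L K_mult by (auto simp: K0_def L_mult_eq_0_iff subset_iff)
    then have "(\<lambda>y. x * y) ` K0 = K0"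
      using inj fin by (simp add: endo_inj_surj)
    then have "(\<Prod>y\<in>K0. y) = (\<Prod>y\<in>K0. x * y)"
      by (metis inj prod.reindex_cong)
    also have "\<dots> = x ^ card K0 * (\<Prod>y\<in>K0. y)" by (simp add: prod.distrib)
    finally have eq: "(\<Prod>y\<in>K0. y) = x ^ card K0 * (\<Prod>y\<in>K0. y)" .
    define u where "u = e * (\<Prod>y\<in>K0. y)"
    have u: "u \<noteq> 0" "u \<in> L"
      unfolding u_def using K_L L_prod_nonzero[OF fin, of "\<lambda>y. y"] by (auto intro!: L_multR simp: K0_def)
    have "u * x = u * x ^ q"
    proof -
      have "q = Suc (card K0)" using card_K K_zero finite_K q_gt1 by (simp add: K0_def)
      then have "u * x ^ q = e * x * (x ^ card K0 * (\<Prod>y\<in>K0. y))"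
        by (simp add: u_def algebra_simps)
      then show ?thesis unfolding eq[symmetric] by (simp add: u_def algebra_simps)
    qed
    then have "x = x ^ q" using u xL by (intro L_mult_cancel[of x "x ^ q" u]) (auto intro: L_power)
    then show ?thesis using xL by (simp add: E_def)
  qed simp
  then have "K \<subseteq> E 1" by blast
  moreover have "card (E 1) \<le> card K" "finite (E 1)" using card_frob_fixed_le[of 1] card_K by auto
  ultimately show ?thesis by (simp add: card_seteq)
qed

text \<open>The polynomial X^Q - X splits over \<open>L\<close>, so only double roots have to be
  excluded. At a root -t additivity of the Q-th power gives X^Q - X = (X + t)^Q - (X + t) up to the
  factor \<open>e\<close>, and the cofactor (X + t)^(Q - 1) - 1 does not vanish at -t.\<close>

lemma card_E:
  assumes r: "r > 0"
  shows "card (E r) = q ^ r"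
proof -
  define Q where "Q = q ^ r"
  have Q: "Q > 1" using q_power_gt1[OF assms] by (simp add: Q_def)
  define p where "p = monom e Q - monom e 1"
  have p: "smult e p = p" by (simp add: p_def smult_diff_right smult_monom idem)
  have cQ: "coeff p Q = e" using Q by (simp add: p_def)
  have "degree p \<le> Q" unfolding p_def
    using Q by (intro degree_diff_le) (auto simp: degree_monom_le intro: order_trans[OF degree_monom_le])
  then have deg: "degree p = Q" using cQ e_nonzero by (intro antisym le_degree) auto
  have p0: "p \<noteq> 0" using cQ e_nonzero by auto
  obtain D where D: "set_mset D \<subseteq> L" "size D = Q" "p = smult e (\<Prod>t\<in>#D. [:t, 1:])"
    using split_poly[OF p p0] deg cQ by auto
  have root: "- t \<in> E r" if "t \<in># D" for t
  proof -
    have tL: "t \<in> L" using that D(1) by blast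
    obtain D' where "D = add_mset t D'" using \<open>t \<in># D\<close> multi_member_split by metis
    then have "poly p (- t) = 0" unfolding D(3) by (simp add: poly_prod_mset)
    then show ?thesis using tL
      by (simp add: p_def poly_monom E_def L_e L_power L_minus Q_def eq_neg_iff_add_eq_0)
  qed
  have count: "count D t \<le> 1" for t
  proof (rule ccontr)
    assume "\<not> count D t \<le> 1"
    then have "count D t \<ge> 2" by simp
    then have tD: "t \<in># D" by (metis not_in_iff not_numeral_le_zero)
    have tE: "t \<in> E r" using E_minus[OF root[OF tD]] by simp
    have tL: "t \<in> L" using tE by (rule E_L)
    obtain G' where G': "D = add_mset t G'" using multi_member_split[OF tD] by blast
    then have "t \<in># G'" using \<open>count D t \<ge> 2\<close> by (auto simp: not_in_iff)
    then obtain G where G: "D = add_mset t (add_mset t G)" using G' multi_member_split by metis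
    define g where "g = smult e (\<Prod>t\<in>#G. [:t, 1:])"
    have p_g: "p = [:t, 1:] * ([:t, 1:] * g)" by (simp only: D(3) G g_def image_mset_add_mset prod_mset.add_mset mult_smult_right)
    obtain pp k where pp: "prime pp" "q = pp ^ k" "\<And>x. x \<in> L \<Longrightarrow> of_nat pp * x = 0"
      by (rule characteristic) blast
    have "of_nat pp * [:t:] = 0" using pp(3)[OF tL] by (simp add: of_nat_poly mult.commute)
    from prime_power_freshmans_dream[OF pp(1) this, of "monom e 1" "k * r"]
    have "([:t:] + monom e 1) ^ Q = [:t:] ^ Q + monom e 1 ^ Q"
      by (simp add: Q_def pp(2) power_mult)
    moreover have "[:t:] + monom e 1 = smult e [:t, 1:]" using tL by (simp add: L_e monom_altdef)
    moreover have "monom e 1 ^ Q = monom e Q" using Q by (simp add: monom_power)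
    moreover have "[:t:] ^ Q = [:t:]"
      using tE by (simp add: E_def Q_def poly_const_pow)
    ultimately have "smult e [:t, 1:] ^ Q = [:t:] + monom e Q" by simp
    then have "p = smult e [:t, 1:] ^ Q - smult e [:t, 1:]"
      using tL by (simp add: p_def L_e monom_altdef)
    also have "smult e [:t, 1:] ^ Q = smult e ([:t, 1:] ^ Q)"
      using Q e_power[of Q] by (metis smult_power less_trans zero_less_one)
    also have "smult e ([:t, 1:] ^ Q) - smult e [:t, 1:] = smult e ([:t, 1:] ^ Q - [:t, 1:])"
      by (simp only: smult_diff_right)
    also have "\<dots> = [:t, 1:] * smult e ([:t, 1:] ^ (Q - 1) - 1)"
      using Q by (cases Q) (simp_all add: smult_diff_right algebra_simps)
    finally have "[:t, 1:] * ([:t, 1:] * g) = [:t, 1:] * smult e ([:t, 1:] ^ (Q - 1) - 1)"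
      using p_g by simp
    then have "[:t, 1:] * g = smult e ([:t, 1:] ^ (Q - 1) - 1)"
      by (rule linear_mult_left_cancel)
    then have "poly ([:t, 1:] * g) (- t) = poly (smult e ([:t, 1:] ^ (Q - 1) - 1)) (- t)" by simp
    then have "e = 0" using Q by (simp add: power_0_left)
    then show False using e_nonzero by simp
  qed
  have "size D = (\<Sum>t\<in>set_mset D. count D t)" by (rule size_multiset_overloaded_eq)
  also have "\<dots> \<le> (\<Sum>t\<in>set_mset D. 1)" by (rule sum_mono) (rule count)
  also have "\<dots> = card (set_mset D)" by simp
  also have "\<dots> \<le> card (E r)"
    by (rule card_inj_on_le[of uminus]) (auto simp: root finite_E[OF r])
  finally show ?thesis using card_frob_fixed_le[OF r] D(2) by (simp add: Q_def)
qed

end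

section \<open>The auxiliary polynomial\<close>

lemma coeff_mult_top:
  fixes p r :: "'r::comm_semiring_0 poly"
  assumes "degree p \<le> a" "degree r \<le> b"
  shows "coeff (p * r) (a + b) = coeff p a * coeff r b"
proof -
  have "coeff (p * r) (a + b) = (\<Sum>i\<le>a + b. coeff p i * coeff r (a + b - i))" by (rule coeff_mult)
  also have "\<dots> = (\<Sum>i\<le>a + b. if i = a then coeff p a * coeff r b else 0)"
  proof (rule sum.cong[OF HOL.refl])
    fix i assume i: "i \<in> {..a + b}"
    consider "i < a" | "i = a" | "i > a" by linarith
    then show "coeff p i * coeff r (a + b - i) = (if i = a then coeff p a * coeff r b else 0)"
      by cases (use assms i in \<open>auto simp: coeff_eq_0\<close>)
  qed
  also have "\<dots> = coeff p a * coeff r b" by simp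
  finally show ?thesis .
qed

lemma power_monic:
  fixes p :: "'r::comm_ring_1 poly"
  assumes "degree p \<le> a" "coeff p a = 1"
  shows "degree (p ^ k) \<le> k * a \<and> coeff (p ^ k) (k * a) = 1"
proof (induction k)
  case (Suc k)
  have "degree (p ^ Suc k) \<le> a + k * a"
    using degree_mult_le[of p "p ^ k"] Suc assms(1) by simp
  moreover have "coeff (p * p ^ k) (a + k * a) = 1"
    using coeff_mult_top[of p a "p ^ k" "k * a"] Suc assms by simp
  ultimately show ?case by simp
qed simp

lemma coeff_monom_mult_dvd: "monom 1 n dvd p \<Longrightarrow> r < n \<Longrightarrow> coeff p r = (0::'r::comm_ring_1)"
  by (auto elim!: dvdE simp: coeff_monom_mult)

lemma geometric_sum_less: "(q::nat) > 1 \<Longrightarrow> (\<Sum>j<n. q ^ j) < q ^ n"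
proof (induction n)
  case (Suc n)
  then have "(\<Sum>j<Suc n. q ^ j) < 2 * q ^ n" by simp
  also have "\<dots> \<le> q ^ Suc n" using Suc.prems by simp
  finally show ?case .
qed simp

lemma geometric_sum_nat: "(q::nat) > 0 \<Longrightarrow> (q - 1) * (\<Sum>j<n. q ^ j) + 1 = q ^ n"
proof (induction n)
  case (Suc n)
  have "(q - 1) * (\<Sum>j<Suc n. q ^ j) + 1 = ((q - 1) * (\<Sum>j<n. q ^ j) + 1) + (q - 1) * q ^ n"
    by (simp add: algebra_simps)
  also have "\<dots> = q ^ Suc n" using Suc by (cases q) simp_all
  finally show ?case .
qed simp

text \<open>\<open>conj_distinct\<close> is the form in which \<open>\<theta>\<close> generates the
  extension: no smaller power of Frobenius fixes it, so it has \<open>m\<close> distinct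
  conjugates.\<close>

locale generated_corner = finite_corner e K q for e :: "'r::comm_ring_1" and K q +
  fixes m :: nat and \<theta> :: 'r
  assumes m_pos: "m > 0" and theta_E: "\<theta> \<in> E m"
    and conj_distinct: "0 < j \<Longrightarrow> j < m \<Longrightarrow> \<theta> ^ (q ^ j) \<noteq> \<theta>"
begin

lemma theta_L: "\<theta> \<in> L"
  using theta_E by (rule E_L)

lemma theta_fixed_iff: "\<theta> ^ (q ^ j) = \<theta> \<longleftrightarrow> m dvd j"
proof
  assume fixed: "\<theta> ^ (q ^ j) = \<theta>"
  have "\<theta> ^ (q ^ j) = \<theta> ^ (q ^ (m * (j div m)) * q ^ (j mod m))"
    by (metis mult_div_mod_eq power_add)
  also have "\<dots> = \<theta> ^ (q ^ (j mod m))"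
    using E_iterate[OF theta_E] by (simp add: power_mult)
  finally have "\<theta> ^ (q ^ (j mod m)) = \<theta>" using fixed by simp
  then have "j mod m = 0" using conj_distinct[of "j mod m"] m_pos by (metis mod_less_divisor not_gr_zero)
  then show "m dvd j" by presburger
qed (auto elim!: dvdE simp: E_iterate[OF theta_E])

text \<open>At \<open>t + \<theta>\<close> this polynomial takes the value \<open>\<Prod>j<\<nu>. \<theta> + t ^ (q ^ j)\<close>.\<close>

definition norm_poly :: "nat \<Rightarrow> 'r poly" where
  "norm_poly \<nu> = (\<Prod>j<\<nu>. monom 1 (q ^ j) + [:\<theta> - \<theta> ^ (q ^ j):])"

text \<open>At \<open>t + \<theta>\<close> with \<open>t\<close> in \<open>L\<close> this is the sum
  of the \<open>t ^ (q ^ j)\<close> plus a constant independent of \<open>t\<close>, which is later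
  absorbed into the prescribed value.\<close>

definition trace_poly :: "nat \<Rightarrow> 'r poly" where
  "trace_poly \<nu> = (\<Sum>j<\<nu>. monom 1 (q ^ j))"

lemma degree_norm_poly: "degree (norm_poly \<nu>) < q ^ \<nu>"
proof -
  have "degree (norm_poly \<nu>) \<le> (\<Sum>j<\<nu>. degree (monom (1::'r) (q ^ j) + [:\<theta> - \<theta> ^ (q ^ j):]))"
    unfolding norm_poly_def using degree_prod_sum_le[of "{..<\<nu>}"] by (simp add: comp_def)
  also have "\<dots> \<le> (\<Sum>j<\<nu>. q ^ j)"
    by (intro sum_mono degree_add_le) (auto simp: degree_monom_le)
  finally show ?thesis using geometric_sum_less[OF q_gt1, of \<nu>] by simp
qed

lemma degree_trace_poly:
  assumes "k < q"
  shows "k * degree (trace_poly \<nu>) \<le> q ^ \<nu>"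
proof (cases \<nu>)
  case (Suc n)
  have "degree (trace_poly \<nu>) \<le> q ^ n"
    unfolding trace_poly_def using q_gt1
    by (intro degree_sum_le) (auto simp: Suc less_Suc_eq_le intro!: order_trans[OF degree_monom_le] power_increasing)
  then have "k * degree (trace_poly \<nu>) \<le> q * q ^ n" using assms by (intro mult_le_mono) auto
  then show ?thesis by (simp add: Suc)
qed (simp add: trace_poly_def)

section \<open>Nonvanishing of the auxiliary polynomial\<close>

definition digit_poly :: "nat \<Rightarrow> nat \<Rightarrow> (nat \<Rightarrow> nat \<Rightarrow> 'r) \<Rightarrow> 'r poly" where
  "digit_poly \<nu> A b = (\<Sum>k<q. \<Sum>l<A. smult (b k l) (monom 1 l * trace_poly \<nu> ^ k))"

text \<open>Modulo X^(q^(n+1)) the trace polynomial is a monic \<open>V0\<close> of degree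
  \<open>A = q ^ n\<close>. The products of X^l and \<open>V0 ^ k\<close> have degrees
  \<open>k A + l\<close>, which are distinct and less than \<open>q A\<close> since
  \<open>l < A\<close> and \<open>k < q\<close>; so the largest one with a nonzero coefficient
  cannot cancel.\<close>

lemma digit_poly_low_coeff:
  assumes \<nu>: "n < \<nu>" and b: "b k1 l1 \<noteq> 0" "k1 < q" "l1 < q ^ n"
  shows "\<exists>r<q ^ Suc n. coeff (digit_poly \<nu> (q ^ n) b) r \<noteq> 0"
proof -
  define A where "A = q ^ n"
  define V0 where "V0 = trace_poly (Suc n)"
  have V0: "degree V0 \<le> A" "coeff V0 A = 1"
  proof -
    show "degree V0 \<le> A"
      unfolding V0_def trace_poly_def A_def using q_gt1
      by (intro degree_sum_le) (auto simp: less_Suc_eq_le intro!: order_trans[OF degree_monom_le] power_increasing)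
    have "coeff V0 A = (\<Sum>j<Suc n. if j = n then 1 else 0)"
      unfolding V0_def trace_poly_def A_def coeff_sum
      by (intro sum.cong) (use q_gt1 in auto)
    then show "coeff V0 A = 1" by simp
  qed
  have "monom 1 (q * A) dvd trace_poly \<nu> - V0"
  proof -
    have "trace_poly \<nu> = V0 + (\<Sum>j\<in>{Suc n..<\<nu>}. monom 1 (q ^ j))"
      unfolding trace_poly_def V0_def lessThan_atLeast0 using \<nu>
      by (intro sum.atLeastLessThan_concat[symmetric]) auto
    moreover have "monom (1::'r) (q * A) dvd (\<Sum>j\<in>{Suc n..<\<nu>}. monom 1 (q ^ j))"
    proof (rule dvd_sum)
      fix j assume j: "j \<in> {Suc n..<\<nu>}"
      have "q * A \<le> q ^ j" unfolding A_def power_Suc[symmetric] using j q_gt1 by (intro power_increasing) auto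
      then have "monom (1::'r) (q ^ j) = monom 1 (q * A) * monom 1 (q ^ j - q * A)"
        by (simp add: mult_monom)
      then show "monom (1::'r) (q * A) dvd monom 1 (q ^ j)" by simp
    qed
    ultimately show ?thesis by simp
  qed
  then have dvd: "monom 1 (q * A) dvd trace_poly \<nu> ^ k - V0 ^ k" for k
    by (rule dvd_trans) (metis dvd_triv_left power_diff_sumr2)
  have coeff_V: "coeff (trace_poly \<nu> ^ k) r = coeff (V0 ^ k) r" if "r < q * A" for k r
    using coeff_monom_mult_dvd[OF dvd[of k] that] by simp
  define S where "S = {(k, l). k < q \<and> l < A \<and> b k l \<noteq> 0}"
  have fin: "finite S"
    by (rule finite_subset[of _ "{..<q} \<times> {..<A}"]) (auto simp: S_def)
  have ne: "S \<noteq> {}" using b by (auto simp: S_def A_def)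
  obtain k0 l0 where max: "(k0, l0) \<in> S" "\<And>k l. (k, l) \<in> S \<Longrightarrow> k * A + l \<le> k0 * A + l0"
  proof -
    define f where "f = (\<lambda>(k, l). k * A + l)"
    have "Max (f ` S) \<in> f ` S" using fin ne by (intro Max_in) auto
    then obtain k0 l0 where 1: "(k0, l0) \<in> S" "Max (f ` S) = f (k0, l0)" by auto
    show ?thesis
    proof (rule that[OF 1(1)])
      fix k l assume "(k, l) \<in> S"
      then have "f (k, l) \<le> f (k0, l0)"
        using 1(2) fin by (metis Max_ge finite_imageI imageI)
      then show "k * A + l \<le> k0 * A + l0"
        by (simp add: f_def)
    qed
  qed
  define N where "N = k0 * A + l0"
  have kl0: "k0 < q" "l0 < A" "b k0 l0 \<noteq> 0" using max(1) by (auto simp: S_def)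
  have N: "N < q * A"
  proof -
    have "N < Suc k0 * A" using kl0 by (simp add: N_def)
    also have "\<dots> \<le> q * A" using kl0 by (intro mult_le_mono) auto
    finally show ?thesis .
  qed
  have "coeff (smult (b k l) (monom 1 l * trace_poly \<nu> ^ k)) N = (if k = k0 \<and> l = l0 then b k0 l0 else 0)"
    if kl: "k < q" "l < A" for k l
  proof (cases "k = k0 \<and> l = l0")
    case True
    have "k0 * A < q * A" using N unfolding N_def by linarith
    then show ?thesis using True power_monic[OF V0, of k0]
      by (simp add: coeff_monom_mult N_def coeff_V)
  next
    case False
    show ?thesis
    proof (cases "b k l = 0")
      case nz: False
      have "k * A + l \<le> N" unfolding N_def using nz kl by (intro max(2)) (auto simp: S_def)
      moreover have "k * A + l \<noteq> N"
      proof
        assume eq: "k * A + l = N"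
        have "k = N div A" "l = N mod A" using kl eq[symmetric] by auto
        moreover have "k0 = N div A" "l0 = N mod A" using kl0 by (auto simp: N_def)
        ultimately show False using False by blast
      qed
      ultimately have "k * A < N - l" by linarith
      then have "coeff (V0 ^ k) (N - l) = 0" using power_monic[OF V0, of k] by (intro coeff_eq_0) simp
      then show ?thesis using False N by (auto simp: coeff_monom_mult coeff_V)
    qed (use False in auto)
  qed
  then have "coeff (digit_poly \<nu> A b) N = (\<Sum>k<q. \<Sum>l<A. if k = k0 \<and> l = l0 then b k0 l0 else 0)"
    by (simp add: digit_poly_def coeff_sum)
  also have "\<dots> = (\<Sum>k<q. if k = k0 then b k0 l0 else 0)"
    by (intro sum.cong) (use kl0 in auto)
  also have "\<dots> = b k0 l0" using kl0 by simp
  finally show ?thesis using kl0 N by (auto simp: A_def)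
qed

definition aux_poly :: "nat \<Rightarrow> nat \<Rightarrow> nat \<Rightarrow> nat \<Rightarrow> (nat \<Rightarrow> nat \<Rightarrow> nat \<Rightarrow> nat \<Rightarrow> 'r) \<Rightarrow> 'r poly" where
  "aux_poly \<nu> A B d b =
     (\<Sum>i<d. \<Sum>j<B. \<Sum>k<q. \<Sum>l<A. smult (b i j k l) (monom 1 (l + q ^ \<nu> * j) * norm_poly \<nu> ^ i * trace_poly \<nu> ^ k))"

lemma aux_poly_digits:
  "aux_poly \<nu> A B d b = (\<Sum>i<d. \<Sum>j<B. monom 1 (q ^ \<nu> * j) * norm_poly \<nu> ^ i * digit_poly \<nu> A (b i j))"
proof -
  have "smult x (monom 1 (l + a) * h * v) = monom 1 a * h * smult x (monom 1 l * v)"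
    for x and l a and h v :: "'r poly"
    using mult_monom[of "1::'r" l 1 a] by (simp add: algebra_simps)
  then show ?thesis by (simp only: aux_poly_def digit_poly_def sum_distrib_left)
qed

text \<open>
  At \<open>0\<close>, corresponding to \<open>t = - \<theta>\<close>, the polynomial \<open>norm_poly \<nu>\<close> vanishes to the order
  \<open>\<delta> = (q ^ \<nu> - 1) / (q ^ m - 1)\<close>; so the orders of the summands of \<open>aux_poly_digits\<close> are distinct.
\<close>

lemma norm_poly_order:
  assumes \<nu>: "\<nu> = m * k" "k > 0"
  obtains \<delta> h1 where "norm_poly \<nu> = monom 1 \<delta> * h1" "e * coeff h1 0 \<noteq> 0"
    "(q ^ m - 1) * \<delta> < q ^ \<nu>" "q ^ (\<nu> - m) \<le> \<delta>"
proof -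
  \<comment> \<open>For these \<open>j\<close> the factor is the pure power X^(q^j); every other
    factor has a nonzero constant term in \<open>L\<close>.\<close>
  define J where "J = {j. j < \<nu> \<and> m dvd j}"
  define \<delta> where "\<delta> = (\<Sum>j\<in>J. q ^ j)"
  define f where "f j = monom 1 (q ^ j) + [:\<theta> - \<theta> ^ (q ^ j):]" for j
  define h1 where "h1 = (\<Prod>j\<in>{..<\<nu>} - J. f j)"
  have fin: "finite J" by (simp add: J_def)
  have "norm_poly \<nu> = (\<Prod>j\<in>J. f j) * h1"
    unfolding norm_poly_def h1_def f_def[symmetric]
    by (subst prod.subset_diff[of J]) (auto simp: J_def mult.commute)
  also have "(\<Prod>j\<in>J. f j) = (\<Prod>j\<in>J. monom 1 (q ^ j))"
    by (intro prod.cong) (auto simp: f_def J_def theta_fixed_iff[THEN iffD2])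
  also have "\<dots> = monom 1 \<delta>"
    unfolding \<delta>_def using fin by (induction J rule: finite_induct) (auto simp: mult_monom)
  finally have 1: "norm_poly \<nu> = monom 1 \<delta> * h1" .
  have "coeff h1 0 = (\<Prod>j\<in>{..<\<nu>} - J. \<theta> - \<theta> ^ (q ^ j))"
    unfolding h1_def poly_0_coeff_0[symmetric] poly_prod
    by (intro prod.cong) (auto simp: f_def poly_monom)
  also have "e * \<dots> \<noteq> 0"
    by (intro L_prod_nonzero) (auto simp: J_def theta_L L_diff L_power dest: theta_fixed_iff[THEN iffD1, OF sym])
  finally have 2: "e * coeff h1 0 \<noteq> 0" .
  have "J = (\<lambda>i. m * i) ` {..<k}"
    using m_pos by (auto simp: J_def \<nu> elim!: dvdE)
  then have "\<delta> = (\<Sum>i<k. (q ^ m) ^ i)"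
    using m_pos by (simp add: \<delta>_def sum.reindex inj_on_def power_mult)
  then have 3: "(q ^ m - 1) * \<delta> < q ^ \<nu>"
    using geometric_sum_nat[of "q ^ m" k] by (simp add: \<nu> power_mult)
  have "\<nu> - m \<in> J" using m_pos \<nu> by (auto simp: J_def)
  then have 4: "q ^ (\<nu> - m) \<le> \<delta>" unfolding \<delta>_def using fin by (intro member_le_sum) auto
  show ?thesis by (rule that[OF 1 2 3 4])
qed

text \<open>The choice of \<open>A\<close> makes \<open>q A = q ^ (\<nu> - m)\<close> at most
  \<delta>, so every nonzero digit polynomial has order less than \<delta>. As
  \<open>d \<delta> < P\<close>, the order of the summand (i, j) lies in an interval of length
  \<delta> starting at \<open>P j + \<delta> i\<close>; these intervals are disjoint, so the first
  nonzero summand cannot cancel.\<close>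

lemma aux_poly_nonzero:
  assumes \<nu>: "\<nu> = m * k" "k > 1" and d: "d = q ^ m - 1" and A: "A = q ^ (\<nu> - m - 1)"
    and bL: "\<And>i j k l. i < d \<Longrightarrow> j < B \<Longrightarrow> k < q \<Longrightarrow> l < A \<Longrightarrow> b i j k l \<in> L"
    and nz: "b i1 j1 k1 l1 \<noteq> 0" "i1 < d" "j1 < B" "k1 < q" "l1 < A"
  shows "aux_poly \<nu> A B d b \<noteq> 0"
proof -
  define P where "P = q ^ \<nu>"
  obtain \<delta> h1 where h: "norm_poly \<nu> = monom 1 \<delta> * h1" and h1: "e * coeff h1 0 \<noteq> 0"
    and \<delta>: "d * \<delta> < P" "q ^ (\<nu> - m) \<le> \<delta>"
    using norm_poly_order[OF \<nu>(1)] \<nu>(2) d unfolding P_def by auto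
  have mk: "m + m \<le> \<nu>"
  proof -
    have "m * 2 \<le> m * k" using \<nu>(2) by (intro mult_le_mono2) simp
    then show ?thesis using \<nu>(1) by linarith
  qed
  then have "Suc (\<nu> - m - 1) = \<nu> - m" using m_pos by simp
  then have n: "\<nu> - m - 1 < \<nu>" "q ^ Suc (\<nu> - m - 1) \<le> \<delta>" using \<delta>(2) m_pos mk by auto
  define w where "w i j = digit_poly \<nu> A (b i j)" for i j
  have w_low: "\<exists>r<\<delta>. coeff (w i j) r \<noteq> 0" if "b i j k l \<noteq> 0" "k < q" "l < A" for i j k l
    using digit_poly_low_coeff[of "\<nu> - m - 1" \<nu> "b i j" k l] that n unfolding w_def A
    by (meson less_le_trans)
  define S where "S = {(i, j). i < d \<and> j < B \<and> w i j \<noteq> 0}"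
  have fin: "finite S"
    by (rule finite_subset[of _ "{..<d} \<times> {..<B}"]) (auto simp: S_def)
  have "w i1 j1 \<noteq> 0" using w_low[OF nz(1,4,5)] by auto
  then have ne: "S \<noteq> {}" using nz by (auto simp: S_def)
  \<comment> \<open>As \<open>i < d\<close>, this is the lexicographic order with \<open>j\<close>
    first, which is the order of the intervals.\<close>
  obtain i0 j0 where min: "(i0, j0) \<in> S" "\<And>i j. (i, j) \<in> S \<Longrightarrow> j0 * d + i0 \<le> j * d + i"
  proof -
    define f where "f = (\<lambda>(i, j). j * d + i)"
    have "Min (f ` S) \<in> f ` S" using fin ne by (intro Min_in) auto
    then obtain i0 j0 where 1: "(i0, j0) \<in> S" "Min (f ` S) = f (i0, j0)" by auto
    show ?thesis
    proof (rule that[OF 1(1)])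
      fix i j assume "(i, j) \<in> S"
      then have "f (i0, j0) \<le> f (i, j)"
        using 1(2) fin by (metis Min_le finite_imageI imageI)
      then show "j0 * d + i0 \<le> j * d + i"
        by (simp add: f_def)
    qed
  qed
  have ij0: "i0 < d" "j0 < B" "w i0 j0 \<noteq> 0" using min(1) by (auto simp: S_def)
  have ex: "\<exists>r<\<delta>. coeff (w i0 j0) r \<noteq> 0"
  proof -
    have "\<exists>k<q. \<exists>l<A. b i0 j0 k l \<noteq> 0"
    proof (rule ccontr)
      assume "\<not> ?thesis"
      then have "w i0 j0 = 0" by (simp add: w_def digit_poly_def)
      then show False using ij0 by simp
    qed
    then show ?thesis using w_low by blast
  qed
  define r0 where "r0 = (LEAST r. coeff (w i0 j0) r \<noteq> 0)"
  obtain r1 where r1: "r1 < \<delta>" "coeff (w i0 j0) r1 \<noteq> 0" using ex by blast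
  have r0: "coeff (w i0 j0) r0 \<noteq> 0" unfolding r0_def by (rule LeastI[of _ r1]) (rule r1(2))
  have r0_least: "coeff (w i0 j0) r = 0" if "r < r0" for r
    using not_less_Least that unfolding r0_def by blast
  have r0_less: "r0 < \<delta>"
    using Least_le[of "\<lambda>r. coeff (w i0 j0) r \<noteq> 0", OF r1(2)] r1(1) unfolding r0_def by simp
  define N where "N = P * j0 + \<delta> * i0 + r0"
  define u where "u = coeff (h1 ^ i0) 0 * coeff (w i0 j0) r0"
  have coeff_N: "coeff (monom 1 (P * j) * norm_poly \<nu> ^ i * w i j) N = (if i = i0 \<and> j = j0 then u else 0)"
    if ij: "i < d" "j < B" for i j
  proof -
    have eq: "monom 1 (P * j) * norm_poly \<nu> ^ i * w i j = monom 1 (P * j + \<delta> * i) * (h1 ^ i * w i j)"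
    proof -
      have "norm_poly \<nu> ^ i = monom 1 (\<delta> * i) * h1 ^ i"
        by (simp add: h power_mult_distrib monom_power)
      moreover have "monom (1::'r) (P * j + \<delta> * i) = monom 1 (P * j) * monom 1 (\<delta> * i)"
        by (simp add: mult_monom)
      ultimately show ?thesis by (simp only: mult.assoc)
    qed
    show ?thesis
    proof (cases "i = i0 \<and> j = j0")
      case True
      have "coeff (h1 ^ i0 * w i0 j0) r0 = (\<Sum>a\<le>r0. coeff (h1 ^ i0) a * coeff (w i0 j0) (r0 - a))"
        by (rule coeff_mult)
      also have "\<dots> = (\<Sum>a\<le>r0. if a = 0 then u else 0)"
        by (intro sum.cong) (auto simp: u_def r0_least)
      finally show ?thesis using True unfolding eq by (simp add: coeff_monom_mult N_def)
    next
      case False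
      show ?thesis
      proof (cases "w i j = 0")
        case w: False
        have le: "j0 * d + i0 \<le> j * d + i" using ij w by (intro min(2)) (simp add: S_def)
        have "j0 \<le> j"
        proof (rule ccontr)
          assume "\<not> j0 \<le> j"
          then have "Suc j * d \<le> j0 * d" by (intro mult_le_mono) auto
          then show False using le ij by simp
        qed
        have "P * j0 + \<delta> * i0 + \<delta> \<le> P * j + \<delta> * i"
        proof (cases "j = j0")
          case True
          then have "Suc i0 \<le> i" using le False by auto
          then have "\<delta> * Suc i0 \<le> \<delta> * i" by (intro mult_le_mono) auto
          then show ?thesis using True by simp
        next
          case False
          then have "P * Suc j0 \<le> P * j" using \<open>j0 \<le> j\<close> by (intro mult_le_mono) auto
          moreover have "\<delta> * Suc i0 \<le> d * \<delta>"
            using ij0 by (subst mult.commute) (intro mult_le_mono, auto)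
          ultimately show ?thesis using \<delta>(1) by simp
        qed
        then show ?thesis using False r0_less unfolding eq by (auto simp: coeff_monom_mult N_def)
      qed (use False in auto)
    qed
  qed
  have "coeff (aux_poly \<nu> A B d b) N = (\<Sum>i<d. \<Sum>j<B. coeff (monom 1 (P * j) * norm_poly \<nu> ^ i * w i j) N)"
    by (simp only: aux_poly_digits coeff_sum P_def w_def)
  also have "\<dots> = (\<Sum>i<d. \<Sum>j<B. if i = i0 \<and> j = j0 then u else 0)"
    by (intro sum.cong HOL.refl coeff_N) auto
  also have "\<dots> = (\<Sum>i<d. if i = i0 then u else 0)"
    by (intro sum.cong) (use ij0 in auto)
  also have "\<dots> = u" using ij0 by simp
  also have "u \<noteq> 0"
  proof
    assume "u = 0"
    have wL: "coeff (w i0 j0) r0 \<in> L"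
      unfolding w_def digit_poly_def using ij0 bL
      by (auto simp: coeff_sum intro!: L_sum L_multR)
    have "e * coeff (h1 ^ i0) 0 = 0"
      using \<open>u = 0\<close> r0 wL by (intro L_mult_0D) (auto simp: u_def mult.commute)
    then have "(e * coeff h1 0) ^ i0 = 0 \<and> i0 > 0"
      using e_nonzero by (cases "i0 = 0") (auto simp: coeff_0_power power_mult_distrib)
    then show False using h1 L_power_eq_0_iff[OF L_multR[OF e_L], of i0 "coeff h1 0"] by auto
  qed
  finally show ?thesis by auto
qed

end

section \<open>The point count\<close>

text \<open>There are more families of unknowns than vectors of values. In the application \<Phi> is
  additive, so the difference of the two families is a nonzero solution of \<open>D\<close>
  homogeneous equations in \<open>card I\<close> unknowns.\<close>

lemma pigeonhole_same_image:
  fixes \<Phi> :: "('i \<Rightarrow> 'r) \<Rightarrow> nat \<Rightarrow> 'r"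
  assumes I: "finite I" and F: "finite F" "card F > 1" and less: "D < card I"
    and range: "\<And>a i. a \<in> PiE I (\<lambda>_. F) \<Longrightarrow> i < D \<Longrightarrow> \<Phi> a i \<in> F"
  shows "\<exists>a\<in>PiE I (\<lambda>_. F). \<exists>b\<in>PiE I (\<lambda>_. F). a \<noteq> b \<and> (\<forall>i<D. \<Phi> a i = \<Phi> b i)"
proof -
  have "card (PiE {..<D} (\<lambda>_. F)) = card F ^ D" by (simp add: card_PiE)
  also have "\<dots> < card F ^ card I" using F less by (intro power_strict_increasing) auto
  also have "\<dots> = card (PiE I (\<lambda>_. F))" using I by (simp add: card_PiE)
  finally have "card (PiE {..<D} (\<lambda>_. F)) < card (PiE I (\<lambda>_. F))" .
  moreover have "finite (PiE {..<D} (\<lambda>_. F))" using F by (intro finite_PiE) auto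
  moreover have "(\<lambda>a. restrict (\<Phi> a) {..<D}) ` PiE I (\<lambda>_. F) \<subseteq> PiE {..<D} (\<lambda>_. F)"
    by (rule image_subsetI) (simp add: restrict_PiE_iff range)
  ultimately have "\<not> inj_on (\<lambda>a. restrict (\<Phi> a) {..<D}) (PiE I (\<lambda>_. F))"
    by (meson card_inj_on_le not_le)
  then obtain a b where ab: "a \<in> PiE I (\<lambda>_. F)" "b \<in> PiE I (\<lambda>_. F)" "a \<noteq> b"
    "restrict (\<Phi> a) {..<D} = restrict (\<Phi> b) {..<D}"
    by (auto simp: inj_on_def)
  have "\<Phi> a i = \<Phi> b i" if "i < D" for i
    using fun_cong[OF ab(4), of i] that by simp
  then show ?thesis using ab by blast
qed

section \<open>Comparison of the auxiliary polynomial with a polynomial of low degree\<close>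

context generated_corner
begin

text \<open>The leading coefficient \<open>1\<close> of \<open>norm_poly\<close> lies outside \<open>E m\<close>, whose unit is \<open>e\<close>.\<close>

definition multipliers :: "'r set" where "multipliers = {x. \<forall>y\<in>E m. x * y \<in> E m}"

definition multiplier_poly :: "'r poly \<Rightarrow> bool" where
  "multiplier_poly p \<longleftrightarrow> (\<forall>i. coeff p i \<in> multipliers)"

lemma multipliersI: "x \<in> E m \<Longrightarrow> x \<in> multipliers"
  by (simp add: multipliers_def E_mult)

lemma multipliers_closed:
  "0 \<in> multipliers" "1 \<in> multipliers" "x \<in> multipliers \<Longrightarrow> y \<in> multipliers \<Longrightarrow> x + y \<in> multipliers"
  "x \<in> multipliers \<Longrightarrow> y \<in> multipliers \<Longrightarrow> x - y \<in> multipliers"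
  "x \<in> multipliers \<Longrightarrow> y \<in> multipliers \<Longrightarrow> x * y \<in> multipliers"
  by (simp_all add: multipliers_def distrib_right left_diff_distrib E_add E_diff mult.assoc)

lemma multipliers_sum: "(\<And>i. i \<in> I \<Longrightarrow> f i \<in> multipliers) \<Longrightarrow> sum f I \<in> multipliers"
  by (induction I rule: infinite_finite_induct) (auto intro: multipliers_closed)

lemma multiplier_poly_mult: "multiplier_poly p \<Longrightarrow> multiplier_poly r \<Longrightarrow> multiplier_poly (p * r)"
  by (auto simp: multiplier_poly_def coeff_mult intro!: multipliers_sum multipliers_closed)

lemma multiplier_poly_1: "multiplier_poly 1"
  by (simp add: multiplier_poly_def coeff_1 multipliers_closed)

lemma multiplier_poly_power: "multiplier_poly p \<Longrightarrow> multiplier_poly (p ^ n)"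
  by (induction n) (auto intro: multiplier_poly_mult multiplier_poly_1)

lemma multiplier_poly_prod: "(\<And>i. i \<in> I \<Longrightarrow> multiplier_poly (f i)) \<Longrightarrow> multiplier_poly (prod f I)"
  by (induction I rule: infinite_finite_induct) (auto intro: multiplier_poly_mult multiplier_poly_1)

lemma multiplier_poly_monom: "multiplier_poly (monom 1 n)"
  by (simp add: multiplier_poly_def multipliers_closed)

lemma multiplier_poly_const: "x \<in> E m \<Longrightarrow> multiplier_poly [:x:]"
  by (simp add: multiplier_poly_def multipliers_closed multipliersI coeff_pCons split: nat.split)

lemma multiplier_poly_add: "multiplier_poly p \<Longrightarrow> multiplier_poly r \<Longrightarrow> multiplier_poly (p + r)"
  by (simp add: multiplier_poly_def multipliers_closed)

lemma multiplier_poly_diff: "multiplier_poly p \<Longrightarrow> multiplier_poly r \<Longrightarrow> multiplier_poly (p - r)"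
  by (simp add: multiplier_poly_def multipliers_closed)

lemma multiplier_norm_poly: "multiplier_poly (norm_poly \<nu>)"
  unfolding norm_poly_def
  by (intro multiplier_poly_prod multiplier_poly_add multiplier_poly_monom multiplier_poly_const
      E_diff theta_E E_power) simp

lemma multiplier_trace_poly: "multiplier_poly (trace_poly \<nu>)"
  unfolding trace_poly_def multiplier_poly_def coeff_sum
  by (auto intro!: multipliers_sum simp: multipliers_closed)

text \<open>At points with \<open>s ^ (P * P) = s\<close>, \<open>h * h ^ P = \<zeta>\<close> and
  \<open>v + v ^ P = c\<close> this takes the value \<open>h ^ (d - 1) * W ^ P\<close>: the power
  \<open>P\<close> turns \<open>s ^ (l + P * j)\<close> into \<open>s ^ (P * l + j)\<close>,
  \<open>h ^ i\<close> into \<zeta>^i / h^i and \<open>v ^ k\<close> into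
  \<open>(c - v) ^ k\<close>, and the factor \<open>h ^ (d - 1)\<close> clears the
  denominators.\<close>

definition cond_poly ::
    "nat \<Rightarrow> nat \<Rightarrow> nat \<Rightarrow> nat \<Rightarrow> 'r \<Rightarrow> 'r \<Rightarrow> (nat \<Rightarrow> nat \<Rightarrow> nat \<Rightarrow> nat \<Rightarrow> 'r) \<Rightarrow> 'r poly" where
  "cond_poly \<nu> A B d \<zeta> c b =
     (\<Sum>i<d. \<Sum>j<B. \<Sum>k<q. \<Sum>l<A. smult (b i j k l)
       (smult (\<zeta> ^ i) (monom 1 (q ^ \<nu> * l + j) * norm_poly \<nu> ^ (d - 1 - i) * ([:c:] - trace_poly \<nu>) ^ k)))"

lemma degree_norm_trace_term:
  assumes "i < d" "k < q"
  shows "degree (monom 1 n * norm_poly \<nu> ^ i * trace_poly \<nu> ^ k) \<le> n + d * q ^ \<nu> + q ^ \<nu>"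
    and "degree (monom 1 n * norm_poly \<nu> ^ i * ([:c:] - trace_poly \<nu>) ^ k) \<le> n + (d - 1) * q ^ \<nu> + q ^ \<nu>"
proof -
  have h: "degree (norm_poly \<nu> ^ i) \<le> (d - 1) * q ^ \<nu>"
  proof -
    have "degree (norm_poly \<nu> ^ i) \<le> degree (norm_poly \<nu>) * i" by (rule degree_power_le)
    also have "\<dots> \<le> q ^ \<nu> * (d - 1)" using assms degree_norm_poly[of \<nu>] by (intro mult_le_mono) auto
    finally show ?thesis by (simp add: mult.commute)
  qed
  have tr: "degree (r ^ k) \<le> q ^ \<nu>" if "degree r \<le> degree (trace_poly \<nu>)" for r :: "'r poly"
  proof -
    have "degree (r ^ k) \<le> degree r * k" by (rule degree_power_le)
    also have "\<dots> \<le> k * degree (trace_poly \<nu>)" using that by (simp add: mult.commute)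
    also have "\<dots> \<le> q ^ \<nu>" by (rule degree_trace_poly[OF assms(2)])
    finally show ?thesis .
  qed
  have gen: "degree (monom 1 n * norm_poly \<nu> ^ i * r ^ k) \<le> n + (d - 1) * q ^ \<nu> + q ^ \<nu>"
    if "degree r \<le> degree (trace_poly \<nu>)" for r :: "'r poly"
  proof -
    have "degree (monom 1 n * norm_poly \<nu> ^ i * r ^ k)
        \<le> degree (monom (1::'r) n) + degree (norm_poly \<nu> ^ i) + degree (r ^ k)"
      using degree_mult_le[of "monom 1 n * norm_poly \<nu> ^ i" "r ^ k"]
        degree_mult_le[of "monom 1 n" "norm_poly \<nu> ^ i"] by linarith
    also have "\<dots> \<le> n + (d - 1) * q ^ \<nu> + q ^ \<nu>"
      using h tr[OF that] degree_monom_le[of "1::'r" n] by linarith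
    finally show ?thesis .
  qed
  have "(d - 1) * q ^ \<nu> \<le> d * q ^ \<nu>" by (intro mult_le_mono) auto
  then show "degree (monom 1 n * norm_poly \<nu> ^ i * trace_poly \<nu> ^ k) \<le> n + d * q ^ \<nu> + q ^ \<nu>"
    using gen[of "trace_poly \<nu>"] by linarith
  have "degree ([:c:] - trace_poly \<nu>) \<le> degree (trace_poly \<nu>)"
    by (intro degree_diff_le) auto
  then show "degree (monom 1 n * norm_poly \<nu> ^ i * ([:c:] - trace_poly \<nu>) ^ k) \<le> n + (d - 1) * q ^ \<nu> + q ^ \<nu>"
    by (rule gen)
qed

lemma degree_aux_poly:
  assumes "A \<le> q ^ \<nu>"
  shows "degree (aux_poly \<nu> A B d b) \<le> q ^ \<nu> * (B + d + 1)"
proof -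
  have "degree (smult (b i j k l) (monom 1 (l + q ^ \<nu> * j) * norm_poly \<nu> ^ i * trace_poly \<nu> ^ k)) \<le> q ^ \<nu> * (B + d + 1)"
    if "i < d" "j < B" "k < q" "l < A" for i j k l
  proof -
    have "q ^ \<nu> * Suc j \<le> q ^ \<nu> * B" using that by (intro mult_le_mono) auto
    then have "l + q ^ \<nu> * j \<le> q ^ \<nu> * B" using that assms by simp
    then have "l + q ^ \<nu> * j + d * q ^ \<nu> + q ^ \<nu> \<le> q ^ \<nu> * (B + d + 1)" by (simp add: algebra_simps)
    then show ?thesis
      by (intro order_trans[OF degree_smult_le] order_trans[OF degree_norm_trace_term(1)[OF that(1,3)]])
  qed
  then show ?thesis unfolding aux_poly_def by (intro degree_sum_le) auto
qed

lemma degree_cond_poly: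
  assumes "A > 0" "B > 0"
  shows "degree (cond_poly \<nu> A B d \<zeta> c b) < q ^ \<nu> * A + d * q ^ \<nu> + B"
proof (cases "d = 0")
  case False
  have "degree (smult (b i j k l) (smult (\<zeta> ^ i) (monom 1 (q ^ \<nu> * l + j) * norm_poly \<nu> ^ (d - 1 - i) * ([:c:] - trace_poly \<nu>) ^ k)))
      \<le> q ^ \<nu> * A + d * q ^ \<nu> + B - 1"
    if "i < d" "j < B" "k < q" "l < A" for i j k l
  proof -
    have "q ^ \<nu> * l + q ^ \<nu> \<le> q ^ \<nu> * A" using that mult_le_mono2[of "Suc l" A "q ^ \<nu>"] by simp
    moreover have "(d - 1) * q ^ \<nu> + q ^ \<nu> = d * q ^ \<nu>" using False by (cases d) auto
    moreover have "q ^ \<nu> > 0" by simp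
    ultimately have "(q ^ \<nu> * l + j) + (d - 1) * q ^ \<nu> + q ^ \<nu> \<le> q ^ \<nu> * A + d * q ^ \<nu> + B - 1"
      using that by linarith
    moreover have "d - 1 - i < d" using False by simp
    ultimately show ?thesis
      by (meson degree_norm_trace_term(2)[OF _ that(3)] degree_smult_le order_trans)
  qed
  then have "degree (cond_poly \<nu> A B d \<zeta> c b) \<le> q ^ \<nu> * A + d * q ^ \<nu> + B - 1"
    unfolding cond_poly_def by (intro degree_sum_le) auto
  then show ?thesis using assms by simp
qed (use assms in \<open>simp add: cond_poly_def\<close>)

text \<open>This confines the conditions to the finite field \<open>E m\<close>, as the pigeonhole
  argument requires.\<close>

lemma coeff_cond_poly_E:
  assumes "\<zeta> \<in> E m" "c \<in> E m" "\<And>i j k l. i < d \<Longrightarrow> j < B \<Longrightarrow> k < q \<Longrightarrow> l < A \<Longrightarrow> b i j k l \<in> E m"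
  shows "coeff (cond_poly \<nu> A B d \<zeta> c b) n \<in> E m"
proof -
  have "multiplier_poly (smult (\<zeta> ^ i) (monom 1 (q ^ \<nu> * l + j) * norm_poly \<nu> ^ (d - 1 - i) * ([:c:] - trace_poly \<nu>) ^ k))" for i j k l
  proof -
    have "\<zeta> ^ i \<in> multipliers"
      by (cases "i = 0") (auto intro!: multipliersI E_power assms simp: multipliers_closed)
    then have "multiplier_poly [:\<zeta> ^ i:]"
      by (simp add: multiplier_poly_def multipliers_closed coeff_pCons split: nat.split)
    then have "multiplier_poly ([:\<zeta> ^ i:] * (monom 1 (q ^ \<nu> * l + j) * norm_poly \<nu> ^ (d - 1 - i) * ([:c:] - trace_poly \<nu>) ^ k))"
      by (intro multiplier_poly_mult multiplier_poly_power multiplier_poly_diff multiplier_poly_monom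
          multiplier_poly_const[OF assms(2)] multiplier_norm_poly multiplier_trace_poly)
    then show ?thesis by simp
  qed
  moreover have "coeff (smult x p) n \<in> E m" if "multiplier_poly p" "x \<in> E m" for x p
    using that by (auto simp: multiplier_poly_def multipliers_def mult.commute)
  ultimately show ?thesis unfolding cond_poly_def coeff_sum
    using assms(3) by (intro E_sum) (auto simp del: coeff_smult smult_smult)
qed

lemma cond_poly_diff:
  "cond_poly \<nu> A B d \<zeta> c (\<lambda>i j k l. a i j k l - b i j k l) = cond_poly \<nu> A B d \<zeta> c a - cond_poly \<nu> A B d \<zeta> c b"
  by (simp only: cond_poly_def smult_diff_left sum_subtractf)

text \<open>The power \<open>P\<close> is additive on \<open>L\<close> and fixes the coefficients
  because \<open>m dvd \<nu>\<close>; the rest is the computation with single terms that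
  \<open>cond_poly\<close> is made for.\<close>

lemma aux_poly_eval:
  assumes m: "m dvd \<nu>" and P: "P = q ^ \<nu>"
    and b: "\<And>i j k l. i < d \<Longrightarrow> j < B \<Longrightarrow> k < q \<Longrightarrow> l < A \<Longrightarrow> b i j k l \<in> E m"
    and s: "s \<in> L" "s ^ (P * P) = s"
    and h: "h = poly (norm_poly \<nu>) s" "h * h ^ P = \<zeta>"
    and v: "v = poly (trace_poly \<nu>) s" "v + v ^ P = c"
  shows "h ^ (d - 1) * poly (aux_poly \<nu> A B d b) s ^ P = poly (cond_poly \<nu> A B d \<zeta> c b) s"
proof -
  define T where "T i j k l = b i j k l * (s ^ (l + P * j) * h ^ i * v ^ k)" for i j k l
  have W: "poly (aux_poly \<nu> A B d b) s = (\<Sum>i<d. \<Sum>j<B. \<Sum>k<q. \<Sum>l<A. T i j k l)"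
    by (simp add: aux_poly_def poly_sum poly_monom T_def P h(1) v(1))
  have TL: "T i j k l \<in> L" if "i < d" "j < B" "k < q" "l < A" for i j k l
    using E_L[OF b[OF that]] by (simp add: T_def L_multR)
  have "poly (aux_poly \<nu> A B d b) s ^ P = (\<Sum>i<d. (\<Sum>j<B. \<Sum>k<q. \<Sum>l<A. T i j k l) ^ P)"
    unfolding W P by (rule frob_sum) (auto intro!: L_sum TL)
  also have "\<dots> = (\<Sum>i<d. \<Sum>j<B. (\<Sum>k<q. \<Sum>l<A. T i j k l) ^ P)"
    unfolding P by (intro sum.cong HOL.refl frob_sum) (auto intro!: L_sum TL)
  also have "\<dots> = (\<Sum>i<d. \<Sum>j<B. \<Sum>k<q. (\<Sum>l<A. T i j k l) ^ P)"
    unfolding P by (intro sum.cong HOL.refl frob_sum) (auto intro!: L_sum TL)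
  also have "\<dots> = (\<Sum>i<d. \<Sum>j<B. \<Sum>k<q. \<Sum>l<A. T i j k l ^ P)"
    unfolding P by (intro sum.cong HOL.refl frob_sum) (auto intro!: TL)
  finally have "poly (aux_poly \<nu> A B d b) s ^ P = (\<Sum>i<d. \<Sum>j<B. \<Sum>k<q. \<Sum>l<A. T i j k l ^ P)" .
  then have "h ^ (d - 1) * poly (aux_poly \<nu> A B d b) s ^ P
      = (\<Sum>i<d. \<Sum>j<B. \<Sum>k<q. \<Sum>l<A. h ^ (d - 1) * T i j k l ^ P)"
    by (simp only: sum_distrib_left)
  also have "\<dots> = (\<Sum>i<d. \<Sum>j<B. \<Sum>k<q. \<Sum>l<A. b i j k l * (\<zeta> ^ i * (s ^ (P * l + j) * h ^ (d - 1 - i) * (c - v) ^ k)))"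
  proof (intro sum.cong HOL.refl)
    fix i j k l assume "i \<in> {..<d}" "j \<in> {..<B}" "k \<in> {..<q}" "l \<in> {..<A}"
    then have ijkl: "i < d" "j < B" "k < q" "l < A" by auto
    have 1: "b i j k l ^ P = b i j k l"
      using E_dvd[OF b[OF ijkl] m] by (simp add: E_def P)
    have 2: "(s ^ (l + P * j)) ^ P = s ^ (P * l + j)"
    proof -
      have "(s ^ (l + P * j)) ^ P = s ^ (P * l) * (s ^ (P * P)) ^ j"
        by (simp add: power_add power_mult[symmetric] power_mult_distrib algebra_simps)
      then show ?thesis by (simp add: s power_add)
    qed
    have 3: "(v ^ k) ^ P = (c - v) ^ k"
    proof -
      have "(v ^ k) ^ P = (v ^ P) ^ k" by (simp add: power_mult[symmetric] mult.commute)
      also have "v ^ P = c - v" using v(2) by (simp add: algebra_simps)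
      finally show ?thesis .
    qed
    have 4: "h ^ (d - 1) * (h ^ i) ^ P = \<zeta> ^ i * h ^ (d - 1 - i)"
    proof -
      have "h ^ (d - 1) = h ^ i * h ^ (d - 1 - i)" using ijkl by (simp add: power_add[symmetric])
      moreover have "(h ^ i) ^ P = (h ^ P) ^ i" by (simp add: power_mult[symmetric] mult.commute)
      moreover have "\<zeta> ^ i = h ^ i * (h ^ P) ^ i" by (simp only: h(2)[symmetric] power_mult_distrib)
      ultimately show ?thesis by (simp add: mult_ac)
    qed
    have "h ^ (d - 1) * T i j k l ^ P
        = b i j k l ^ P * ((h ^ (d - 1) * (h ^ i) ^ P) * ((s ^ (l + P * j)) ^ P * (v ^ k) ^ P))"
      by (simp only: T_def power_mult_distrib mult_ac)
    also have "\<dots> = b i j k l * (\<zeta> ^ i * (s ^ (P * l + j) * h ^ (d - 1 - i) * (c - v) ^ k))"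
      unfolding 1 2 3 4 by (simp only: mult_ac)
    finally show "h ^ (d - 1) * T i j k l ^ P = b i j k l * (\<zeta> ^ i * (s ^ (P * l + j) * h ^ (d - 1 - i) * (c - v) ^ k))" .
  qed
  also have "\<dots> = poly (cond_poly \<nu> A B d \<zeta> c b) s"
    by (simp add: cond_poly_def poly_sum poly_monom P h(1) v(1) mult.assoc)
  finally show ?thesis .
qed

lemma poly_norm_poly_L:
  assumes "\<nu> > 0" "s \<in> L"
  shows "poly (norm_poly \<nu>) s \<in> L"
  unfolding norm_poly_def poly_prod
  by (rule L_prod[of _ 0]) (use assms in \<open>auto simp: poly_monom intro!: L_add L_diff theta_L L_power\<close>)

text \<open>Stepanov's argument: making \<open>cond_poly\<close> vanish identically imposes fewer
  conditions than there are unknown coefficients, so some nonzero \<open>W\<close> has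
  \<open>h ^ (d - 1) * W ^ P = 0\<close> at all points of the set. There \<open>h\<close> is nonzero
  since \<zeta> is, so \<open>W\<close> vanishes, and its degree bounds the number of
  points.\<close>

lemma card_norm_trace_le:
  assumes \<nu>: "\<nu> = m * k" "k > 2" and d: "d = q ^ m - 1" and P: "P = q ^ \<nu>"
    and \<zeta>: "\<zeta> \<in> E m" "\<zeta> \<noteq> 0" and c: "c \<in> E m"
  shows "card {s\<in>L. s ^ (P * P) = s \<and> poly (norm_poly \<nu>) s * poly (norm_poly \<nu>) s ^ P = \<zeta> \<and>
       poly (trace_poly \<nu>) s + poly (trace_poly \<nu>) s ^ P = c} \<le> P * (P div (d * q) + 4 * q ^ m + 1)"
    (is "card ?Z \<le> _")
proof -
  define A where "A = q ^ (\<nu> - m - 1)"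
  \<comment> \<open>There are \<open>d B q A\<close> unknowns, and \<open>P = q ^ m q A\<close>. The
    part \<open>P div (d * q) + 1\<close> of \<open>B\<close> pays for \<open>P * A\<close> of the
    \<open>D\<close> conditions; the part \<open>3 * q ^ m\<close> yields \<open>3 d P\<close>
    unknowns, which cover the remaining \<open>d * P + B\<close>.\<close>
  define B where "B = P div (d * q) + 3 * q ^ m + 1"
  define D where "D = P * A + d * P + B"
  have qm: "q ^ m > 1" using q_power_gt1 m_pos by simp
  have d0: "d > 0" "q ^ m = d + 1" using qm d by auto
  have mk: "3 * m \<le> \<nu>"
  proof -
    have "m * 3 \<le> m * k" using \<nu>(2) by (intro mult_le_mono2) simp
    then show ?thesis using \<nu>(1) by linarith
  qed
  have P_A: "P = q ^ m * q * A"
  proof -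
    have "\<nu> = m + 1 + (\<nu> - m - 1)" using mk m_pos by linarith
    then show ?thesis unfolding P A_def by (metis power_add power_one_right)
  qed
  have A0: "A > 0" by (simp add: A_def)
  \<comment> \<open>The bound \<open>3 * m \<le> \<nu>\<close>, which comes from
    \<open>k > 2\<close>, is used here to prepare \<open>B < 2 * P\<close>.\<close>
  have P_ge: "P \<ge> 4 * q ^ m"
  proof -
    have "2 * 2 * q ^ m \<le> q ^ m * q ^ m * q ^ m" using qm by (intro mult_le_mono) auto
    also have "\<dots> = q ^ (3 * m)" by (simp add: power_add[symmetric] mult.commute numeral_3_eq_3 add.assoc)
    also have "\<dots> \<le> P" unfolding P using mk q_gt1 by (intro power_increasing) auto
    finally show ?thesis by simp
  qed
  have B_less: "B < 2 * P"
  proof -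
    have "2 * (P div (d * q)) \<le> (d * q) * (P div (d * q))" using d0 q_gt1
      by (intro mult_le_mono1) (metis Suc_1 Suc_leI One_nat_def mult_le_mono nat_mult_1)
    also have "\<dots> \<le> P" by simp
    finally show ?thesis using P_ge qm by (simp add: B_def)
  qed
  have D_less: "D < d * (B * (q * A))"
  proof -
    have "P < d * q * (P div (d * q)) + d * q"
      using d0 by (metis add.commute mod_less_divisor mult_div_mod_eq nat_add_left_cancel_less
          nat_0_less_mult_iff q_pos)
    then have "P * A + d * q * A * (3 * q ^ m) < d * q * (P div (d * q)) * A + d * q * A + d * q * A * (3 * q ^ m)"
      using A0 by (metis add_less_cancel_right distrib_right mult.commute mult_less_cancel2)
    also have "\<dots> = d * (B * (q * A))" by (simp add: B_def algebra_simps)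
    also have "d * q * A * (3 * q ^ m) = 3 * (d * P)" by (simp add: P_A algebra_simps)
    finally have "P * A + 3 * (d * P) < d * (B * (q * A))" .
    moreover have "P \<le> d * P" using d0 by simp
    ultimately show ?thesis using B_less unfolding D_def by linarith
  qed
  define I where "I = {..<d} \<times> {..<B} \<times> {..<q} \<times> {..<A}"
  define curry4 :: "(nat \<times> nat \<times> nat \<times> nat \<Rightarrow> 'r) \<Rightarrow> nat \<Rightarrow> nat \<Rightarrow> nat \<Rightarrow> nat \<Rightarrow> 'r"
    where "curry4 a i j k l = a (i, j, k, l)" for a i j k l
  have I: "finite I" "card I = d * (B * (q * A))" by (simp_all add: I_def)
  have "\<exists>a\<in>PiE I (\<lambda>_. E m). \<exists>b\<in>PiE I (\<lambda>_. E m). a \<noteq> b \<and>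
      (\<forall>n<D. coeff (cond_poly \<nu> A B d \<zeta> c (curry4 a)) n = coeff (cond_poly \<nu> A B d \<zeta> c (curry4 b)) n)"
    using I D_less finite_E[OF m_pos] card_E[OF m_pos] qm \<zeta> c
    by (intro pigeonhole_same_image coeff_cond_poly_E) (auto simp: curry4_def I_def)
  then obtain a1 a2 where a: "a1 \<in> PiE I (\<lambda>_. E m)" "a2 \<in> PiE I (\<lambda>_. E m)" "a1 \<noteq> a2"
    "\<And>n. n < D \<Longrightarrow> coeff (cond_poly \<nu> A B d \<zeta> c (curry4 a1)) n = coeff (cond_poly \<nu> A B d \<zeta> c (curry4 a2)) n"
    by blast
  have "cond_poly \<nu> A B d \<zeta> c (curry4 a1) = cond_poly \<nu> A B d \<zeta> c (curry4 a2)"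
  proof (rule poly_eqI)
    fix n
    have "coeff (cond_poly \<nu> A B d \<zeta> c (curry4 a)) n = 0" if "\<not> n < D" for a
    proof -
      have "degree (cond_poly \<nu> A B d \<zeta> c (curry4 a)) < D"
        unfolding D_def P using A0 by (intro degree_cond_poly) (auto simp: B_def)
      then show ?thesis using that by (intro coeff_eq_0) simp
    qed
    then show "coeff (cond_poly \<nu> A B d \<zeta> c (curry4 a1)) n = coeff (cond_poly \<nu> A B d \<zeta> c (curry4 a2)) n"
      using a(4)[of n] by (cases "n < D") simp_all
  qed
  \<comment> \<open>\<open>cond_poly\<close> is additive in the coefficients, so it vanishes for the
    difference of the two families.\<close>
  define b where "b = (\<lambda>i j k l. curry4 a1 i j k l - curry4 a2 i j k l)"
  have cond0: "cond_poly \<nu> A B d \<zeta> c b = 0"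
    unfolding b_def cond_poly_diff using \<open>cond_poly \<nu> A B d \<zeta> c (curry4 a1) = _\<close> by simp
  have bE: "b i j k l \<in> E m" if "i < d" "j < B" "k < q" "l < A" for i j k l
    using a(1,2) that by (auto simp: b_def curry4_def I_def intro!: E_diff)
  obtain x where x: "x \<in> I" "a1 x \<noteq> a2 x" using a(1-3) by (metis PiE_ext)
  obtain i1 j1 k1 l1 where "x = (i1, j1, k1, l1)" by (cases x)
  with x have nz: "b i1 j1 k1 l1 \<noteq> 0" "i1 < d" "j1 < B" "k1 < q" "l1 < A"
    by (auto simp: b_def curry4_def I_def)
  define W where "W = aux_poly \<nu> A B d b"
  have W0: "W \<noteq> 0" unfolding W_def
    using \<nu>(2) E_L[OF bE] by (intro aux_poly_nonzero[where b = b, OF \<nu>(1) _ d A_def _ nz]) auto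
  have We: "smult e W = W"
    unfolding smult_e_iff W_def aux_poly_def coeff_sum
    by (auto intro!: L_sum L_multR E_L[OF bE])
  have "?Z \<subseteq> {s\<in>L. poly W s = 0}"
  proof
    fix s assume s: "s \<in> ?Z"
    define h where "h = poly (norm_poly \<nu>) s"
    have hL: "h \<in> L" using s mk m_pos by (auto simp: h_def intro!: poly_norm_poly_L)
    have h0: "h \<noteq> 0" using s \<zeta>(2) by (auto simp: h_def)
    have "h ^ (d - 1) * poly W s ^ P = 0"
      using aux_poly_eval[where \<nu> = \<nu> and P = P and b = b and d = d and A = A and B = B and s = s
          and h = h and \<zeta> = \<zeta> and v = "poly (trace_poly \<nu>) s" and c = c] s \<nu>(1) cond0 bE P
      by (auto simp: W_def h_def)
    then have "h * (h ^ (d - 1) * poly W s ^ P) = 0" by simp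
    then have "h ^ d * poly W s ^ P = 0" using d0(1) by (simp add: power_eq_if mult.assoc)
    then have "poly W s ^ P = 0"
      using hL h0 d0(1) poly_L[OF We] P
      by (subst (asm) L_mult_eq_0_iff) (auto simp: L_power L_power_eq_0_iff)
    then show "s \<in> {s\<in>L. poly W s = 0}"
      using s poly_L[OF We] P by (simp add: L_power_eq_0_iff)
  qed
  then have "card ?Z \<le> card {s\<in>L. poly W s = 0}"
    using card_roots_le[OF We W0] by (intro card_mono) auto
  also have "\<dots> \<le> degree W" using card_roots_le[OF We W0] by simp
  also have "\<dots> \<le> P * (B + d + 1)"
    unfolding W_def P by (rule degree_aux_poly) (use q_gt1 in \<open>simp add: A_def power_increasing\<close>)
  also have "B + d + 1 = P div (d * q) + 4 * q ^ m + 1" using d0 by (simp add: B_def)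
  finally show ?thesis .
qed

end

section \<open>Character sums over extensions\<close>

text \<open>Only upper bounds for the fibres are at hand. Since \<open>g\<close> sums to zero,
  \<open>M\<close> may be subtracted from every fibre size; the deficits are nonnegative and add up
  to \<open>card Y * M - card U1\<close>. A point mapped outside \<open>Y\<close> counts twice, once
  for its own term and once for being absent from \<open>U1\<close>.\<close>

lemma norm_sum_le_of_fibres:
  fixes g :: "'b \<Rightarrow> complex" and M :: real
  assumes fin: "finite U" "finite Y"
    and fibre: "\<And>y. y \<in> Y \<Longrightarrow> real (card {t\<in>U. f t = y}) \<le> M"
    and g: "\<And>y. y \<in> Y \<Longrightarrow> cmod (g y) \<le> 1" "\<And>t. t \<in> U \<Longrightarrow> cmod (g (f t)) \<le> 1"
    and sum0: "sum g Y = 0"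
  shows "cmod (\<Sum>t\<in>U. g (f t)) \<le> card Y * M - card U + 2 * card {t\<in>U. f t \<notin> Y}"
proof -
  define U0 where "U0 = {t\<in>U. f t \<notin> Y}"
  define U1 where "U1 = {t\<in>U. f t \<in> Y}"
  define N where "N y = card {t\<in>U. f t = y}" for y
  have fin': "finite U0" "finite U1" using fin by (auto simp: U0_def U1_def)
  have split: "U = U0 \<union> U1" "U0 \<inter> U1 = {}" by (auto simp: U0_def U1_def)
  have fibre_sum: "sum h U1 = (\<Sum>y\<in>Y. \<Sum>t\<in>{t\<in>U. f t = y}. h t)" for h :: "'a \<Rightarrow> 'c::comm_monoid_add"
  proof -
    have "(\<Sum>y\<in>Y. \<Sum>t\<in>{t\<in>U1. f t = y}. h t) = sum h U1"
      using fin'(2) fin(2) by (intro sum.group) (auto simp: U1_def)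
    moreover have "{t\<in>U1. f t = y} = {t\<in>U. f t = y}" if "y \<in> Y" for y using that by (auto simp: U1_def)
    ultimately show ?thesis by simp
  qed
  have card_U1: "card U1 = (\<Sum>y\<in>Y. N y)"
    using fibre_sum[of "\<lambda>_. 1::nat"] by (simp add: N_def)
  have "(\<Sum>t\<in>U1. g (f t)) = (\<Sum>y\<in>Y. \<Sum>t\<in>{t\<in>U. f t = y}. g y)"
    unfolding fibre_sum by (intro sum.cong) auto
  also have "\<dots> = (\<Sum>y\<in>Y. of_nat (N y) * g y)" by (simp add: N_def)
  also have "\<dots> = (\<Sum>y\<in>Y. of_nat (N y) * g y) - of_real M * sum g Y" using sum0 by simp
  also have "\<dots> = (\<Sum>y\<in>Y. of_real (real (N y) - M) * g y)"
    by (simp add: sum_distrib_left sum_subtractf left_diff_distrib)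
  also have "cmod \<dots> \<le> (\<Sum>y\<in>Y. M - real (N y))"
  proof (rule sum_norm_le)
    fix y assume y: "y \<in> Y"
    have "cmod (of_real (real (N y) - M) * g y) = (M - real (N y)) * cmod (g y)"
      using fibre[OF y] by (simp only: norm_mult norm_of_real) (simp add: N_def)
    also have "\<dots> \<le> (M - real (N y)) * 1"
      using fibre[OF y] g(1)[OF y] by (intro mult_left_mono) (auto simp: N_def)
    finally show "cmod (of_real (real (N y) - M) * g y) \<le> M - real (N y)" by simp
  qed
  also have "\<dots> = card Y * M - card U1" by (simp add: card_U1 sum_subtractf)
  finally have 1: "cmod (\<Sum>t\<in>U1. g (f t)) \<le> card Y * M - card U1" .
  have 2: "cmod (\<Sum>t\<in>U0. g (f t)) \<le> card U0"
    using sum_norm_le[of U0 "\<lambda>t. g (f t)" "\<lambda>_. 1"] g(2) by (simp add: U0_def)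
  have "(\<Sum>t\<in>U. g (f t)) = (\<Sum>t\<in>U0. g (f t)) + (\<Sum>t\<in>U1. g (f t))"
    using fin' split by (simp add: sum.union_disjoint)
  then have "cmod (\<Sum>t\<in>U. g (f t)) \<le> cmod (\<Sum>t\<in>U0. g (f t)) + cmod (\<Sum>t\<in>U1. g (f t))"
    by (simp add: norm_triangle_ineq)
  moreover have "card U = card U0 + card U1" using fin' split by (simp add: card_Un_disjoint)
  ultimately show ?thesis using 1 2 by (simp add: U0_def)
qed

text \<open>\<chi> is the extended character: it is multiplicative also at zero, and its modulus is
  only bounded by 1 because \<open>\<chi> 0\<close> may be 0.\<close>

locale character_corner = generated_corner e K q m \<theta>
  for e :: "'r::comm_ring_1" and K q m \<theta> +
  fixes \<chi> \<psi> :: "'r \<Rightarrow> complex"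
  assumes chi_mult: "x \<in> E m \<Longrightarrow> y \<in> E m \<Longrightarrow> \<chi> (x * y) = \<chi> x * \<chi> y"
    and chi_e: "\<chi> e = 1" and chi_norm: "x \<in> E m \<Longrightarrow> cmod (\<chi> x) \<le> 1"
    and psi_add: "x \<in> K \<Longrightarrow> y \<in> K \<Longrightarrow> \<psi> (x + y) = \<psi> x * \<psi> y"
    and psi_0: "\<psi> 0 = 1" and psi_norm: "x \<in> K \<Longrightarrow> cmod (\<psi> x) \<le> 1"
    and nontrivial: "(\<exists>x\<in>K. \<psi> x \<noteq> 1) \<or> (\<chi> 0 = 0 \<and> (\<exists>x\<in>E m. x \<noteq> 0 \<and> \<chi> x \<noteq> 1))"
begin

lemma sum_psi:
  assumes "c \<in> K" "\<psi> c \<noteq> 1"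
  shows "(\<Sum>x\<in>K. \<psi> x) = 0"
proof -
  have "bij_betw (\<lambda>x. x + c) K K"
    by (rule bij_betw_byWitness[where f' = "\<lambda>x. x - c"]) (auto intro: K_add K_diff assms)
  then have "(\<Sum>x\<in>K. \<psi> x) = (\<Sum>x\<in>K. \<psi> (x + c))" by (rule sum.reindex_bij_betw[symmetric])
  also have "\<dots> = (\<Sum>x\<in>K. \<psi> x) * \<psi> c"
    using assms by (simp add: psi_add sum_distrib_right)
  finally show ?thesis using assms(2) by simp
qed

lemma sum_chi:
  assumes "x \<in> E m" "x \<noteq> 0" "\<chi> x \<noteq> 1"
  shows "(\<Sum>y\<in>E m. \<chi> y) = 0"
proof -
  obtain z where z: "z \<in> E m" "x * z = e" using E_inverse[OF assms(1,2)] by blast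
  have "bij_betw (\<lambda>y. x * y) (E m) (E m)"
  proof (rule bij_betw_byWitness[where f' = "\<lambda>y. z * y"])
    have "z * (x * y) = (x * z) * y" "x * (z * y) = (x * z) * y" for y by (simp_all only: mult_ac)
    then show "\<forall>y\<in>E m. z * (x * y) = y" "\<forall>y\<in>E m. x * (z * y) = y"
      unfolding z(2) using E_L L_e(2) by auto
  qed (auto intro: E_mult assms z)
  then have "(\<Sum>y\<in>E m. \<chi> y) = (\<Sum>y\<in>E m. \<chi> (x * y))" by (rule sum.reindex_bij_betw[symmetric])
  also have "\<dots> = \<chi> x * (\<Sum>y\<in>E m. \<chi> y)"
    using assms by (simp add: chi_mult sum_distrib_left)
  finally show ?thesis using assms(3) by simp
qed

lemma sum_chi_psi: "(\<Sum>(\<zeta>, c)\<in>(E m - {0}) \<times> K. \<chi> \<zeta> * \<psi> c) = 0"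
proof -
  have "(\<Sum>(\<zeta>, c)\<in>(E m - {0}) \<times> K. \<chi> \<zeta> * \<psi> c) = (\<Sum>\<zeta>\<in>E m - {0}. \<chi> \<zeta>) * (\<Sum>c\<in>K. \<psi> c)"
    by (simp add: sum.cartesian_product[symmetric] sum_product)
  moreover have "(\<Sum>\<zeta>\<in>E m - {0}. \<chi> \<zeta>) = 0" if "\<chi> 0 = 0" "\<exists>x\<in>E m. x \<noteq> 0 \<and> \<chi> x \<noteq> 1"
    using that sum_chi finite_E[OF m_pos] by (auto simp: sum_diff1)
  moreover have "(\<Sum>c\<in>K. \<psi> c) = 0" if "\<exists>x\<in>K. \<psi> x \<noteq> 1" using that sum_psi by blast
  ultimately show ?thesis using nontrivial by (elim disjE) simp_all
qed

definition frob :: "'r \<Rightarrow> 'r" where "frob x = x ^ q"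

lemma frob_iterate: "(frob ^^ j) x = x ^ (q ^ j)"
  by (induction j) (simp_all add: frob_def power_mult[symmetric] mult.commute)

lemma inj_frob: "inj_on frob L"
  using frob_inj[of _ _ 1] by (auto intro!: inj_onI simp: frob_def)

lemma frob_L: "frob ` L \<subseteq> L"
  by (auto simp: frob_def L_power)

lemma frob_points: "{t\<in>L. (frob ^^ r) t = t} = E r"
  by (simp add: E_def frob_iterate)

text \<open>The value at \<theta> of the monic polynomial with factors X + t. Multiplying by
  \<open>e\<close> turns the empty product into the unit of \<open>L\<close>.\<close>

definition theta_value :: "'r multiset \<Rightarrow> 'r" where
  "theta_value D = e * (\<Prod>t\<in>#D. \<theta> + t)"

text \<open>This is \<Lambda> of the product of the X + t, the sum of \<open>D\<close> being its
  coefficient below the leading one.\<close>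

definition Lambda :: "'r multiset \<Rightarrow> complex" where
  "Lambda D = \<chi> (theta_value D) * \<psi> (\<Sum>\<^sub># D)"

lemma theta_value_frob:
  assumes "set_mset D \<subseteq> L"
  shows "theta_value D ^ (q ^ m) = theta_value (image_mset (\<lambda>t. t ^ (q ^ m)) D)"
  using assms
proof (induction D)
  case (add t D)
  have "theta_value (add_mset t D) ^ (q ^ m) = (\<theta> + t) ^ (q ^ m) * theta_value D ^ (q ^ m)"
    by (simp add: theta_value_def power_mult_distrib mult.left_commute)
  also have "(\<theta> + t) ^ (q ^ m) = \<theta> + t ^ (q ^ m)"
    using theta_E by (simp add: frob_add theta_L E_def)
  finally show ?case using add by (simp add: theta_value_def mult.left_commute)
qed (simp add: theta_value_def)

lemma sum_mset_frob:
  assumes "set_mset D \<subseteq> L"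
  shows "(\<Sum>\<^sub># D) ^ q = \<Sum>\<^sub># (image_mset frob D)"
  using assms
proof (induction D)
  case (add t D)
  then show ?case using frob_add[of t "\<Sum>\<^sub># D" 1] by (simp add: frob_def)
qed (simp add: power_0_left)

lemma sum_mset_L: "set_mset D \<subseteq> L \<Longrightarrow> \<Sum>\<^sub># D \<in> L"
  by (induction D) (auto intro: L_add)

lemma image_mset_funpow: "image_mset f D = D \<Longrightarrow> image_mset (f ^^ j) D = D"
  by (induction j) (auto simp: image_mset.compositionality[symmetric] simp del: image_mset.compositionality)

text \<open>Frobenius permutes the points of a stable multiset. It may move \<theta>, but its
  \<open>m\<close>-th iterate does not, so the value lies in \<open>E m\<close>; the sum is fixed by
  Frobenius itself.\<close>

lemma stable_values:
  assumes "D \<in> stable_msets frob L n"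
  shows "theta_value D \<in> E m" "\<Sum>\<^sub># D \<in> K"
proof -
  have D: "set_mset D \<subseteq> L" "image_mset frob D = D" using assms by (auto simp: stable_msets_def)
  have "(frob ^^ m) = (\<lambda>t. t ^ (q ^ m))" by (rule ext) (rule frob_iterate)
  then have "image_mset (\<lambda>t. t ^ (q ^ m)) D = D" using image_mset_funpow[OF D(2), of m] by simp
  then show "theta_value D \<in> E m"
    using theta_value_frob[OF D(1)] by (simp add: E_def) (simp add: theta_value_def L_multR)
  show "\<Sum>\<^sub># D \<in> K"
    using sum_mset_frob[OF D(1)] D(2) sum_mset_L[OF D(1)] by (simp add: K_eq_E1 E_def)
qed

lemma Lambda_mult:
  assumes "A \<in> stable_msets frob L i" "B \<in> stable_msets frob L j"
  shows "Lambda (A + B) = Lambda A * Lambda B"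
proof -
  have "theta_value (A + B) = theta_value A * theta_value B"
    using idem by (simp add: theta_value_def mult_ac) (metis mult.assoc)
  then show ?thesis
    using stable_values[OF assms(1)] stable_values[OF assms(2)]
    by (simp add: Lambda_def chi_mult psi_add)
qed

text \<open>The sum called \<open>S r\<close> in the overview; the points of \<open>E r\<close> are
  those fixed by the \<open>r\<close>-th iterate of \<open>frob\<close>.\<close>

definition point_sum :: "nat \<Rightarrow> complex" where
  "point_sum r = (\<Sum>t\<in>E r. Lambda (orbit_mset frob r t))"

lemma point_sum_1: "point_sum 1 = (\<Sum>t\<in>K. \<chi> (\<theta> + t) * \<psi> t)"
proof -
  have "e * (\<theta> + t) = \<theta> + t" if "t \<in> E 1" for t
    using that by (simp add: L_e L_add theta_L E_L)
  then show ?thesis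
    by (auto simp: point_sum_def Lambda_def K_eq_E1 theta_value_def orbit_mset_Suc numeral_eq_Suc intro!: sum.cong)
qed

text \<open>The first \<nu> conjugates of \<open>t\<close> give the value h of
  \<open>norm_poly\<close> and the other \<nu> give \<open>h ^ P\<close>, because
  \<open>\<theta> ^ P = \<theta>\<close>. The trace polynomial is evaluated at
  \<open>t + \<theta>\<close>, which adds the powers \<open>\<theta> ^ (q ^ j)\<close>.\<close>

lemma orbit_values:
  assumes t: "t \<in> L" and \<nu>: "m dvd \<nu>" "\<nu> > 0" and P: "P = q ^ \<nu>" and n: "n = 2 * \<nu>"
  shows "theta_value (orbit_mset frob n t) = poly (norm_poly \<nu>) (t + \<theta>) * poly (norm_poly \<nu>) (t + \<theta>) ^ P"
    and "\<Sum>\<^sub># (orbit_mset frob n t) + (\<Sum>j<n. \<theta> ^ (q ^ j))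
       = poly (trace_poly \<nu>) (t + \<theta>) + poly (trace_poly \<nu>) (t + \<theta>) ^ P"
proof -
  have "j \<in> {..<\<nu>} \<union> (\<lambda>j. j + \<nu>) ` {..<\<nu>}" if "j < n" for j
    using that by (cases "j < \<nu>") (auto simp: n image_iff intro!: bexI[of _ "j - \<nu>"])
  then have split: "{..<n} = {..<\<nu>} \<union> (\<lambda>j. j + \<nu>) ` {..<\<nu>}" "{..<\<nu>} \<inter> (\<lambda>j. j + \<nu>) ` {..<\<nu>} = {}"
    by (auto simp: n)
  have inj: "inj_on (\<lambda>j. j + \<nu>) {..<\<nu>}" by simp
  have thP: "\<theta> ^ P = \<theta>" using theta_fixed_iff[of \<nu>] \<nu>(1) P by simp
  define h where "h = poly (norm_poly \<nu>) (t + \<theta>)"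
  have factor: "(t + \<theta>) ^ (q ^ j) + (\<theta> - \<theta> ^ (q ^ j)) = \<theta> + t ^ (q ^ j)" for j
    using frob_add[OF t, of \<theta> j] by simp
  have h: "h = (\<Prod>j<\<nu>. \<theta> + t ^ (q ^ j))"
    unfolding h_def norm_poly_def poly_prod
    by (intro prod.cong) (simp_all add: poly_monom factor[symmetric] del: factor)
  have hL: "h \<in> L" unfolding h_def using t \<nu> by (intro poly_norm_poly_L L_add theta_L) auto
  have "h ^ P = (\<Prod>j<\<nu>. (\<theta> + t ^ (q ^ j)) ^ P)" by (simp add: h prod_power_distrib)
  also have "\<dots> = (\<Prod>j<\<nu>. \<theta> + t ^ (q ^ (j + \<nu>)))"
    using thP unfolding P by (intro prod.cong) (simp_all add: frob_add theta_L power_mult[symmetric] power_add[symmetric])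
  finally have "h * h ^ P = (\<Prod>j<n. \<theta> + t ^ (q ^ j))"
    using inj by (subst split(1), subst prod.union_disjoint) (simp_all add: split(2) prod.reindex h)
  moreover have "theta_value (orbit_mset frob n t) = e * (\<Prod>j<n. \<theta> + t ^ (q ^ j))"
    by (simp add: theta_value_def orbit_mset_def frob_iterate image_mset.compositionality comp_def prod_unfold_prod_mset)
  ultimately show "theta_value (orbit_mset frob n t) = poly (norm_poly \<nu>) (t + \<theta>) * poly (norm_poly \<nu>) (t + \<theta>) ^ P"
    using L_e(2)[OF L_multR[OF hL], of "h ^ P"] by (simp add: h_def)
  define v where "v = poly (trace_poly \<nu>) (t + \<theta>)"
  have v: "v = (\<Sum>j<\<nu>. t ^ (q ^ j) + \<theta> ^ (q ^ j))"
    unfolding v_def trace_poly_def poly_sum by (simp add: poly_monom frob_add t)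
  have "v ^ P = (\<Sum>j<\<nu>. (t ^ (q ^ j) + \<theta> ^ (q ^ j)) ^ P)"
    unfolding v P by (rule frob_sum) (auto intro!: L_add L_power t theta_L)
  also have "\<dots> = (\<Sum>j<\<nu>. t ^ (q ^ (j + \<nu>)) + \<theta> ^ (q ^ (j + \<nu>)))"
    unfolding P by (intro sum.cong) (simp_all add: frob_add L_power t power_mult[symmetric] power_add[symmetric])
  finally have "v + v ^ P = (\<Sum>j<n. t ^ (q ^ j) + \<theta> ^ (q ^ j))"
    using inj by (subst split(1), subst sum.union_disjoint) (simp_all add: split(2) sum.reindex v)
  moreover have "\<Sum>\<^sub># (orbit_mset frob n t) = (\<Sum>j<n. t ^ (q ^ j))"
    by (simp add: orbit_mset_def frob_iterate sum_unfold_sum_mset)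
  ultimately show "\<Sum>\<^sub># (orbit_mset frob n t) + (\<Sum>j<n. \<theta> ^ (q ^ j))
       = poly (trace_poly \<nu>) (t + \<theta>) + poly (trace_poly \<nu>) (t + \<theta>) ^ P"
    by (simp add: v_def sum.distrib)
qed

text \<open>The \<open>d q\<close> pairs in \<open>Y\<close> have fibres of size at most
  \<open>M\<close>, which is P^2 / (d q) + O(P); hence \<open>card Y * M\<close> exceeds
  \<open>card (E n) = P * P\<close> by O(P) only, with a constant independent of
  \<open>k\<close>.\<close>

lemma point_sum_bound:
  "\<exists>C. \<forall>k>2. cmod (point_sum (2 * (m * k))) \<le> C * real q ^ (m * k)"
proof -
  define d where "d = q ^ m - 1"
  have qm: "q ^ m > 1" using q_power_gt1 m_pos by simp
  then have d0: "d > 0" by (simp add: d_def)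
  \<comment> \<open>The first summand bounds the excess of \<open>card Y * M\<close> over
    \<open>P * P\<close>, divided by \<open>P\<close>; the second accounts for the points at which
    the value at \<theta> is zero.\<close>
  define C where "C = real (d * q * (4 * q ^ m + 1) + 2 * q ^ m)"
  have "cmod (point_sum (2 * (m * k))) \<le> C * real q ^ (m * k)" if k: "k > 2" for k
  proof -
    define \<nu> where "\<nu> = m * k"
    define n where "n = 2 * \<nu>"
    define P where "P = q ^ \<nu>"
    have \<nu>: "m dvd \<nu>" "\<nu> > 0" using m_pos k by (auto simp: \<nu>_def)
    have n0: "n > 0" using \<nu> by (simp add: n_def)
    have QP: "q ^ n = P * P" by (simp add: n_def P_def mult_2 power_add)
    define f where "f t = (theta_value (orbit_mset frob n t), \<Sum>\<^sub># (orbit_mset frob n t))" for t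
    define Y where "Y = (E m - {0}) \<times> K"
    define M where "M = real (P * (P div (d * q) + 4 * q ^ m + 1))"
    have stable: "orbit_mset frob n t \<in> stable_msets frob L n" if t: "t \<in> E n" for t
    proof -
      have "(frob ^^ n) t = t" using t by (simp add: E_def frob_iterate)
      then show ?thesis using E_L[OF t]
        by (auto simp: stable_msets_def orbit_mset_stable mem_orbit_mset frob_iterate L_power)
    qed
    have fin: "finite (E n)" "finite Y" using finite_E m_pos n0 finite_K by (auto simp: Y_def)
    \<comment> \<open>By \<open>orbit_values\<close> the translation by \<theta> carries the fibre
      over (\<zeta>, c) into the point set belonging to \<zeta> and
      \<open>c + \<tau>\<close>.\<close>
    define \<tau> where "\<tau> = (\<Sum>j<n. \<theta> ^ (q ^ j))"
    have \<tau>: "\<tau> \<in> E m" by (simp add: \<tau>_def E_sum E_power theta_E)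
    have fibre: "real (card {t\<in>E n. f t = y}) \<le> M" if "y \<in> Y" for y
    proof -
      obtain \<zeta> c where y: "y = (\<zeta>, c)" "\<zeta> \<in> E m" "\<zeta> \<noteq> 0" "c \<in> K" using \<open>y \<in> Y\<close> by (auto simp: Y_def)
      have c: "c + \<tau> \<in> E m"
        using y(4) \<tau> m_pos by (auto intro!: E_add E_dvd[of c 1 m] simp: K_eq_E1)
      define Z where "Z = {s\<in>L. s ^ (P * P) = s \<and> poly (norm_poly \<nu>) s * poly (norm_poly \<nu>) s ^ P = \<zeta> \<and>
         poly (trace_poly \<nu>) s + poly (trace_poly \<nu>) s ^ P = c + \<tau>}"
      have thn: "\<theta> \<in> E n" using theta_E \<nu> by (auto intro: E_dvd simp: n_def)
      have "Z \<subseteq> E n" by (auto simp: Z_def E_def QP)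
      then have finZ: "finite Z" using fin finite_subset by blast
      have "card {t\<in>E n. f t = y} \<le> card Z"
      proof (rule card_inj_on_le[OF _ _ finZ])
        show "inj_on (\<lambda>t. t + \<theta>) {t\<in>E n. f t = y}" by simp
        show "(\<lambda>t. t + \<theta>) ` {t\<in>E n. f t = y} \<subseteq> Z"
        proof safe
          fix t assume t: "t \<in> E n" "y = f t"
          have "t + \<theta> \<in> E n" by (rule E_add[OF t(1) thn])
          moreover have "\<zeta> = theta_value (orbit_mset frob n t)" "c = \<Sum>\<^sub># (orbit_mset frob n t)"
            using t y by (auto simp: f_def)
          ultimately show "t + \<theta> \<in> Z"
            using orbit_values[OF E_L[OF t(1)] \<nu> P_def n_def]
            by (simp add: Z_def E_def QP[symmetric] \<tau>_def)
        qed
      qed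
      also have "\<dots> \<le> P * (P div (d * q) + 4 * q ^ m + 1)"
        unfolding Z_def by (rule card_norm_trace_le[OF \<nu>_def k d_def P_def y(2,3) c])
      finally show ?thesis unfolding M_def by (rule of_nat_mono)
    qed
    define g where "g = (\<lambda>(\<zeta>, c). \<chi> \<zeta> * \<psi> c)"
    have g_le: "cmod (g (\<zeta>, c)) \<le> 1" if "\<zeta> \<in> E m" "c \<in> K" for \<zeta> c
      using chi_norm[OF that(1)] psi_norm[OF that(2)] by (simp add: g_def norm_mult mult_le_one)
    \<comment> \<open>A vanishing value means that some \<open>t ^ (q ^ j)\<close> is
      \<open>- \<theta>\<close>, so \<open>t\<close> itself lies in \<open>E m\<close>.\<close>
    have U0: "card {t\<in>E n. f t \<notin> Y} \<le> q ^ m"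
    proof -
      have "t \<in> E m" if t: "t \<in> E n" "f t \<notin> Y" for t
      proof -
        have "theta_value (orbit_mset frob n t) = 0"
          using t stable_values[OF stable[OF t(1)]] by (auto simp: f_def Y_def)
        moreover have "theta_value (orbit_mset frob n t) = e * (\<Prod>j<n. \<theta> + t ^ (q ^ j))"
          by (simp add: theta_value_def orbit_mset_def frob_iterate image_mset.compositionality comp_def prod_unfold_prod_mset)
        moreover have "\<theta> + t ^ (q ^ j) \<in> L" for j
          using E_L[OF t(1)] by (intro L_add L_power theta_L) auto
        ultimately obtain j where "\<theta> + t ^ (q ^ j) = 0"
          using L_prod_nonzero[of "{..<n}" "\<lambda>j. \<theta> + t ^ (q ^ j)"] by auto
        then have "t ^ (q ^ j) = - \<theta>" by (simp add: eq_neg_iff_add_eq_0 add.commute)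
        then have "t ^ (q ^ j) \<in> E m" by (simp add: E_minus theta_E)
        then have "(t ^ (q ^ j)) ^ (q ^ m) = t ^ (q ^ j)" by (simp add: E_def)
        moreover have "(t ^ (q ^ m)) ^ (q ^ j) = (t ^ (q ^ j)) ^ (q ^ m)"
          by (simp only: power_mult[symmetric] mult.commute)
        ultimately have "t ^ (q ^ m) = t"
          using E_L[OF t(1)] frob_inj[of "t ^ (q ^ m)" t j] by (simp add: L_power)
        then show ?thesis using E_L[OF t(1)] by (simp add: E_def)
      qed
      then have "card {t\<in>E n. f t \<notin> Y} \<le> card (E m)"
        using finite_E[OF m_pos] by (intro card_mono) auto
      then show ?thesis by (simp add: card_E m_pos)
    qed
    have cardY: "card Y = d * q"
      by (simp add: Y_def card_cartesian_product card_K d_def card_E m_pos finite_E)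
    have "cmod (\<Sum>t\<in>E n. g (f t)) \<le> card Y * M - card (E n) + 2 * card {t\<in>E n. f t \<notin> Y}"
    proof (rule norm_sum_le_of_fibres[OF fin fibre])
      show "cmod (g y) \<le> 1" if "y \<in> Y" for y using that g_le by (auto simp: Y_def)
      show "cmod (g (f t)) \<le> 1" if "t \<in> E n" for t
        using stable_values[OF stable[OF that]] g_le by (auto simp: f_def)
      show "sum g Y = 0" unfolding g_def Y_def by (rule sum_chi_psi)
    qed
    also have "\<dots> \<le> C * real P"
    proof -
      have "d * q * (P * (P div (d * q))) \<le> P * P" by (simp add: mult.left_commute)
      then have "d * q * (P * (P div (d * q) + 4 * q ^ m + 1)) \<le> P * P + d * q * (4 * q ^ m + 1) * P"
        by (simp add: algebra_simps)
      then have 1: "real (d * q) * M \<le> real (P * P) + real (d * q * (4 * q ^ m + 1)) * real P"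
        unfolding M_def of_nat_mult[symmetric] of_nat_add[symmetric] of_nat_le_iff by simp
      have "q ^ m * 1 \<le> q ^ m * P" by (intro mult_le_mono2) (simp add: P_def Suc_le_eq)
      then have 2: "real (q ^ m) \<le> real (q ^ m) * real P"
        unfolding of_nat_mult[symmetric] of_nat_le_iff by simp
      have 3: "real (card {t\<in>E n. f t \<notin> Y}) \<le> real (q ^ m)" using U0 by (rule of_nat_mono)
      have 4: "card (E n) = P * P" by (simp add: card_E n0 QP)
      have "C * real P = real (d * q * (4 * q ^ m + 1)) * real P + 2 * (real (q ^ m) * real P)"
        by (simp add: C_def algebra_simps)
      then show ?thesis using 1 2 3 unfolding cardY 4 by linarith
    qed
    finally show ?thesis
      by (simp add: point_sum_def Lambda_def g_def f_def n_def \<nu>_def P_def)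
  qed
  then show ?thesis by blast
qed

end

section \<open>The L-function\<close>

definition div_poly :: "'r::comm_ring_1 multiset \<Rightarrow> 'r poly" where
  "div_poly D = (\<Prod>t\<in>#D. [:t, 1:])"

lemma div_poly_empty [simp]: "div_poly {#} = 1"
  by (simp add: div_poly_def)

lemma div_poly_add [simp]: "div_poly (add_mset t D) = [:t, 1:] * div_poly D"
  by (simp add: div_poly_def)

lemma coeff_linear_mult:
  "coeff ([:t, 1:] * g) i = t * coeff g i + (if i = 0 then 0 else coeff g (i - 1))"
  for g :: "'r::comm_ring_1 poly"
  by (cases i) simp_all

lemma div_poly_monic: "degree (div_poly D) = size D \<and> coeff (div_poly D) (size D) = 1"
proof (induction D)
  case (add t D)
  have top: "coeff ([:t, 1:] * div_poly D) (Suc (size D)) = 1"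
    using add by (simp only: coeff_linear_mult) (simp add: coeff_eq_0)
  have "degree ([:t, 1:] * div_poly D) \<le> Suc (size D)"
    using add degree_mult_le[of "[:t, 1:]" "div_poly D"] by simp
  moreover have "degree ([:t, 1:] * div_poly D) \<ge> Suc (size D)"
    using top by (intro le_degree) simp
  ultimately show ?case using top by (simp del: mult_pCons_left)
qed simp

lemma coeff_div_poly_sum:
  "D \<noteq> {#} \<Longrightarrow> coeff (div_poly D) (size D - 1) = \<Sum>\<^sub># D"
proof (induction D)
  case (add t D)
  then show ?case
    using div_poly_monic[of D] by (cases "D = {#}") (simp_all add: coeff_linear_mult del: mult_pCons_left)
qed simp

lemma poly_div_poly: "poly (div_poly D) x = (\<Prod>t\<in>#D. x + t)"
  by (induction D) (simp_all add: algebra_simps)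

section \<open>Monic polynomials over K and Frobenius-stable multisets\<close>

context finite_corner
begin

lemma K_E: "x \<in> K \<Longrightarrow> x \<in> E r"
  using E_dvd[of x 1 r] by (simp add: K_eq_E1)

lemma coeff_div_poly_L:
  assumes "set_mset D \<subseteq> L" "i < size D"
  shows "coeff (div_poly D) i \<in> L"
  using assms
proof (induction D arbitrary: i)
  case (add t D)
  show ?case
  proof (cases "i = 0")
    case False
    then have "coeff (div_poly D) (i - 1) \<in> L" using add by simp
    then show ?thesis using add.prems False
      by (simp add: coeff_linear_mult L_add L_multR del: mult_pCons_left)
  qed (use add.prems in \<open>simp add: coeff_linear_mult L_multR del: mult_pCons_left\<close>)
qed simp

text \<open>The top coefficient 1 may lie outside \<open>L\<close>, but additivity of the
  \<open>q\<close>-th power needs only one of the two summands in \<open>L\<close>.\<close>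

lemma coeff_div_poly_frob:
  assumes "set_mset D \<subseteq> L"
  shows "coeff (div_poly (image_mset (\<lambda>t. t ^ q) D)) i = coeff (div_poly D) i ^ q"
  using assms
proof (induction D arbitrary: i)
  case empty
  show ?case by (simp add: coeff_1 power_0_left)
next
  case (add t D)
  have "(t * coeff (div_poly D) i + x) ^ q = (t * coeff (div_poly D) i) ^ q + x ^ q" for x
    using frob_add[of "t * coeff (div_poly D) i" x 1] add.prems by (simp add: L_multR)
  then show ?case
    using add by (simp add: coeff_linear_mult power_mult_distrib power_0_left del: mult_pCons_left)
qed

lemma L_prod_mset_nonzero:
  "(\<And>t. t \<in># D \<Longrightarrow> f t \<in> L \<and> f t \<noteq> 0) \<Longrightarrow> e * (\<Prod>t\<in>#D. f t) \<noteq> 0"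
proof (induction D)
  case (add t D)
  then have "f t * (e * (\<Prod>t\<in>#D. f t)) \<noteq> 0"
    by (subst L_mult_eq_0_iff) (auto intro: L_multR)
  then show ?case by (simp add: mult.left_commute)
qed (simp add: e_nonzero)

text \<open>The product over \<open>D'\<close> vanishes at \<open>- t\<close>; as nonzero factors in
  \<open>L\<close> cannot give that, one factor is zero, so \<open>t\<close> occurs in
  \<open>D'\<close> and can be cancelled.\<close>

lemma div_poly_inj:
  assumes "set_mset D \<subseteq> L" "set_mset D' \<subseteq> L" "div_poly D = div_poly D'"
  shows "D = D'"
  using assms
proof (induction D arbitrary: D')
  case empty
  then have "size D' = 0" using div_poly_monic[of D'] by (metis div_poly_empty degree_1)
  then show ?case by simp
next
  case (add t D)
  have "poly (div_poly D') (- t) = 0" using add.prems(3)[symmetric] by simp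
  then have "e * (\<Prod>t'\<in>#D'. - t + t') = 0" by (simp add: poly_div_poly)
  moreover have "- t + t' \<in> L" if "t' \<in># D'" for t'
    using add.prems(1,2) that by (intro L_add L_minus) auto
  ultimately obtain t' where "t' \<in># D'" "- t + t' = 0"
    using L_prod_mset_nonzero[of D' "\<lambda>t'. - t + t'"] by blast
  then have "t \<in># D'" by (simp add: add_eq_0_iff)
  then obtain D'' where D'': "D' = add_mset t D''" using multi_member_split by metis
  have "div_poly D = div_poly D''"
    by (rule linear_mult_left_cancel[of t]) (use add.prems(3) in \<open>simp only: D'' div_poly_add\<close>)
  then have "D = D''" using add.prems D'' by (intro add.IH) auto
  then show ?case by (simp add: D'')
qed

text \<open>The leading coefficient is the 1 of the ring, as for \<open>div_poly\<close>; only the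
  lower ones lie in \<open>K\<close>, whose unit is \<open>e\<close>.\<close>

definition monics :: "nat \<Rightarrow> 'r poly set" where
  "monics n = {f. coeff f n = 1 \<and> (\<forall>i>n. coeff f i = 0) \<and> (\<forall>i<n. coeff f i \<in> K)}"

lemma K_fixed: "x \<in> K \<Longrightarrow> x ^ q = x"
  by (simp add: K_eq_E1 E_def)

text \<open>Stability of the multiset makes the lower coefficients fixed by Frobenius, that is
  elements of \<open>K = E 1\<close>. Conversely a monic polynomial over \<open>K\<close> splits,
  and since Frobenius fixes its coefficients, uniqueness of the factors makes the multiset
  stable.\<close>

lemma bij_div_poly: "bij_betw div_poly (stable_msets (\<lambda>t. t ^ q) L n) (monics n)"
proof (rule bij_betwI')
  fix D D' assume "D \<in> stable_msets (\<lambda>t. t ^ q) L n" "D' \<in> stable_msets (\<lambda>t. t ^ q) L n"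
  then show "(div_poly D = div_poly D') = (D = D')"
    using div_poly_inj by (auto simp: stable_msets_def)
next
  fix D assume "D \<in> stable_msets (\<lambda>t. t ^ q) L n"
  then have D: "set_mset D \<subseteq> L" "size D = n" "image_mset (\<lambda>t. t ^ q) D = D"
    by (auto simp: stable_msets_def)
  have "coeff (div_poly D) i \<in> K" if "i < n" for i
    using coeff_div_poly_frob[OF D(1), of i] coeff_div_poly_L[OF D(1), of i] D that
    by (simp add: K_eq_E1 E_def)
  then show "div_poly D \<in> monics n"
    using div_poly_monic[of D] D(2) by (auto simp: monics_def coeff_eq_0)
next
  fix f assume f: "f \<in> monics n"
  \<comment> \<open>\<open>split_poly\<close> asks for coefficients in \<open>L\<close>. Multiplying
    by \<open>e\<close> changes only the leading coefficient, so \<open>f\<close> can be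
    recovered.\<close>
  define p where "p = smult e f"
  have p: "smult e p = p" by (simp add: p_def idem)
  have pn: "coeff p n = e" using f by (simp add: p_def monics_def)
  then have p0: "p \<noteq> 0" using e_nonzero by auto
  have "degree p = n"
    using pn e_nonzero f by (intro antisym degree_le le_degree) (auto simp: p_def monics_def)
  then obtain D where D: "set_mset D \<subseteq> L" "size D = n" "p = smult e (div_poly D)"
    using split_poly[OF p p0] pn by (auto simp: div_poly_def)
  have f_eq: "f = div_poly D"
  proof (rule poly_eqI)
    fix i
    consider "i < n" | "i = n" | "i > n" by linarith
    then show "coeff f i = coeff (div_poly D) i"
    proof cases
      case 1
      have "e * coeff f i = e * coeff (div_poly D) i"
        using arg_cong[OF D(3), of "\<lambda>p. coeff p i"] by (simp add: p_def)
      moreover have "coeff f i \<in> L" using 1 f K_L by (auto simp: monics_def)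
      moreover have "coeff (div_poly D) i \<in> L" using 1 coeff_div_poly_L[OF D(1), of i] D(2) by simp
      ultimately show ?thesis by (simp add: L_e)
    qed (use f div_poly_monic[of D] D(2) in \<open>auto simp: monics_def coeff_eq_0\<close>)
  qed
  have "div_poly (image_mset (\<lambda>t. t ^ q) D) = div_poly D"
  proof (rule poly_eqI)
    fix i
    have "coeff f i ^ q = coeff f i"
      using f by (cases i n rule: linorder_cases) (auto simp: monics_def K_fixed power_0_left)
    then show "coeff (div_poly (image_mset (\<lambda>t. t ^ q) D)) i = coeff (div_poly D) i"
      by (simp add: coeff_div_poly_frob[OF D(1)] f_eq)
  qed
  then have "image_mset (\<lambda>t. t ^ q) D = D"
    using D(1) by (intro div_poly_inj) (auto simp: L_power)
  then show "\<exists>D\<in>stable_msets (\<lambda>t. t ^ q) L n. f = div_poly D"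
    using D f_eq by (auto simp: stable_msets_def)
qed

lemma finite_monics: "finite (monics n)"
proof (rule inj_on_finite)
  show "inj_on (\<lambda>f. restrict (coeff f) {..<n}) (monics n)"
  proof (rule inj_onI)
    fix f g assume fg: "f \<in> monics n" "g \<in> monics n" "restrict (coeff f) {..<n} = restrict (coeff g) {..<n}"
    show "f = g"
    proof (rule poly_eqI)
      fix i
      show "coeff f i = coeff g i"
        using fg(1,2) fun_cong[OF fg(3), of i]
        by (cases i n rule: linorder_cases) (auto simp: monics_def)
    qed
  qed
  show "(\<lambda>f. restrict (coeff f) {..<n}) ` monics n \<subseteq> PiE {..<n} (\<lambda>_. K)"
    by (rule image_subsetI) (auto simp: restrict_PiE_iff monics_def)
  show "finite (PiE {..<n} (\<lambda>_. K))" using finite_K by (intro finite_PiE) auto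
qed

end

section \<open>The powers of \<theta> as a basis of the extension\<close>

context generated_corner
begin

lemma inj_conjugates: "inj_on (\<lambda>j. \<theta> ^ (q ^ j)) {..<m}"
proof (rule linorder_inj_onI)
  fix i j assume ij: "i < j" "i \<in> {..<m}" "j \<in> {..<m}"
  show "\<theta> ^ (q ^ i) \<noteq> \<theta> ^ (q ^ j)"
  proof
    assume eq: "\<theta> ^ (q ^ i) = \<theta> ^ (q ^ j)"
    have "(\<theta> ^ (q ^ (j - i))) ^ (q ^ i) = \<theta> ^ (q ^ j)"
      using ij by (simp add: power_mult[symmetric] power_add[symmetric])
    then have "\<theta> ^ (q ^ (j - i)) = \<theta>"
      using eq frob_inj[of "\<theta> ^ (q ^ (j - i))" \<theta> i] by (simp add: L_power theta_L)
    moreover have "0 < j - i" "j - i < m" using ij by auto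
    ultimately show False using conj_distinct by blast
  qed
qed auto

text \<open>Frobenius fixes the coefficients, so with \<theta> all its \<open>m\<close> distinct
  conjugates would be roots, too many for the degree.\<close>

lemma poly_theta_nonzero:
  assumes K: "\<And>i. coeff g i \<in> K" and deg: "\<And>i. i \<ge> m \<Longrightarrow> coeff g i = 0" and g: "g \<noteq> 0"
  shows "poly g \<theta> \<noteq> 0"
proof
  assume zero: "poly g \<theta> = 0"
  have e: "smult e g = g" using K K_L by (auto simp: smult_e_iff)
  have root: "poly g (\<theta> ^ (q ^ j)) = 0" for j
  proof -
    have "coeff g i * (\<theta> ^ (q ^ j)) ^ i = (coeff g i * \<theta> ^ i) ^ (q ^ j)" for i
    proof -
      have "coeff g i ^ (q ^ j) = coeff g i"
        using K[of i] E_iterate[of "coeff g i" 1 j] by (simp add: K_eq_E1)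
      moreover have "(\<theta> ^ (q ^ j)) ^ i = (\<theta> ^ i) ^ (q ^ j)"
        by (simp only: power_mult[symmetric] mult.commute)
      ultimately show ?thesis by (simp add: power_mult_distrib)
    qed
    then have "poly g (\<theta> ^ (q ^ j)) = (\<Sum>i\<le>degree g. (coeff g i * \<theta> ^ i) ^ (q ^ j))"
      by (simp add: poly_altdef)
    also have "\<dots> = (poly g \<theta>) ^ (q ^ j)"
      unfolding poly_altdef using coeff_L[OF e] by (intro frob_sum[symmetric]) (auto intro: L_multR)
    finally show ?thesis using zero by simp
  qed
  have "m = card ((\<lambda>j. \<theta> ^ (q ^ j)) ` {..<m})" using inj_conjugates by (simp add: card_image)
  also have "\<dots> \<le> card {x\<in>L. poly g x = 0}"
    using card_roots_le[OF e g] root by (intro card_mono) (auto simp: theta_L L_power)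
  also have "\<dots> \<le> degree g" using card_roots_le[OF e g] by simp
  also have "\<dots> < m" using g deg[of "degree g"] by (cases "degree g < m") auto
  finally show False by simp
qed

text \<open>Spanning by counting: the \<open>q ^ m\<close> combinations are distinct by
  \<open>poly_theta_nonzero\<close>, and \<open>E m\<close> has just as many elements.\<close>

lemma power_basis:
  assumes "y \<in> E m"
  shows "\<exists>a. (\<forall>i<m. a i \<in> K) \<and> y = (\<Sum>i<m. a i * \<theta> ^ i)"
proof -
  define F where "F a = (\<Sum>i<m. a i * \<theta> ^ i)" for a :: "nat \<Rightarrow> 'r"
  have "inj_on F (PiE {..<m} (\<lambda>_. K))"
  proof (rule inj_onI)
    fix a b assume ab: "a \<in> PiE {..<m} (\<lambda>_. K)" "b \<in> PiE {..<m} (\<lambda>_. K)" "F a = F b"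
    define g where "g = (\<Sum>i<m. monom (a i - b i) i)"
    have g: "coeff g i = (if i < m then a i - b i else 0)" for i
      by (simp add: g_def coeff_sum)
    have gK: "coeff g i \<in> K" for i using ab(1,2) by (auto simp: g K_zero intro!: K_diff)
    have "poly g \<theta> = F a - F b"
      by (simp add: g_def poly_sum poly_monom F_def left_diff_distrib sum_subtractf)
    then have "g = 0" using poly_theta_nonzero[OF gK] ab(3) by (auto simp: g)
    then have "a i = b i" if "i < m" for i using g[of i] that by simp
    then show "a = b" using ab(1,2) by (intro PiE_ext) auto
  qed
  moreover have sub: "F ` PiE {..<m} (\<lambda>_. K) \<subseteq> E m"
  proof (rule image_subsetI)
    fix a assume a: "a \<in> PiE {..<m} (\<lambda>_. K)"
    have "a i * \<theta> ^ i \<in> E m" if i: "i < m" for i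
    proof -
      have ai: "a i \<in> E m" using a i by (auto intro: K_E)
      show ?thesis
        by (cases "i = 0") (use ai in \<open>auto intro: E_mult E_power theta_E\<close>)
    qed
    then show "F a \<in> E m" by (auto simp: F_def intro: E_sum)
  qed
  ultimately have "F ` PiE {..<m} (\<lambda>_. K) = E m"
    using finite_E[OF m_pos] by (intro card_subset_eq) (auto simp: card_image card_PiE card_K card_E m_pos)
  then obtain a where "a \<in> PiE {..<m} (\<lambda>_. K)" "y = F a" using assms by blast
  then show ?thesis by (auto simp: F_def intro!: exI[of _ a])
qed

end

section \<open>Coefficients of the L-function and the bound for its reciprocal roots\<close>

context character_corner
begin

lemma frob_eq: "frob = (\<lambda>t. t ^ q)"
  by (simp add: frob_def fun_eq_iff)

lemma finite_stable: "finite (stable_msets frob L n)"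
  using bij_betw_finite[OF bij_div_poly[of n]] finite_monics by (simp add: frob_eq)

lemma theta_value_div_poly: "theta_value D = e * poly (div_poly D) \<theta>"
  by (simp add: theta_value_def poly_div_poly)

definition L_coeff :: "nat \<Rightarrow> complex" where
  "L_coeff n = (\<Sum>D\<in>stable_msets frob L n. Lambda D)"

lemma L_coeff_monics:
  assumes "n > 0"
  shows "L_coeff n = (\<Sum>f\<in>monics n. \<chi> (e * poly f \<theta>) * \<psi> (coeff f (n - 1)))"
proof -
  have "Lambda D = \<chi> (e * poly (div_poly D) \<theta>) * \<psi> (coeff (div_poly D) (n - 1))"
    if "D \<in> stable_msets frob L n" for D
  proof -
    have "size D = n" "D \<noteq> {#}" using that assms by (auto simp: stable_msets_def)
    then show ?thesis using coeff_div_poly_sum[of D] by (simp add: Lambda_def theta_value_div_poly)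
  qed
  then have "L_coeff n = (\<Sum>D\<in>stable_msets frob L n. \<chi> (e * poly (div_poly D) \<theta>) * \<psi> (coeff (div_poly D) (n - 1)))"
    unfolding L_coeff_def by (rule sum.cong[OF HOL.refl])
  also have "\<dots> = (\<Sum>f\<in>monics n. \<chi> (e * poly f \<theta>) * \<psi> (coeff f (n - 1)))"
    using bij_div_poly[of n] unfolding frob_eq[symmetric] by (rule sum.reindex_bij_betw)
  finally show ?thesis .
qed

lemma monics_value_E:
  assumes "f \<in> monics n"
  shows "e * poly f \<theta> \<in> E m"
proof -
  obtain D where "D \<in> stable_msets frob L n" "f = div_poly D"
    using bij_div_poly[of n] assms unfolding bij_betw_def frob_eq[symmetric] by blast
  then show ?thesis using stable_values(1)[of D n] by (simp add: theta_value_div_poly)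
qed

lemma bij_monics_shift:
  assumes "\<And>i. coeff g i \<in> K" "\<And>i. i \<ge> n \<Longrightarrow> coeff g i = 0"
  shows "bij_betw (\<lambda>f. f + g) (monics n) (monics n)"
proof (rule bij_betw_byWitness[where f' = "\<lambda>f. f - g"])
  show "(\<lambda>f. f + g) ` monics n \<subseteq> monics n" "(\<lambda>f. f - g) ` monics n \<subseteq> monics n"
    using assms(2) K_add[OF _ assms(1)] K_diff[OF _ assms(1)] by (auto simp: monics_def)
qed simp_all

text \<open>As \<open>n - 1 \<ge> m\<close>, adding a polynomial of degree less than
  \<open>m\<close> changes the value at \<theta> by an arbitrary element of \<open>E m\<close> and
  leaves the coefficient at \<open>n - 1\<close> alone. So the arguments of \<chi> and \<psi> can be
  varied independently, and orthogonality for a nontrivial one gives zero.\<close>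

lemma L_coeff_eq_0:
  assumes n: "n > m"
  shows "L_coeff n = 0"
proof -
  define T where "T f = \<chi> (e * poly f \<theta>) * \<psi> (coeff f (n - 1))" for f
  have L_T: "L_coeff n = sum T (monics n)" using n by (simp add: L_coeff_monics T_def)
  have low: "\<exists>g. (\<forall>i. coeff g i \<in> K) \<and> (\<forall>i\<ge>m. coeff g i = 0) \<and> poly g \<theta> = y" if y: "y \<in> E m" for y
  proof -
    obtain a where a: "\<And>i. i < m \<Longrightarrow> a i \<in> K" "y = (\<Sum>i<m. a i * \<theta> ^ i)"
      using power_basis[OF y] by blast
    show ?thesis
      by (rule exI[of _ "\<Sum>i<m. monom (a i) i"])
        (use a in \<open>auto simp: coeff_sum poly_sum poly_monom K_zero\<close>)
  qed
  show ?thesis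
  proof (cases "\<exists>x\<in>K. \<psi> x \<noteq> 1")
    case True
    then obtain c where c: "c \<in> K" "\<psi> c \<noteq> 1" by blast
    have "c \<in> E m" using c(1) by (rule K_E)
    then have "- (c * \<theta> ^ (n - 1)) \<in> E m"
      using n m_pos by (intro E_minus E_mult E_power theta_E) auto
    from low[OF this] obtain g where g: "\<And>i. coeff g i \<in> K" "\<And>i. i \<ge> m \<Longrightarrow> coeff g i = 0"
      "poly g \<theta> = - (c * \<theta> ^ (n - 1))" by blast
    \<comment> \<open>\<open>g\<close> cancels the value of the monomial at \<theta>, so the shift
      by \<open>g'\<close> only adds \<open>c\<close> to the coefficient at \<open>n - 1\<close> and
      multiplies the sum by \<open>\<psi> c\<close>.\<close>
    define g' where "g' = g + monom c (n - 1)"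
    have "bij_betw (\<lambda>f. f + g') (monics n) (monics n)"
      by (rule bij_monics_shift) (use g(1,2) c n in \<open>auto simp: g'_def intro!: K_add K_zero\<close>)
    then have "sum T (monics n) = (\<Sum>f\<in>monics n. T (f + g'))" by (rule sum.reindex_bij_betw[symmetric])
    also have "\<dots> = (\<Sum>f\<in>monics n. T f * \<psi> c)"
    proof (rule sum.cong[OF HOL.refl])
      fix f assume f: "f \<in> monics n"
      have "coeff (f + g') (n - 1) = coeff f (n - 1) + c" using g(2)[of "n - 1"] n by (simp add: g'_def)
      moreover have "coeff f (n - 1) \<in> K" using f n by (simp add: monics_def)
      moreover have "poly (f + g') \<theta> = poly f \<theta>" using g(3) by (simp add: g'_def poly_monom)
      ultimately show "T (f + g') = T f * \<psi> c" using c by (simp add: T_def psi_add)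
    qed
    also have "\<dots> = sum T (monics n) * \<psi> c" by (simp add: sum_distrib_right)
    finally show ?thesis using c(2) by (simp add: L_T)
  next
    case False
    then obtain x where x: "x \<in> E m" "x \<noteq> 0" "\<chi> x \<noteq> 1" using nontrivial by blast
    have shift: "sum T (monics n) = (\<Sum>f\<in>monics n. \<chi> (e * poly f \<theta> + y) * \<psi> (coeff f (n - 1)))" if y: "y \<in> E m" for y
    proof -
      obtain g where g: "\<And>i. coeff g i \<in> K" "\<And>i. i \<ge> m \<Longrightarrow> coeff g i = 0" "poly g \<theta> = y"
        using low[OF y] by blast
      have "bij_betw (\<lambda>f. f + g) (monics n) (monics n)"
        by (rule bij_monics_shift) (use g n in auto)
      then have "sum T (monics n) = (\<Sum>f\<in>monics n. T (f + g))" by (rule sum.reindex_bij_betw[symmetric])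
      then show ?thesis
        using g(2)[of "n - 1"] n L_e(2)[OF E_L[OF y]] by (simp add: T_def g(3) distrib_left)
    qed
    have chi_shift: "(\<Sum>y\<in>E m. \<chi> (z + y)) = 0" if z: "z \<in> E m" for z
    proof -
      have "bij_betw (\<lambda>y. z + y) (E m) (E m)"
        by (rule bij_betw_byWitness[where f' = "\<lambda>y. y - z"]) (auto intro: E_add E_diff z)
      from sum.reindex_bij_betw[OF this, of \<chi>] show ?thesis using sum_chi[OF x] by simp
    qed
    \<comment> \<open>Averaging the shifted sums over all \<open>y\<close> produces, for each
      \<open>f\<close>, a full sum of \<chi> over \<open>E m\<close>.\<close>
    have "of_nat (card (E m)) * sum T (monics n) = (\<Sum>y\<in>E m. sum T (monics n))" by simp
    also have "\<dots> = (\<Sum>y\<in>E m. \<Sum>f\<in>monics n. \<chi> (e * poly f \<theta> + y) * \<psi> (coeff f (n - 1)))"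
      by (intro sum.cong HOL.refl shift)
    also have "\<dots> = (\<Sum>f\<in>monics n. (\<Sum>y\<in>E m. \<chi> (e * poly f \<theta> + y)) * \<psi> (coeff f (n - 1)))"
      by (subst sum.swap) (simp add: sum_distrib_right)
    also have "\<dots> = 0" by (simp add: chi_shift monics_value_E)
    finally show ?thesis by (simp add: L_T card_E m_pos)
  qed
qed

lemma L_coeff_0: "L_coeff 0 = 1"
proof -
  have "stable_msets frob L 0 = {{#}}" by (auto simp: stable_msets_def)
  then show ?thesis by (simp add: L_coeff_def Lambda_def theta_value_def chi_e psi_0)
qed

theorem character_sum_bound:
  "cmod (\<Sum>t\<in>K. \<chi> (\<theta> + t) * \<psi> t) \<le> real m * sqrt (real q)"
proof -
  have rec: "of_nat n * L_coeff n = (\<Sum>r=1..n. point_sum r * L_coeff (n - r))" for n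
    using log_derivative_identity[of frob L Lambda n, OF inj_frob frob_L finite_stable _ Lambda_mult]
    by (simp add: frob_points finite_E L_coeff_def point_sum_def)
  obtain w where w: "\<And>n. n > 0 \<Longrightarrow> point_sum n = - (\<Sum>i<m. w i ^ n)"
    using power_sums_of_recurrence[of L_coeff m point_sum] L_coeff_0 L_coeff_eq_0 rec by blast
  obtain C where C: "\<And>k. k > 2 \<Longrightarrow> cmod (point_sum (2 * (m * k))) \<le> C * real q ^ (m * k)"
    using point_sum_bound by blast
  have "cmod (w i) \<le> sqrt (real q)" if i: "i < m" for i
  proof -
    \<comment> \<open>The estimate is available for exponents \<open>2 * (m * k)\<close> only, that
      is for power sums of the \<open>w i ^ (2 * m)\<close>; extracting the root afterwards loses
      nothing.\<close>
    have "cmod (w i ^ (2 * m)) \<le> real q ^ m"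
    proof (rule norm_le_of_power_sums_bound[where z = "\<lambda>i. w i ^ (2 * m)" and kmin = 3 and C = C, OF _ _ i])
      fix k :: nat assume k: "k \<ge> 3"
      have "(\<Sum>i<m. (w i ^ (2 * m)) ^ k) = - point_sum (2 * (m * k))"
        using w[of "2 * (m * k)"] m_pos k by (simp add: power_mult[symmetric] mult.assoc)
      then show "cmod (\<Sum>i<m. (w i ^ (2 * m)) ^ k) \<le> C * (real q ^ m) ^ k"
        using C[of k] k by (simp add: power_mult)
    qed simp
    also have "real q ^ m = sqrt (real q) ^ (2 * m)" by (simp add: power_mult)
    finally have "cmod (w i) ^ (2 * m) \<le> sqrt (real q) ^ (2 * m)" by (simp add: norm_power)
    then show ?thesis using m_pos by (simp add: power_mono_iff)
  qed
  then have "cmod (\<Sum>i<m. w i) \<le> (\<Sum>i<m. sqrt (real q))" by (intro sum_norm_le) auto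
  then show ?thesis using w[of 1] by (simp add: point_sum_1[symmetric])
qed

end

section \<open>Embedding a field into a type\<close>

lemma field_cring: "field R \<Longrightarrow> cring R"
  using field.axioms(1) domain.axioms(1) by blast

lemma field_ring_laws:
  assumes "field R"
  shows "\<zero>\<^bsub>R\<^esub> \<in> carrier R" "\<one>\<^bsub>R\<^esub> \<in> carrier R"
    "x \<in> carrier R \<Longrightarrow> y \<in> carrier R \<Longrightarrow> x \<oplus>\<^bsub>R\<^esub> y \<in> carrier R"
    "x \<in> carrier R \<Longrightarrow> y \<in> carrier R \<Longrightarrow> x \<otimes>\<^bsub>R\<^esub> y \<in> carrier R"
    "x \<in> carrier R \<Longrightarrow> \<ominus>\<^bsub>R\<^esub> x \<in> carrier R"
    "x \<in> carrier R \<Longrightarrow> y \<in> carrier R \<Longrightarrow> z \<in> carrier R \<Longrightarrow> x \<oplus>\<^bsub>R\<^esub> y \<oplus>\<^bsub>R\<^esub> z = x \<oplus>\<^bsub>R\<^esub> (y \<oplus>\<^bsub>R\<^esub> z)"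
    "x \<in> carrier R \<Longrightarrow> y \<in> carrier R \<Longrightarrow> z \<in> carrier R \<Longrightarrow> x \<otimes>\<^bsub>R\<^esub> y \<otimes>\<^bsub>R\<^esub> z = x \<otimes>\<^bsub>R\<^esub> (y \<otimes>\<^bsub>R\<^esub> z)"
    "x \<in> carrier R \<Longrightarrow> y \<in> carrier R \<Longrightarrow> z \<in> carrier R \<Longrightarrow> (x \<oplus>\<^bsub>R\<^esub> y) \<otimes>\<^bsub>R\<^esub> z = x \<otimes>\<^bsub>R\<^esub> z \<oplus>\<^bsub>R\<^esub> y \<otimes>\<^bsub>R\<^esub> z"
    "x \<in> carrier R \<Longrightarrow> y \<in> carrier R \<Longrightarrow> x \<oplus>\<^bsub>R\<^esub> y = y \<oplus>\<^bsub>R\<^esub> x"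
    "x \<in> carrier R \<Longrightarrow> y \<in> carrier R \<Longrightarrow> x \<otimes>\<^bsub>R\<^esub> y = y \<otimes>\<^bsub>R\<^esub> x"
    "x \<in> carrier R \<Longrightarrow> \<zero>\<^bsub>R\<^esub> \<oplus>\<^bsub>R\<^esub> x = x" "x \<in> carrier R \<Longrightarrow> \<one>\<^bsub>R\<^esub> \<otimes>\<^bsub>R\<^esub> x = x"
    "x \<in> carrier R \<Longrightarrow> x \<otimes>\<^bsub>R\<^esub> \<zero>\<^bsub>R\<^esub> = \<zero>\<^bsub>R\<^esub>" "x \<in> carrier R \<Longrightarrow> \<zero>\<^bsub>R\<^esub> \<otimes>\<^bsub>R\<^esub> x = \<zero>\<^bsub>R\<^esub>"
    "x \<in> carrier R \<Longrightarrow> (\<ominus>\<^bsub>R\<^esub> x) \<oplus>\<^bsub>R\<^esub> x = \<zero>\<^bsub>R\<^esub>"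
proof -
  interpret cring R using field_cring[OF assms] .
  show "\<zero>\<^bsub>R\<^esub> \<in> carrier R" "\<one>\<^bsub>R\<^esub> \<in> carrier R" by auto
  show "x \<in> carrier R \<Longrightarrow> y \<in> carrier R \<Longrightarrow> x \<oplus>\<^bsub>R\<^esub> y \<in> carrier R"
    "x \<in> carrier R \<Longrightarrow> y \<in> carrier R \<Longrightarrow> x \<otimes>\<^bsub>R\<^esub> y \<in> carrier R"
    "x \<in> carrier R \<Longrightarrow> \<ominus>\<^bsub>R\<^esub> x \<in> carrier R" by auto
  show "x \<in> carrier R \<Longrightarrow> y \<in> carrier R \<Longrightarrow> z \<in> carrier R \<Longrightarrow> x \<oplus>\<^bsub>R\<^esub> y \<oplus>\<^bsub>R\<^esub> z = x \<oplus>\<^bsub>R\<^esub> (y \<oplus>\<^bsub>R\<^esub> z)"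
    by (rule a_assoc)
  show "x \<in> carrier R \<Longrightarrow> y \<in> carrier R \<Longrightarrow> z \<in> carrier R \<Longrightarrow> x \<otimes>\<^bsub>R\<^esub> y \<otimes>\<^bsub>R\<^esub> z = x \<otimes>\<^bsub>R\<^esub> (y \<otimes>\<^bsub>R\<^esub> z)"
    by (rule m_assoc)
  show "x \<in> carrier R \<Longrightarrow> y \<in> carrier R \<Longrightarrow> z \<in> carrier R \<Longrightarrow> (x \<oplus>\<^bsub>R\<^esub> y) \<otimes>\<^bsub>R\<^esub> z = x \<otimes>\<^bsub>R\<^esub> z \<oplus>\<^bsub>R\<^esub> y \<otimes>\<^bsub>R\<^esub> z"
    by (rule l_distr)
  show "x \<in> carrier R \<Longrightarrow> y \<in> carrier R \<Longrightarrow> x \<oplus>\<^bsub>R\<^esub> y = y \<oplus>\<^bsub>R\<^esub> x" by (rule a_comm)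
  show "x \<in> carrier R \<Longrightarrow> y \<in> carrier R \<Longrightarrow> x \<otimes>\<^bsub>R\<^esub> y = y \<otimes>\<^bsub>R\<^esub> x" by (rule m_comm)
  show "x \<in> carrier R \<Longrightarrow> \<zero>\<^bsub>R\<^esub> \<oplus>\<^bsub>R\<^esub> x = x" "x \<in> carrier R \<Longrightarrow> \<one>\<^bsub>R\<^esub> \<otimes>\<^bsub>R\<^esub> x = x"
    "x \<in> carrier R \<Longrightarrow> x \<otimes>\<^bsub>R\<^esub> \<zero>\<^bsub>R\<^esub> = \<zero>\<^bsub>R\<^esub>" "x \<in> carrier R \<Longrightarrow> \<zero>\<^bsub>R\<^esub> \<otimes>\<^bsub>R\<^esub> x = \<zero>\<^bsub>R\<^esub>"
    "x \<in> carrier R \<Longrightarrow> (\<ominus>\<^bsub>R\<^esub> x) \<oplus>\<^bsub>R\<^esub> x = \<zero>\<^bsub>R\<^esub>"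
    by (auto simp: l_neg)
qed

text \<open>
  The product of all fields on \<open>'b\<close>, and of the integers, which only serve to make it nontrivial.
  The idempotents of its factors exhibit every field on \<open>'b\<close> as an ideal \<open>e * R\<close> of one and the same ring.
\<close>

typedef 'b field_product =
  "{f :: 'b ring \<Rightarrow> 'b. \<forall>R. if field R then f R \<in> carrier R else f R = undefined} \<times> (UNIV :: int set)"
proof -
  have "\<exists>f :: 'b ring \<Rightarrow> 'b. \<forall>R. if field R then f R \<in> carrier R else f R = undefined"
    by (rule exI[of _ "\<lambda>R. if field R then \<zero>\<^bsub>R\<^esub> else undefined"])
      (simp add: field_ring_laws)
  then show ?thesis by auto
qed

setup_lifting type_definition_field_product

instantiation field_product :: (type) comm_ring_1
begin

lift_definition zero_field_product :: "'a field_product" is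
  "(\<lambda>R. if field R then \<zero>\<^bsub>R\<^esub> else undefined, 0)"
  by (auto simp: field_ring_laws)

lift_definition one_field_product :: "'a field_product" is
  "(\<lambda>R. if field R then \<one>\<^bsub>R\<^esub> else undefined, 1)"
  by (auto simp: field_ring_laws)

lift_definition plus_field_product :: "'a field_product \<Rightarrow> 'a field_product \<Rightarrow> 'a field_product" is
  "\<lambda>(f, a) (g, b). (\<lambda>R. if field R then f R \<oplus>\<^bsub>R\<^esub> g R else undefined, a + b)"
  by (auto simp: field_ring_laws)

lift_definition times_field_product :: "'a field_product \<Rightarrow> 'a field_product \<Rightarrow> 'a field_product" is
  "\<lambda>(f, a) (g, b). (\<lambda>R. if field R then f R \<otimes>\<^bsub>R\<^esub> g R else undefined, a * b)"
  by (auto simp: field_ring_laws)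

lift_definition uminus_field_product :: "'a field_product \<Rightarrow> 'a field_product" is
  "\<lambda>(f, a). (\<lambda>R. if field R then \<ominus>\<^bsub>R\<^esub> f R else undefined, - a)"
  by (auto simp: field_ring_laws)

definition minus_field_product :: "'a field_product \<Rightarrow> 'a field_product \<Rightarrow> 'a field_product" where
  "minus_field_product x y = x + - y"

instance
proof
  fix a b c :: "'a field_product"
  show "a + b + c = a + (b + c)"
    by transfer (auto simp: fun_eq_iff field_ring_laws(6) algebra_simps)
  show "a + b = b + a"
    by transfer (auto simp: fun_eq_iff field_ring_laws(9) algebra_simps)
  show "0 + a = a"
    by transfer (auto simp: fun_eq_iff field_ring_laws(11))
  show "- a + a = 0"
    by transfer (auto simp: fun_eq_iff field_ring_laws(15))
  show "a * b * c = a * (b * c)"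
    by transfer (auto simp: fun_eq_iff field_ring_laws(7) algebra_simps)
  show "a * b = b * a"
    by transfer (auto simp: fun_eq_iff field_ring_laws(10) algebra_simps)
  show "1 * a = a"
    by transfer (auto simp: fun_eq_iff field_ring_laws(12))
  show "(a + b) * c = a * c + b * c"
    by transfer (auto simp: fun_eq_iff field_ring_laws(8) algebra_simps)
  show "(0::'a field_product) \<noteq> 1"
    by transfer simp
  show "a - b = a + - b" by (rule minus_field_product_def)
qed

end

locale field_factor = field R for R :: "'b ring" (structure)
begin

lift_definition factor :: "'b field_product \<Rightarrow> 'b" is "\<lambda>(f, a). f R" .

lift_definition embed :: "'b \<Rightarrow> 'b field_product" is
  "\<lambda>x. (\<lambda>S. if S = R then (if x \<in> carrier R then x else \<zero>) else if field S then \<zero>\<^bsub>S\<^esub> else undefined, 0)"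
  using field_axioms by (auto simp: field_ring_laws)

lemma factor_closed [simp]: "factor z \<in> carrier R"
  using field_axioms by transfer auto

lemma factor_hom:
  "factor 0 = \<zero>" "factor (z + w) = factor z \<oplus> factor w" "factor (z * w) = factor z \<otimes> factor w"
  using field_axioms by (transfer, auto)+

lemma factor_embed [simp]: "x \<in> carrier R \<Longrightarrow> factor (embed x) = x"
  by transfer auto

lemma embed_hom:
  assumes "x \<in> carrier R" "y \<in> carrier R"
  shows "embed (x \<oplus> y) = embed x + embed y" "embed (x \<otimes> y) = embed x * embed y"
  using assms field_axioms by (transfer, force simp: fun_eq_iff field_ring_laws)+

lemma embed_zero: "embed \<zero> = 0"
  using field_axioms by transfer (auto simp: fun_eq_iff)

text \<open>This identifies the image of \<open>embed\<close> with the ideal generated by the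
  idempotent \<open>embed \<one>\<close>.\<close>

lemma embed_factor: "embed (factor z) = z * embed \<one>"
  using field_axioms by transfer (force simp: fun_eq_iff field_ring_laws)

lemma embed_one_mult: "x \<in> carrier R \<Longrightarrow> embed x * embed \<one> = embed x"
  using embed_factor[of "embed x"] by simp

lemma eval_factor:
  assumes "x \<in> carrier R"
  shows "factor (poly p (embed x)) = eval (map factor (rev (coeffs p))) x"
proof (induction p)
  case (pCons a p)
  have "coeffs (pCons a p) = a # coeffs p" using pCons(1) by (auto simp: cCons_def)
  show ?case
  proof -
    define l where "l = map factor (rev (coeffs p))"
    have l: "set l \<subseteq> carrier R" by (auto simp: l_def)
    have "factor (poly (pCons a p) (embed x)) = factor a \<oplus> x \<otimes> eval l x"
      using pCons(2) assms by (simp add: factor_hom l_def)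
    also have "\<dots> = eval l x \<otimes> x \<oplus> factor a"
      using eval_in_carrier[OF l assms] assms by (simp add: m_comm a_comm)
    also have "\<dots> = eval (l @ [factor a]) x"
      using eval_append_aux[OF l factor_closed assms] by simp
    finally show ?thesis using \<open>coeffs (pCons a p) = a # coeffs p\<close> by (simp add: l_def)
  qed
qed (simp add: factor_hom)

end

text \<open>\<open>factor\<close> and \<open>embed\<close> identify the ideal with \<open>R\<close>:
  inverses come from the units of \<open>R\<close>, and a root comes from the splitting of the
  polynomial with projected coefficients.\<close>

lemma closed_corner_embed:
  fixes R :: "'b ring"
  assumes "algebraically_closed R"
  shows "closed_corner (field_factor.embed R \<one>\<^bsub>R\<^esub>)"
proof -
  interpret algebraically_closed R by fact
  interpret field_factor R by unfold_locales
  show ?thesis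
  proof
    show "embed \<one>\<^bsub>R\<^esub> * embed \<one>\<^bsub>R\<^esub> = embed \<one>\<^bsub>R\<^esub>" by (rule embed_one_mult) simp
    show "embed \<one>\<^bsub>R\<^esub> \<noteq> 0"
      using factor_embed[of "\<one>\<^bsub>R\<^esub>"] factor_hom(1) by (metis one_closed zero_not_one)
  next
    fix x :: "'b field_product" assume x: "x * embed \<one>\<^bsub>R\<^esub> = x" "x \<noteq> 0"
    define a where "a = factor x"
    have xa: "x = embed a" using x(1) embed_factor[of x] by (simp add: a_def)
    have "a \<in> carrier R" by (simp add: a_def)
    moreover have "a \<noteq> \<zero>\<^bsub>R\<^esub>" using x(2) xa embed_zero by metis
    ultimately have "a \<in> Units R" by (simp add: field_Units)
    then have "embed a * embed (inv\<^bsub>R\<^esub> a) = embed \<one>\<^bsub>R\<^esub>"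
      using embed_hom(2)[of a "inv\<^bsub>R\<^esub> a"] by (simp add: Units_closed)
    then show "\<exists>y. x * y = embed \<one>\<^bsub>R\<^esub>" using xa by blast
  next
    fix p :: "'b field_product poly"
    assume p: "Polynomial.smult (embed \<one>\<^bsub>R\<^esub>) p = p" "degree p > 0"
    \<comment> \<open>Polynomials over \<open>R\<close> are lists with the leading coefficient
      first, hence the reversal.\<close>
    define l where "l = map factor (rev (coeffs p))"
    have emb: "embed (factor z) = z" if "embed \<one>\<^bsub>R\<^esub> * z = z" for z
      using embed_factor[of z] that by (simp add: mult.commute)
    have p0: "p \<noteq> 0" using p(2) by auto
    have "embed (factor (lead_coeff p)) = lead_coeff p"
      by (rule emb) (metis p(1) coeff_smult)
    then have lc: "factor (lead_coeff p) \<noteq> \<zero>\<^bsub>R\<^esub>" using p0 embed_zero by (metis leading_coeff_0_iff)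
    have len: "length l = Suc (degree p)" using p0 by (simp add: l_def length_coeffs_degree)
    have "hd l = factor (lead_coeff p)"
      using p0 by (simp add: l_def hd_map hd_rev last_coeffs_eq_coeff_degree)
    then have "polynomial\<^bsub>R\<^esub> (carrier R) l"
      using lc by (auto simp: polynomial_def l_def)
    then have "splitted l" by (intro roots_over_carrier) (simp add: univ_poly_carrier[symmetric])
    then have "roots l \<noteq> {#}" using len p(2) by (auto simp: splitted_def)
    then obtain x where "x \<in># roots l" by blast
    then have x: "x \<in> carrier R" "eval l x = \<zero>\<^bsub>R\<^esub>"
      using roots_mem_iff_is_root[of l] \<open>polynomial\<^bsub>R\<^esub> (carrier R) l\<close>
      by (auto simp: univ_poly_carrier is_root_def)
    have "embed (factor (poly p (embed x))) = poly p (embed x)"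
      by (rule emb) (metis p(1) poly_smult)
    then have "poly p (embed x) = 0"
      using eval_factor[OF x(1), of p] x(2) embed_zero by (simp add: l_def)
    then show "\<exists>x. x * embed \<one>\<^bsub>R\<^esub> = x \<and> poly p x = 0" using embed_one_mult[OF x(1)] by blast
  qed
qed

lemma hom_circle_one:
  assumes "f \<in> hom G circle_group" "\<one>\<^bsub>G\<^esub> \<in> carrier G" "\<one>\<^bsub>G\<^esub> \<otimes>\<^bsub>G\<^esub> \<one>\<^bsub>G\<^esub> = \<one>\<^bsub>G\<^esub>"
  shows "f \<one>\<^bsub>G\<^esub> = 1"
proof -
  have "f \<one>\<^bsub>G\<^esub> * f \<one>\<^bsub>G\<^esub> = f \<one>\<^bsub>G\<^esub>" "cmod (f \<one>\<^bsub>G\<^esub>) = 1"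
    using assms hom_mult[OF assms(1,2,2)] hom_in_carrier[OF assms(1,2)] by (auto simp: circle_group_def)
  then show ?thesis by (metis mult_cancel_left2 norm_zero zero_neq_one)
qed

section \<open>Transfer of the bound along an embedding of F into its algebraic closure\<close>

theorem theorem1p6:
  fixes F :: "('a, 'b) ring_scheme" (structure)
    and K :: "'a set"
    and q m :: nat
    and \<chi> \<psi> :: "'a \<Rightarrow> complex"
    and \<theta> :: 'a
  assumes "primepow q" and "m > 0"
    and "field F" and "card (carrier F) = q ^ m"
    and "subfield K F" and "card K = q"
    and "multiplicative_character F \<chi>"
    and "additive_character (F\<lparr>carrier := K\<rparr>) \<psi>"
    and "\<not> (trivial_multiplicative F \<chi> \<and>
            trivial_additive (F\<lparr>carrier := K\<rparr>) \<psi>)"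
    and "\<theta> \<in> carrier F"
    and "generate_field F (insert \<theta> K) = carrier F"
  shows "cmod (\<Sum>t\<in>K. \<chi> (\<theta> \<oplus> t) * \<psi> t) \<le> real m * sqrt (real q)"
proof -
  interpret F: field F by fact
  obtain A :: "((('a list \<times> nat) multiset) \<Rightarrow> 'a) ring"
    where A: "algebraic_closure A (F.indexed_const ` carrier F)" and cA: "F.indexed_const \<in> ring_hom F A"
    using F.exists_closure by blast
  interpret A: algebraic_closure A "F.indexed_const ` carrier F" by fact
  interpret R: field_factor A by unfold_locales
  define e where "e = R.embed \<one>\<^bsub>A\<^esub>"
  define j where "j x = R.embed (F.indexed_const x)" for x
  interpret closed_corner e
    unfolding e_def by (rule closed_corner_embed) unfold_locales
  have c_closed: "F.indexed_const x \<in> carrier A" if "x \<in> carrier F" for x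
    using cA that by (rule ring_hom_closed)
  have j_add: "j (x \<oplus> y) = j x + j y" and j_mult: "j (x \<otimes> y) = j x * j y"
    if "x \<in> carrier F" "y \<in> carrier F" for x y
    using that by (simp_all add: j_def ring_hom_add[OF cA] ring_hom_mult[OF cA] R.embed_hom c_closed)
  have j_one: "j \<one> = e" by (simp add: j_def e_def ring_hom_one[OF cA])
  have j_L: "j x \<in> L" if "x \<in> carrier F" for x
  proof -
    have "j x * e = j x" using R.embed_one_mult[OF c_closed[OF that]] by (simp add: j_def e_def)
    then show ?thesis by (simp add: L_def)
  qed
  have inj: "inj_on j (carrier F)"
  proof (rule inj_onI)
    fix x y assume xy: "x \<in> carrier F" "y \<in> carrier F" "j x = j y"
    have "R.factor (j x) = R.factor (j y)" using xy(3) by simp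
    then have "(F.indexed_const x :: ('a list \<times> nat) multiset \<Rightarrow> 'a) = F.indexed_const y" using xy(1,2) by (simp add: j_def c_closed)
    then show "x = y" using inj_onD[OF F.indexed_const_inj_on] xy(1,2) by blast
  qed
  have j_zero: "j \<zero> = 0" using j_add[of "\<zero>" "\<zero>"] by simp
  have j_eq_0: "x = \<zero>" if "x \<in> carrier F" "j x = 0" for x
    using inj_onD[OF inj, of x "\<zero>"] that j_zero by simp
  have j_minus: "j (\<ominus> x) = - j x" if "x \<in> carrier F" for x
    using j_add[of "\<ominus> x" x] that j_zero by (simp add: F.l_neg eq_neg_iff_add_eq_0)
  have KF: "K \<subseteq> carrier F" using subfieldE(3)[OF assms(5)] .
  have K_sub: "subring K F" using subfieldE(1)[OF assms(5)] .
  have K_closed: "\<one> \<in> K" "\<zero> \<in> K" "\<And>x. x \<in> K \<Longrightarrow> \<ominus> x \<in> K"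
    "\<And>x y. x \<in> K \<Longrightarrow> y \<in> K \<Longrightarrow> x \<oplus> y \<in> K" "\<And>x y. x \<in> K \<Longrightarrow> y \<in> K \<Longrightarrow> x \<otimes> y \<in> K"
    using subringE[OF K_sub] by auto
  \<comment> \<open>Applied twice: to \<open>K\<close> with \<open>q\<close> and to the whole of
    \<open>F\<close> with \<open>q ^ m\<close>.\<close>
  have corner: "finite_corner e (j ` S) n"
    if S: "S \<subseteq> carrier F" "\<one> \<in> S" "\<And>x. x \<in> S \<Longrightarrow> \<ominus> x \<in> S" "\<And>x y. x \<in> S \<Longrightarrow> y \<in> S \<Longrightarrow> x \<oplus> y \<in> S"
      "\<And>x y. x \<in> S \<Longrightarrow> y \<in> S \<Longrightarrow> x \<otimes> y \<in> S" "card S = n" "primepow n" for S n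
  proof
    show "j ` S \<subseteq> L" using S(1) j_L by auto
    show "e \<in> j ` S" using S(2) j_one by (metis image_eqI)
    show "card (j ` S) = n" using S(1,6) inj by (metis card_image inj_on_subset)
    show "primepow n" by fact
  next
    fix x y assume "x \<in> j ` S" "y \<in> j ` S"
    then obtain a b where ab: "a \<in> S" "b \<in> S" "x = j a" "y = j b" by blast
    have carr: "a \<in> carrier F" "b \<in> carrier F" using ab S(1) by auto
    then have "x - y = j (a \<oplus> \<ominus> b)" using ab j_add[of a "\<ominus> b"] j_minus[of b] by simp
    then show "x - y \<in> j ` S" using ab S(3,4) by blast
    have "x * y = j (a \<otimes> b)" using ab j_mult[OF carr] by simp
    then show "x * y \<in> j ` S" using ab S(5) by blast
  qed
  interpret finite_corner e "j ` K" q
    by (rule corner) (use KF K_closed assms in auto)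
  \<comment> \<open>\<open>E 1\<close> formed with \<open>q ^ m\<close> in place of \<open>q\<close>
    is \<open>E m\<close>, so \<open>K_eq_E1\<close> applies to the image of
    \<open>F\<close>.\<close>
  have E_m: "E m = j ` carrier F"
  proof -
    interpret F': finite_corner e "j ` carrier F" "q ^ m"
      by (rule corner) (use assms primepow_power_iff_nat in auto)
    show ?thesis using F'.K_eq_E1 by (simp add: E_def F'.E_def)
  qed
  have theta: "j \<theta> \<in> E m" using assms(10) by (simp add: E_m)
  \<comment> \<open>If a smaller Frobenius power fixed \<theta>, everything generated by \<theta>
    and \<open>K\<close>, hence all of \<open>F\<close>, would be mapped into \<open>E i\<close>,
    which has only \<open>q ^ i\<close> elements.\<close>
  have distinct: "j \<theta> ^ (q ^ i) \<noteq> j \<theta>" if i: "0 < i" "i < m" for i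
  proof
    assume "j \<theta> ^ (q ^ i) = j \<theta>"
    then have th: "j \<theta> \<in> E i" using j_L assms(10) by (simp add: E_def)
    have "x \<in> carrier F \<and> j x \<in> E i" if "x \<in> generate_field F (insert \<theta> K)" for x
      using that
    proof (induction rule: generate_field.induct)
      case one
      show ?case by (simp add: j_one)
    next
      case (incl h)
      have "j h \<in> E i" if "h \<in> K"
        using that by (intro K_E) simp
      then show ?case using incl th assms(10) KF by auto
    next
      case (a_inv h)
      then show ?case by (simp add: j_minus E_minus)
    next
      case (m_inv h)
      then have h: "h \<in> carrier F" "j h \<in> E i" "j h \<noteq> 0" using j_eq_0[of h] by blast+
      have u: "h \<in> Units F" using m_inv h by (simp add: F.field_Units)
      have hi: "inv h \<in> carrier F" using u by (rule F.Units_inv_closed)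
      have "j h * j (inv h) = e" using j_mult[OF h(1) hi] u j_one by simp
      moreover obtain y where y: "y \<in> E i" "j h * y = e" using E_inverse[OF h(2,3)] by blast
      ultimately have "j (inv h) = y"
        using L_mult_cancel[of "j (inv h)" y "j h"] h hi j_L E_L by simp
      then show ?case using y hi by simp
    next
      case (eng_add h1 h2)
      then show ?case by (simp add: j_add E_add)
    next
      case (eng_mult h1 h2)
      then show ?case by (simp add: j_mult E_mult)
    qed
    then have "j ` carrier F \<subseteq> E i" using assms(11) by blast
    then have "card (j ` carrier F) \<le> card (E i)" using i finite_E by (intro card_mono) auto
    then have "q ^ m \<le> q ^ i" using assms(4) inj i by (simp add: card_image card_E)
    moreover have "q ^ i < q ^ m" using i q_gt1 by (intro power_strict_increasing) auto
    ultimately show False by simp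
  qed
  define k where "k = the_inv_into (carrier F) j"
  have k: "k (j x) = x" if "x \<in> carrier F" for x
    using inj that by (simp add: k_def the_inv_into_f_f)
  have chi: "\<chi> \<in> hom (Multiplicative_Group.mult_of F) circle_group" "\<chi> \<zero> = (if trivial_multiplicative F \<chi> then 1 else 0)"
    using assms(7) by (auto simp: multiplicative_character_def)
  have psi: "\<psi> \<in> hom (add_monoid (F\<lparr>carrier := K\<rparr>)) circle_group"
    using assms(8) by (simp add: additive_character_def)
  have chi_one: "\<chi> \<one> = 1" using hom_circle_one[OF chi(1)] by simp
  have chi_triv: "\<chi> x = 1" if "trivial_multiplicative F \<chi>" "x \<in> carrier F" for x
    using that chi(2) by (cases "x = \<zero>") (auto simp: trivial_multiplicative_def trivial_character_def)
  \<comment> \<open>The convention at zero keeps \<chi> multiplicative in both cases: the trivial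
    character is 1 throughout, and for a nontrivial one both sides are 0.\<close>
  have chi_mult: "\<chi> (x \<otimes> y) = \<chi> x * \<chi> y" if xy: "x \<in> carrier F" "y \<in> carrier F" for x y
  proof (cases "x = \<zero> \<or> y = \<zero>")
    case True
    then show ?thesis using xy chi_triv chi(2) by (cases "trivial_multiplicative F \<chi>") auto
  next
    case False
    then show ?thesis using hom_mult[OF chi(1), of x y] xy by (simp add: circle_group_def)
  qed
  have chi_norm: "cmod (\<chi> x) \<le> 1" if x: "x \<in> carrier F" for x
    using hom_in_carrier[OF chi(1), of x] x chi(2) by (cases "x = \<zero>") (auto simp: circle_group_def)
  have psi_zero: "\<psi> \<zero> = 1" using hom_circle_one[OF psi] K_closed by simp
  have psi_add: "\<psi> (x \<oplus> y) = \<psi> x * \<psi> y" if "x \<in> K" "y \<in> K" for x y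
    using hom_mult[OF psi, of x y] that by (simp add: circle_group_def)
  have psi_norm: "cmod (\<psi> x) \<le> 1" if "x \<in> K" for x
    using hom_in_carrier[OF psi, of x] that by (simp add: circle_group_def)
  interpret character_corner e "j ` K" q m "j \<theta>" "\<lambda>x. \<chi> (k x)" "\<lambda>x. \<psi> (k x)"
  proof
    show "m > 0" "j \<theta> \<in> E m" by fact+
    show "j \<theta> ^ (q ^ i) \<noteq> j \<theta>" if "0 < i" "i < m" for i using distinct that .
    show "\<chi> (k e) = 1" using k[of \<one>] j_one chi_one by simp
    show "\<psi> (k 0) = 1" using k[of \<zero>] j_zero psi_zero by simp
    show "\<chi> (k (x * y)) = \<chi> (k x) * \<chi> (k y)" if "x \<in> E m" "y \<in> E m" for x y
      using that by (auto simp: E_m k chi_mult j_mult[symmetric])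
    show "cmod (\<chi> (k x)) \<le> 1" if "x \<in> E m" for x using that by (auto simp: E_m k chi_norm)
    show "\<psi> (k (x + y)) = \<psi> (k x) * \<psi> (k y)" if xy: "x \<in> j ` K" "y \<in> j ` K" for x y
    proof -
      obtain a b where ab: "a \<in> K" "b \<in> K" "x = j a" "y = j b" using xy by blast
      then have "a \<in> carrier F" "b \<in> carrier F" using KF by auto
      then show ?thesis using ab by (simp add: k j_add[symmetric] psi_add)
    qed
    show "cmod (\<psi> (k x)) \<le> 1" if "x \<in> j ` K" for x using that KF by (auto simp: k psi_norm subset_iff)
    \<comment> \<open>If \<psi> is trivial then \<chi> is not, so \<open>\<chi> \<zero> = 0\<close>
      by the convention at zero.\<close>
    show "(\<exists>x\<in>j ` K. \<psi> (k x) \<noteq> 1) \<or> (\<chi> (k 0) = 0 \<and> (\<exists>x\<in>E m. x \<noteq> 0 \<and> \<chi> (k x) \<noteq> 1))"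
    proof (cases "trivial_additive (F\<lparr>carrier := K\<rparr>) \<psi>")
      case False
      then obtain x where "x \<in> K" "\<psi> x \<noteq> 1"
        by (auto simp: trivial_additive_def trivial_character_def)
      then show ?thesis using KF by (auto simp: k subset_iff)
    next
      case True
      then have nt: "\<not> trivial_multiplicative F \<chi>" using assms(9) by blast
      then obtain x where x: "x \<in> carrier F" "x \<noteq> \<zero>" "\<chi> x \<noteq> 1"
        by (auto simp: trivial_multiplicative_def trivial_character_def)
      have "j x \<noteq> 0" using x j_eq_0 by blast
      moreover have "\<chi> (k 0) = 0" using k[of \<zero>] j_zero chi(2) nt by simp
      ultimately show ?thesis using x by (auto simp: E_m k)
    qed
  qed
  have "(\<Sum>t\<in>j ` K. \<chi> (k (j \<theta> + t)) * \<psi> (k t)) = (\<Sum>t\<in>K. \<chi> (k (j \<theta> + j t)) * \<psi> (k (j t)))"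
    using inj KF by (subst sum.reindex) (auto intro: inj_on_subset)
  also have "\<dots> = (\<Sum>t\<in>K. \<chi> (\<theta> \<oplus> t) * \<psi> t)"
  proof (rule sum.cong[OF HOL.refl])
    fix t assume "t \<in> K"
    then have "t \<in> carrier F" using KF by blast
    then show "\<chi> (k (j \<theta> + j t)) * \<psi> (k (j t)) = \<chi> (\<theta> \<oplus> t) * \<psi> t"
      using assms(10) by (simp add: k j_add[symmetric])
  qed
  finally show ?thesis using character_sum_bound by simp
qed

end
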